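(* Let $n\ge2$, let $\Omega\subset\mathbb R^n$ be a bounded domain with smooth boundary containing the origin $\mathbf 0$, and let $\Omega_0=\Omega\setminus\{\mathbf 0\}$. If a function $u(x)$ is harmonic in $\Omega_0$, then it has a $\sigma$-trace $\sigma u|_0$ at the point $\mathbf 0$, and this $\sigma$-trace belongs to the space $A(\Theta)$. Conversely, for each function $\psi\in A(\Theta)$ there exists a function $u(x)$ harmonic in $\Omega_0$ such that $\sigma u|_0=\psi$, and it is unique up to a function harmonic in a neighborhood of $\mathbf 0$.
   Context: $\Theta$ is the unit sphere of $\mathbb R^n$; $r=|x|$, $\vartheta=x/|x|$; $Y_{k,l}$ ($k=0,1,\dots$; $l=1,\dots,d_k$) is an orthonormal basis of $L_2(\Theta)$ of spherical harmonics of order $k$. $A(\Theta)$ is the space of functions $\psi$ on $\Theta$ such that, with $\psi_{k,l}=\int_\Theta\psi Y_{k,l}\,d\vartheta$, one has $\psi=\sum\psi_{k,l}Y_{k,l}$ and $\|\psi\|_h=(\sum_{k,l}|\psi_{k,l}|^2h^{-2k})^{1/2}<\infty$ for every $h\in(0,1)$. The $\sigma$-trace of a function $u$ at $\mathbf 0$ is the limit function on $\Theta$ $$\sigma u|_0(\vartheta)=\lim_{r\to+0}r^{n-2}\int_\Theta u(r,\vartheta')K_n(r\vartheta,\vartheta')\,d\vartheta',\qquad K_n(x,y)=\frac{\Gamma(\frac n2)}{2\pi^{n/2}}\frac{1-|x|^2}{|x-y|^n},\qquad n\ge3,$$ and, in polar coordinates for $n=2$, $$\sigma u|_0(\varphi)=\lim_{r\to+0}\frac1{2\pi}\int_{-\pi}^{\pi}u(r,\varphi')\left(\frac{2r\cos(\varphi-\varphi')-2r^2}{1-2r\cos(\varphi-\varphi')+r^2}+\frac1{\ln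 r}\right)d\varphi'.$$ *)

theory Defs
  imports "HOL-Analysis.Analysis"
begin

section \<open>Smooth and harmonic functions\<close>

text \<open>\<^term>\<open>frechet_derivative f (at x) i\<close> is the directional derivative of \<open>f\<close> at \<open>x\<close> in the
  direction \<open>i\<close>, hence a partial derivative for \<open>i \<in> Basis\<close>.\<close>

primrec times_cont_diff_on :: "nat \<Rightarrow> ('a::euclidean_space \<Rightarrow> real) \<Rightarrow> 'a set \<Rightarrow> bool" where
  "times_cont_diff_on 0 f S \<longleftrightarrow> continuous_on S f"
| "times_cont_diff_on (Suc k) f S \<longleftrightarrow>
     (\<forall>x\<in>S. f differentiable (at x)) \<and>
     (\<forall>i\<in>Basis. times_cont_diff_on k (\<lambda>x. frechet_derivative f (at x) i) S)"

definition smooth_on :: "('a::euclidean_space \<Rightarrow> real) \<Rightarrow> 'a set \<Rightarrow> bool" where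
  "smooth_on f S \<longleftrightarrow> (\<forall>k. times_cont_diff_on k f S)"

definition laplacian :: "('a::euclidean_space \<Rightarrow> real) \<Rightarrow> 'a \<Rightarrow> real" where
  "laplacian f x =
     (\<Sum>i\<in>Basis. frechet_derivative (\<lambda>y. frechet_derivative f (at y) i) (at x) i)"

definition harmonic_on :: "('a::euclidean_space \<Rightarrow> real) \<Rightarrow> 'a set \<Rightarrow> bool" where
  "harmonic_on f S \<longleftrightarrow>
     open S \<and> times_cont_diff_on 2 f S \<and> (\<forall>x\<in>S. laplacian f x = 0)"

text \<open>Near each boundary point the set is the sublevel set of a smooth function without
  critical points; the boundary is then locally the zero set of that function.\<close>

definition smooth_boundary :: "'a::euclidean_space set \<Rightarrow> bool" where
  "smooth_boundary S \<longleftrightarrow>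
     (\<forall>p\<in>frontier S. \<exists>U \<rho>. open U \<and> p \<in> U \<and> smooth_on \<rho> U \<and>
        (\<forall>x\<in>U. \<exists>i\<in>Basis. frechet_derivative \<rho> (at x) i \<noteq> 0) \<and>
        S \<inter> U = {x\<in>U. \<rho> x < 0})"


section \<open>The unit sphere and spherical harmonics\<close>

text \<open>Surface measure of the unit sphere as the cone measure: the area of \<open>A\<close> is \<open>n\<close> times the volume
  of \<open>{t *\<^sub>R x | 0 < t < 1, x \<in> A}\<close>, which is how the surface measure arises from Lebesgue measure in
  polar coordinates. It is not normalised: its total mass is \<open>n\<close> times the volume of the unit
  ball.\<close>

definition sphere_measure :: "'a::euclidean_space measure" where
  "sphere_measure =
     scale_measure (of_nat DIM('a))
       (distr (restrict_space lborel (ball 0 1 - {0})) (restrict_space borel (sphere 0 1))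
          (\<lambda>x. x /\<^sub>R norm x))"

definition spherical_harmonic :: "nat \<Rightarrow> ('a::euclidean_space \<Rightarrow> real) \<Rightarrow> bool" where
  "spherical_harmonic k f \<longleftrightarrow>
     (\<exists>P. real_polynomial_function P \<and> (\<forall>t x. P (t *\<^sub>R x) = t ^ k * P x) \<and>
          harmonic_on P UNIV \<and> (\<forall>x\<in>sphere 0 1. f x = P x))"

definition harmonic_index :: "(nat \<Rightarrow> nat) \<Rightarrow> (nat \<times> nat) set" where
  "harmonic_index d = (SIGMA k:UNIV. {1..d k})"

text \<open>The last conjunct is the density of the linear span in \<open>L\<^sub>2\<close> of the sphere. The number \<open>d k\<close> is
  forced to be the dimension of the space of spherical harmonics of order \<open>k\<close>, because spherical
  harmonics of different orders are orthogonal.\<close>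

definition spherical_harmonic_onb ::
    "(nat \<Rightarrow> nat) \<Rightarrow> (nat \<Rightarrow> nat \<Rightarrow> 'a::euclidean_space \<Rightarrow> real) \<Rightarrow> bool" where
  "spherical_harmonic_onb d Y \<longleftrightarrow>
     (\<forall>(k,l)\<in>harmonic_index d. spherical_harmonic k (Y k l)) \<and>
     (\<forall>(k,l)\<in>harmonic_index d. \<forall>(k',l')\<in>harmonic_index d.
        (LINT x|sphere_measure. Y k l x * Y k' l' x) = (if (k,l) = (k',l') then 1 else 0)) \<and>
     (\<forall>f. f \<in> borel_measurable sphere_measure \<and> integrable sphere_measure (\<lambda>x. (f x)\<^sup>2) \<longrightarrow>
        (\<forall>\<epsilon>>0. \<exists>F c. finite F \<and> F \<subseteq> harmonic_index d \<and>
           (LINT x|sphere_measure. (f x - (\<Sum>(k,l)\<in>F. c k l * Y k l x))\<^sup>2) < \<epsilon>))"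


section \<open>The space \<open>A(\<Theta>)\<close>\<close>

definition harmonic_coeff ::
    "(nat \<Rightarrow> nat \<Rightarrow> 'a::euclidean_space \<Rightarrow> real) \<Rightarrow> ('a \<Rightarrow> real) \<Rightarrow> nat \<Rightarrow> nat \<Rightarrow> real" where
  "harmonic_coeff Y \<psi> k l = (LINT x|sphere_measure. \<psi> x * Y k l x)"

text \<open>The expansion holds at every point of the sphere, not just almost everywhere, since the
  \<open>\<sigma>\<close>-trace is a pointwise limit. The values of \<open>\<psi>\<close> off the sphere are irrelevant.
  \<open>\<parallel>\<psi>\<parallel>\<^sub>h < \<infinity>\<close> is the summability of the nonnegative terms of its square.\<close>

definition A_space ::
    "(nat \<Rightarrow> nat) \<Rightarrow> (nat \<Rightarrow> nat \<Rightarrow> 'a::euclidean_space \<Rightarrow> real) \<Rightarrow> ('a \<Rightarrow> real) set" where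
  "A_space d Y = {\<psi>.
     integrable sphere_measure \<psi> \<and>
     (\<forall>x\<in>sphere 0 1.
        ((\<lambda>(k,l). harmonic_coeff Y \<psi> k l * Y k l x) has_sum \<psi> x) (harmonic_index d)) \<and>
     (\<forall>h\<in>{0<..<1}.
        (\<lambda>(k,l). \<bar>harmonic_coeff Y \<psi> k l\<bar>\<^sup>2 * h powi (- 2 * int k)) summable_on harmonic_index d)}"


section \<open>The \<open>\<sigma>\<close>-trace at the origin\<close>

definition poisson_kernel :: "'a::euclidean_space \<Rightarrow> 'a \<Rightarrow> real" where
  "poisson_kernel x y =
     Gamma (real DIM('a) / 2) / (2 * pi powr (real DIM('a) / 2)) *
     ((1 - (norm x)\<^sup>2) / norm (x - y) ^ DIM('a))"

definition polar :: "'a::euclidean_space \<Rightarrow> 'a \<Rightarrow> real \<Rightarrow> real \<Rightarrow> 'a" where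
  "polar e1 e2 r \<phi> = (r * cos \<phi>) *\<^sub>R e1 + (r * sin \<phi>) *\<^sub>R e2"

text \<open>In the plane, both orderings of the two basis vectors are admitted; the condition is the same
  for either, as the kernel depends only on \<open>cos (\<phi> - \<phi>')\<close>.\<close>

definition has_sigma_trace ::
    "('a::euclidean_space \<Rightarrow> real) \<Rightarrow> ('a \<Rightarrow> real) \<Rightarrow> bool" where
  "has_sigma_trace u \<psi> \<longleftrightarrow>
     (if DIM('a) = 2 then
        (\<forall>e1 e2. Basis = {e1, e2} \<and> e1 \<noteq> e2 \<longrightarrow>
          (\<forall>\<phi>. ((\<lambda>r. 1 / (2 * pi) *
                 (LBINT \<phi>'=-pi..pi. u (polar e1 e2 r \<phi>') *
                    ((2 * r * cos (\<phi> - \<phi>') - 2 * r\<^sup>2) / (1 - 2 * r * cos (\<phi> - \<phi>') + r\<^sup>2)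
                      + 1 / ln r)))
               \<longlongrightarrow> \<psi> (polar e1 e2 1 \<phi>)) (at_right 0)))
      else
        (\<forall>\<theta>\<in>sphere 0 1.
          ((\<lambda>r. r ^ (DIM('a) - 2) *
              (LINT \<theta>'|sphere_measure. u (r *\<^sub>R \<theta>') * poisson_kernel (r *\<^sub>R \<theta>) \<theta>'))
            \<longlongrightarrow> \<psi> \<theta>) (at_right 0)))"

end

theory Submission
  imports Defs
begin

text \<open>
  Write \<open>n\<close> for the dimension. Near the origin a function \<open>u\<close> harmonic off \<open>0\<close> splits as \<open>u = v + w\<close>, where
  \<open>v\<close> is harmonic across \<open>0\<close> and \<open>w x = \<bar>x\<bar>\<^sup>2\<^sup>-\<^sup>n W (x / \<bar>x\<bar>\<^sup>2)\<close> is the Kelvin transform of a function \<open>W\<close>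
  that is harmonic on the whole space; in the plane the value \<open>W 0\<close> has to be carried by a logarithm, and
  \<open>w x = W (x / \<bar>x\<bar>\<^sup>2) + W 0 (ln \<bar>x\<bar> - 1)\<close> (\<open>laurent_decomposition\<close>). On the sphere of radius \<open>r\<close> the
  function \<open>r\<^sup>n\<^sup>-\<^sup>2 w\<close> is \<open>\<theta>' \<mapsto> W (\<theta>' / r)\<close>, so the Poisson integral in the definition of the trace
  evaluates the harmonic function \<open>x \<mapsto> W (x / r)\<close> at the point \<open>r \<theta>\<close>: it equals \<open>W \<theta>\<close> for every \<open>r < 1\<close>,
  before any limit is taken. The Poisson integral of \<open>v\<close> is \<open>v (r\<^sup>2 \<theta>)\<close>, which the factor
  \<open>r\<^sup>n\<^sup>-\<^sup>2\<close> makes vanish in the limit. In the plane the given kernel is the Poisson kernel minus the mean value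
  plus the mean value divided by \<open>ln r\<close>, and in this combination the logarithm and the means cancel in the
  same way. Hence the trace of \<open>u\<close> is the restriction of \<open>W\<close> to the sphere.

  With \<open>P\<^sub>k\<^sub>l\<close> the homogeneous harmonic polynomial that extends \<open>Y\<^sub>k\<^sub>l\<close>, the functions
  \<open>W\<close> are the sums \<open>\<Sum> c\<^sub>k\<^sub>l P\<^sub>k\<^sub>l\<close> with \<open>\<Sum> (c\<^sub>k\<^sub>l)\<^sup>2 r\<^sup>2\<^sup>k < \<infinity>\<close> for all \<open>r\<close>, and
  their restrictions to the sphere form \<open>A(\<Theta>)\<close> (\<open>A_space_eq_entire_series\<close>). If the trace vanishes, then all
  coefficients of \<open>W\<close> vanish, hence \<open>w = 0\<close> and \<open>u = v\<close> near \<open>0\<close>; this is the uniqueness statement.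

  The analytic tool is the Poisson formula, obtained here from the maximum principle: Poisson integrals are
  harmonic, the kernel has mass one because its integral is a radial harmonic function, and the boundary values
  are attained uniformly. The formula gives closedness of harmonic functions under locally uniform limits, a
  bound of \<open>\<Sum> c\<^sub>k\<^sub>l P\<^sub>k\<^sub>l\<close> inside a ball by its coefficients alone, and, through the
  symmetry of the kernel, the uniform density of finite combinations of the \<open>Y\<^sub>k\<^sub>l\<close>. The maximum principle in an
  annulus then transfers the radial law \<open>\<alpha> r\<^sup>k + \<beta> r\<^sup>2\<^sup>-\<^sup>n\<^sup>-\<^sup>k\<close> from explicit solutions to
  the spherical coefficients of an arbitrary \<open>u\<close> (\<open>coeff_annulus_relation\<close>). Square summability of the coefficients on two radii makes both series converge.
\<close>

section \<open>The surface measure and its invariance under orthogonal maps\<close>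

abbreviation usphere :: "'a::euclidean_space set" where "usphere \<equiv> sphere 0 1"

lemma nn_integral_lborel_translate:
  fixes f :: "'a::euclidean_space \<Rightarrow> ennreal"
  assumes [measurable]: "f \<in> borel_measurable borel"
  shows "(\<integral>\<^sup>+x. f (c + x) \<partial>lborel) = (\<integral>\<^sup>+x. f x \<partial>lborel)"
proof -
  have "(\<integral>\<^sup>+x. f x \<partial>lborel) = (\<integral>\<^sup>+x. f x \<partial>distr lborel borel ((+) c))"
    by (simp add: lborel_distr_plus)
  also have "\<dots> = (\<integral>\<^sup>+x. f (c + x) \<partial>lborel)"
    by (subst nn_integral_distr) auto
  finally show ?thesis by simp
qed

lemma nn_integral_lborel_reflect:
  fixes f :: "'a::euclidean_space \<Rightarrow> ennreal"
  assumes [measurable]: "f \<in> borel_measurable borel"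
  shows "(\<integral>\<^sup>+x. f (c - x) \<partial>lborel) = (\<integral>\<^sup>+x. f x \<partial>lborel)"
proof -
  have "lborel = density (distr lborel borel (\<lambda>x::'a. c + (-1) *\<^sub>R x)) (\<lambda>_. \<bar>-1::real\<bar>^DIM('a))"
    by (rule lborel_affine) simp
  then have eq: "lborel = distr lborel borel (\<lambda>x::'a. c - x)"
    by (simp add: density_1)
  have "(\<integral>\<^sup>+x. f x \<partial>lborel) = (\<integral>\<^sup>+x. f x \<partial>distr lborel borel (\<lambda>x::'a. c - x))"
    using eq by simp
  also have "\<dots> = (\<integral>\<^sup>+x. f (c - x) \<partial>lborel)"
    by (subst nn_integral_distr) auto
  finally show ?thesis by simp
qed

lemma orthogonal_transformation_measurable:
  fixes T :: "'a::euclidean_space \<Rightarrow> 'a"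
  assumes "orthogonal_transformation T"
  shows "T \<in> borel_measurable borel"
  using assms by (intro borel_measurable_continuous_onI linear_continuous_on
      linear_conv_bounded_linear[THEN iffD1] orthogonal_transformation_linear)

text \<open>The usual uniqueness argument for translation invariant measures, with the image measure \<open>\<mu>\<close> of
  Lebesgue measure \<open>\<lambda>\<close> under \<open>T\<close>: two applications of Fubini give \<open>\<mu> A * \<lambda> B = \<lambda> A * \<mu> B\<close>, and for the unit
  ball \<open>B\<close>, which \<open>T\<close> preserves, the factors \<open>\<lambda> B\<close> and \<open>\<mu> B\<close> agree.\<close>

lemma emeasure_lborel_orthogonal:
  fixes T :: "'a::euclidean_space \<Rightarrow> 'a"
  assumes T: "orthogonal_transformation T" and A: "A \<in> sets borel"
  shows "emeasure lborel (T -` A) = emeasure lborel A"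
proof -
  have [measurable]: "T \<in> borel_measurable borel"
    using T by (rule orthogonal_transformation_measurable)
  have lin: "linear T" using T by (rule orthogonal_transformation_linear)
  define B where "B = ball (0::'a) 1"
  have [measurable]: "A \<in> sets borel" "B \<in> sets borel" using A by (auto simp: B_def)
  have pre: "emeasure lborel (T -` C) = (\<integral>\<^sup>+x. indicator C (T x) \<partial>lborel)"
    if [measurable]: "C \<in> sets borel" for C
  proof -
    have "T -` C \<in> sets borel" using measurable_sets_borel[OF \<open>T \<in> borel_measurable borel\<close> that] .
    then have "emeasure lborel (T -` C) = (\<integral>\<^sup>+x. indicator (T -` C) x \<partial>lborel)" by simp
    also have "\<dots> = (\<integral>\<^sup>+x. indicator C (T x) \<partial>lborel)"
      by (intro nn_integral_cong) (auto simp: indicator_def)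
    finally show ?thesis .
  qed
  have surj: "surj T" using T by (rule orthogonal_transformation_surj)
  have "emeasure lborel (T -` A) * emeasure lborel B
      = (\<integral>\<^sup>+x. (\<integral>\<^sup>+y. indicator A (T x) * indicator B y \<partial>lborel) \<partial>lborel)"
    by (simp add: pre nn_integral_cmult nn_integral_multc)
  also have "\<dots> = (\<integral>\<^sup>+x. (\<integral>\<^sup>+y. indicator A (T x) * indicator B (T x + y) \<partial>lborel) \<partial>lborel)"
    by (intro nn_integral_cong nn_integral_lborel_translate[symmetric]) simp
  also have "\<dots> = (\<integral>\<^sup>+y. (\<integral>\<^sup>+x. indicator A (T x) * indicator B (T x + y) \<partial>lborel) \<partial>lborel)"
    by (rule lborel_pair.Fubini'[symmetric]) simp
  also have "\<dots> = (\<integral>\<^sup>+y. (\<integral>\<^sup>+x. indicator A (T x - y) * indicator B (T x) \<partial>lborel) \<partial>lborel)"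
  proof (rule nn_integral_cong)
    fix y :: 'a
    obtain z where z: "T z = y" using surj by (metis surjD)
    have "(\<integral>\<^sup>+x. indicator A (T x - y) * indicator B (T x) \<partial>lborel)
      = (\<integral>\<^sup>+x. (indicator A (T (z + x) - y) * indicator B (T (z + x)) :: ennreal) \<partial>lborel)"
      by (rule nn_integral_lborel_translate[symmetric]) simp
    then show "(\<integral>\<^sup>+x. (indicator A (T x) * indicator B (T x + y) :: ennreal) \<partial>lborel) =
      (\<integral>\<^sup>+x. indicator A (T x - y) * indicator B (T x) \<partial>lborel)"
      by (simp add: linear_add[OF lin] z add.commute)
  qed
  also have "\<dots> = (\<integral>\<^sup>+x. (\<integral>\<^sup>+y. indicator A (T x - y) * indicator B (T x) \<partial>lborel) \<partial>lborel)"
    by (rule lborel_pair.Fubini') simp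
  also have "\<dots> = (\<integral>\<^sup>+x. emeasure lborel A * indicator B (T x) \<partial>lborel)"
  proof (rule nn_integral_cong)
    fix x :: 'a
    have "(\<integral>\<^sup>+y. indicator A (T x - y) \<partial>lborel) = (\<integral>\<^sup>+y. indicator A y \<partial>lborel)"
      by (rule nn_integral_lborel_reflect) simp
    then show "(\<integral>\<^sup>+y. indicator A (T x - y) * indicator B (T x) \<partial>lborel) =
        emeasure lborel A * indicator B (T x)"
      by (simp add: nn_integral_multc)
  qed
  also have "\<dots> = emeasure lborel A * emeasure lborel (T -` B)"
    by (simp add: pre nn_integral_cmult)
  also have "T -` B = B"
    using T by (auto simp: B_def orthogonal_transformation_norm)
  finally have "emeasure lborel (T -` A) * emeasure lborel B = emeasure lborel A * emeasure lborel B" .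
  moreover have "emeasure lborel B = ennreal (unit_ball_vol DIM('a))"
    unfolding B_def by (simp add: emeasure_ball)
  moreover have "unit_ball_vol DIM('a) > 0" by simp
  ultimately show ?thesis
    by (metis ennreal_mult_cancel_left ennreal_neq_top ennreal_eq_0_iff not_le mult.commute)
qed

lemma space_sphere_measure [simp]: "space (sphere_measure :: 'a::euclidean_space measure) = usphere"
  by (simp add: sphere_measure_def space_scale_measure space_restrict_space)

lemma sets_sphere_measure [measurable_cong]:
  "sets (sphere_measure :: 'a::euclidean_space measure) = sets (restrict_space borel usphere)"
  by (simp add: sphere_measure_def)

lemma measurable_radial_projection:
  "(\<lambda>x::'a::euclidean_space. x /\<^sub>R norm x) \<in>
     restrict_space lborel (ball 0 1 - {0}) \<rightarrow>\<^sub>M restrict_space borel usphere"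
proof (rule measurable_restrict_space2)
  show "(\<lambda>x::'a. x /\<^sub>R norm x) \<in> space (restrict_space lborel (ball 0 1 - {0})) \<rightarrow> usphere"
    by (auto simp: space_restrict_space)
  show "(\<lambda>x::'a. x /\<^sub>R norm x) \<in> restrict_space lborel (ball 0 1 - {0}) \<rightarrow>\<^sub>M borel"
    by (intro measurable_restrict_space1) measurable
qed

lemma emeasure_sphere_measure:
  fixes A :: "'a::euclidean_space set"
  assumes "A \<in> sets (restrict_space borel usphere)"
  shows "emeasure sphere_measure A =
     of_nat DIM('a) * emeasure lborel {x \<in> ball 0 1 - {0}. x /\<^sub>R norm x \<in> A}"
proof -
  have "emeasure sphere_measure A = of_nat DIM('a) *
     emeasure (restrict_space lborel (ball 0 1 - {0}))
       ((\<lambda>x::'a. x /\<^sub>R norm x) -` A \<inter> space (restrict_space lborel (ball 0 1 - {0})))"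
    unfolding sphere_measure_def emeasure_scale_measure
    using measurable_radial_projection assms by (subst emeasure_distr) auto
  also have "(\<lambda>x::'a. x /\<^sub>R norm x) -` A \<inter> space (restrict_space lborel (ball 0 1 - {0}))
     = {x \<in> ball 0 1 - {0}. x /\<^sub>R norm x \<in> A}"
    by (auto simp: space_restrict_space)
  also have "emeasure (restrict_space lborel (ball 0 1 - {0})) \<dots> = emeasure lborel \<dots>"
    by (rule emeasure_restrict_space) auto
  finally show ?thesis .
qed

lemma usphere_in_sets: "(usphere :: 'a::euclidean_space set) \<in> sets (restrict_space borel usphere)"
  by (metis sets.top space_borel space_restrict_space inf_top.right_neutral)

lemma emeasure_usphere:
  "emeasure sphere_measure (usphere :: 'a::euclidean_space set) =
     ennreal (real DIM('a) * unit_ball_vol DIM('a))"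
proof -
  have "{x \<in> ball (0::'a) 1 - {0}. x /\<^sub>R norm x \<in> usphere} = ball 0 1 - {0}" by auto
  then have "emeasure sphere_measure (usphere :: 'a set) =
      of_nat DIM('a) * emeasure lborel (ball (0::'a) 1 - {0})"
    by (simp only: emeasure_sphere_measure[OF usphere_in_sets])
  also have "emeasure lborel (ball (0::'a) 1 - {0}) = emeasure lborel (ball (0::'a) 1)"
    by (intro emeasure_Diff_null_set) auto
  finally show ?thesis by (simp add: emeasure_ball ennreal_mult ennreal_of_nat_eq_real_of_nat)
qed

lemma finite_measure_sphere: "finite_measure (sphere_measure :: 'a::euclidean_space measure)"
  by (rule finite_measureI) (simp add: emeasure_usphere)

text \<open>The reciprocal of the constant in the Poisson kernel; \<open>measure_usphere\<close> identifies it as the area of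
  the unit sphere.\<close>

definition sphere_area :: "'a::euclidean_space itself \<Rightarrow> real" where
  "sphere_area _ = 2 * pi powr (real DIM('a) / 2) / Gamma (real DIM('a) / 2)"

lemma sphere_area_pos: "sphere_area TYPE('a::euclidean_space) > 0"
  unfolding sphere_area_def by (intro divide_pos_pos Gamma_real_pos mult_pos_pos) auto

lemma measure_usphere:
  "measure sphere_measure (usphere :: 'a::euclidean_space set) = sphere_area TYPE('a)"
proof -
  have "measure sphere_measure (usphere :: 'a set) = real DIM('a) * unit_ball_vol DIM('a)"
    by (simp add: measure_def emeasure_usphere)
  also have "\<dots> = sphere_area TYPE('a)"
  proof -
    define h where "h = real DIM('a) / 2"
    have h: "h > 0" "real DIM('a) = 2 * h" by (simp_all add: h_def)
    then have "h \<notin> \<int>\<^sub>\<le>\<^sub>0" by auto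
    then show ?thesis
      unfolding sphere_area_def unit_ball_vol_def h(2) using h(1) Gamma_plus1[of h] by simp
  qed
  finally show ?thesis .
qed

lemma continuous_on_borel_measurable_sphere:
  fixes f :: "'a::euclidean_space \<Rightarrow> 'b::topological_space"
  assumes "continuous_on usphere f"
  shows "f \<in> borel_measurable sphere_measure"
  using borel_measurable_continuous_on_restrict[OF assms]
  by (simp add: measurable_cong_sets[OF sets_sphere_measure refl])

lemma continuous_on_integrable_sphere:
  fixes f :: "'a::euclidean_space \<Rightarrow> 'b::{banach,second_countable_topology}"
  assumes "continuous_on usphere f"
  shows "integrable sphere_measure f"
proof -
  interpret finite_measure "sphere_measure :: 'a measure" by (rule finite_measure_sphere)
  have "compact (f ` usphere)" by (intro compact_continuous_image assms compact_sphere)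
  then obtain B where B: "\<And>x. x \<in> usphere \<Longrightarrow> norm (f x) \<le> B"
    by (metis bounded_iff compact_imp_bounded imageI)
  show ?thesis
    by (rule integrable_const_bound[where B = B])
      (auto intro!: continuous_on_borel_measurable_sphere assms AE_I2 B)
qed

lemma sphere_integral_cong:
  assumes "\<And>x. x \<in> usphere \<Longrightarrow> f x = g x"
  shows "(LINT x|(sphere_measure::'a::euclidean_space measure). f x) = (LINT x|sphere_measure. g x)"
  by (rule Bochner_Integration.integral_cong) (use assms in auto)

lemma sphere_integral_const:
  "(LINT x|(sphere_measure::'a::euclidean_space measure). c) = c * sphere_area TYPE('a)" for c :: real
  using measure_usphere[where 'a='a] by simp

lemma sphere_integral_add:
  fixes f g :: "'a::euclidean_space \<Rightarrow> real"
  assumes "continuous_on usphere f" "continuous_on usphere g"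
  shows "(LINT x|sphere_measure. f x + g x) = (LINT x|sphere_measure. f x) + (LINT x|sphere_measure. g x)"
  using assms by (intro Bochner_Integration.integral_add continuous_on_integrable_sphere)

lemma sphere_integral_mono:
  fixes f g :: "'a::euclidean_space \<Rightarrow> real"
  assumes "continuous_on usphere f" "continuous_on usphere g" "\<And>x. x \<in> usphere \<Longrightarrow> f x \<le> g x"
  shows "(LINT x|sphere_measure. f x) \<le> (LINT x|sphere_measure. g x)"
  using assms by (intro integral_mono continuous_on_integrable_sphere) auto

text \<open>An orthogonal map commutes with the radial projection and preserves the ball, so the cone over the
  preimage of \<open>A\<close> is the preimage of the cone over \<open>A\<close>, and Lebesgue measure is invariant.\<close>

lemma sphere_integral_orthogonal:
  fixes T :: "'a::euclidean_space \<Rightarrow> 'a" and f :: "'a \<Rightarrow> real"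
  assumes T: "orthogonal_transformation T" and f: "continuous_on usphere f"
  shows "(LINT x|sphere_measure. f (T x)) = (LINT x|sphere_measure. f x)"
proof -
  have nrm: "norm (T x) = norm x" for x using T by (rule orthogonal_transformation_norm)
  have lin: "linear T" using T by (rule orthogonal_transformation_linear)
  have Tb: "T \<in> borel_measurable borel" using T by (rule orthogonal_transformation_measurable)
  have Tm: "T \<in> sphere_measure \<rightarrow>\<^sub>M restrict_space borel usphere"
    unfolding measurable_cong_sets[OF sets_sphere_measure refl]
    by (intro measurable_restrict_space2 measurable_restrict_space1 Tb)
      (auto simp: space_restrict_space nrm)
  have "distr sphere_measure (restrict_space borel usphere) T = sphere_measure"
  proof (rule measure_eqI)
    fix A assume "A \<in> sets (distr sphere_measure (restrict_space borel usphere) T)"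
    then have A: "A \<in> sets (restrict_space borel (usphere::'a set))" by simp
    then have "A \<subseteq> usphere" using sets.sets_into_space by (force simp: space_restrict_space)
    define C where "C = {x \<in> ball (0::'a) 1 - {0}. x /\<^sub>R norm x \<in> A}"
    have "C = (\<lambda>x::'a. x /\<^sub>R norm x) -` A \<inter> space (restrict_space lborel (ball 0 1 - {0}))"
      by (auto simp: C_def space_restrict_space)
    also have "\<dots> \<in> sets (restrict_space lborel (ball 0 1 - {0}))"
      using measurable_radial_projection A by (rule measurable_sets)
    finally have Cb: "C \<in> sets borel" by (auto simp: sets_restrict_space)
    have "emeasure (distr sphere_measure (restrict_space borel usphere) T) A
        = emeasure sphere_measure (T -` A \<inter> usphere)"
      using Tm A by (subst emeasure_distr) auto
    also have "\<dots> = of_nat DIM('a) *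
        emeasure lborel {x \<in> ball 0 1 - {0}. x /\<^sub>R norm x \<in> T -` A \<inter> usphere}"
      using measurable_sets[OF Tm A] by (intro emeasure_sphere_measure) (simp add: sets_sphere_measure)
    also have "{x \<in> ball 0 1 - {0}. x /\<^sub>R norm x \<in> T -` A \<inter> usphere} = T -` C"
    proof -
      have "T x = 0 \<longleftrightarrow> x = 0" for x by (metis nrm norm_eq_zero)
      then show ?thesis using nrm by (auto simp: C_def linear_cmul[OF lin])
    qed
    also have "emeasure lborel (T -` C) = emeasure lborel C"
      by (rule emeasure_lborel_orthogonal[OF T Cb])
    also have "of_nat DIM('a) * emeasure lborel C = emeasure sphere_measure A"
      unfolding C_def by (rule emeasure_sphere_measure[OF A, symmetric])
    finally show "emeasure (distr sphere_measure (restrict_space borel usphere) T) A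
        = emeasure sphere_measure A" .
  qed (simp add: sets_sphere_measure)
  then have "(LINT x|sphere_measure. f x) =
      (LINT x|distr sphere_measure (restrict_space borel usphere) T. f x)" by simp
  also have "\<dots> = (LINT x|sphere_measure. f (T x))"
    using Tm borel_measurable_continuous_on_restrict[OF f] by (intro integral_distr)
  finally show ?thesis by simp
qed

text \<open>The surface measure charges every nonempty relatively open set, because the cone over such a set is
  open and nonempty.\<close>

lemma sphere_integral_eq_0_imp:
  fixes f :: "'a::euclidean_space \<Rightarrow> real"
  assumes f: "continuous_on usphere f" and nn: "\<And>x. x \<in> usphere \<Longrightarrow> f x \<ge> 0"
    and int: "(LINT x|sphere_measure. f x) = 0" and x: "x \<in> usphere"
  shows "f x = 0"
proof -
  define A where "A = {x \<in> usphere. f x \<noteq> 0}"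
  have "AE x in sphere_measure. f x = 0"
    using int nn continuous_on_integrable_sphere[OF f]
    by (subst (asm) integral_nonneg_eq_0_iff_AE) auto
  moreover have fm: "f \<in> borel_measurable sphere_measure" 
    by (rule continuous_on_borel_measurable_sphere[OF f])
  have Am: "A \<in> sets sphere_measure" 
  proof -
    have "A = f -` (-{0}) \<inter> space sphere_measure" by (auto simp: A_def)
    also have "\<dots> \<in> sets sphere_measure" using fm by (rule measurable_sets) auto
    finally show ?thesis .
  qed
  ultimately have "emeasure sphere_measure A = 0"
    by (subst (asm) AE_iff_measurable[OF Am]) (auto simp: A_def)
  then have 0: "emeasure lborel {x \<in> ball 0 1 - {0}. x /\<^sub>R norm x \<in> A} = 0"
    using Am emeasure_sphere_measure[of A] by (simp add: sets_sphere_measure)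
  define U where "U = {x \<in> ball (0::'a) 1 - {0}. x /\<^sub>R norm x \<in> A}"
  have "U = (ball 0 1 - {0}) \<inter> (\<lambda>x. f (x /\<^sub>R norm x)) -` (-{0})"
    by (auto simp: U_def A_def)
  also have "open \<dots>"
    by (intro continuous_open_preimage continuous_on_compose2[OF f] continuous_intros)
      (auto intro!: left_inverse simp del: left_inverse)
  finally have "open U" .
  then have "U = {}"
    using 0 open_not_negligible[of U] unfolding U_def[symmetric]
    by (auto simp: negligible_iff_null_sets null_sets_def)
  moreover have "(1/2) *\<^sub>R x \<in> U" if "f x \<noteq> 0"
    using that x by (auto simp: U_def A_def)
  ultimately show ?thesis by blast
qed

section \<open>Harmonic functions and the maximum principle\<close>

lemma frechet_derivative_eqI: "(f has_derivative f') (at x) \<Longrightarrow> frechet_derivative f (at x) = f'"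
  by (metis frechet_derivative_at)

text \<open>The defining partial derivatives are awkward to compute with. It is easier to exhibit a gradient
  field \<open>D\<close> and its derivative \<open>A\<close>; the Laplacian is then the trace of \<open>A\<close>.\<close>

lemma harmonic_onI:
  fixes f :: "'a::euclidean_space \<Rightarrow> real"
  assumes S: "open S"
    and D: "\<And>x. x \<in> S \<Longrightarrow> (f has_derivative (\<lambda>h. h \<bullet> D x)) (at x)"
    and A: "\<And>x. x \<in> S \<Longrightarrow> (D has_derivative A x) (at x)"
    and cont: "\<And>i. i \<in> Basis \<Longrightarrow> continuous_on S (\<lambda>x. A x i)"
    and tr: "\<And>x. x \<in> S \<Longrightarrow> (\<Sum>i\<in>Basis. A x i \<bullet> i) = 0"
  shows "harmonic_on f S"
proof -
  let ?g = "\<lambda>i x. frechet_derivative f (at x) i"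
  have g: "?g i x = i \<bullet> D x" if "x \<in> S" for x i
    using frechet_derivative_eqI[OF D[OF that]] by simp
  have dg: "(?g i has_derivative (\<lambda>h. i \<bullet> A x h)) (at x)" if "x \<in> S" for x i
    by (rule has_derivative_transform_within_open[where f = "\<lambda>x. i \<bullet> D x", OF _ S that])
      (use A[OF that] g in \<open>auto intro!: derivative_eq_intros\<close>)
  have fg: "frechet_derivative (?g i) (at x) j = i \<bullet> A x j" if "x \<in> S" for x i j
    using frechet_derivative_eqI[OF dg[OF that]] by simp
  have "continuous_on S (\<lambda>x. frechet_derivative (?g i) (at x) j)" if "j \<in> Basis" for i j
    by (subst continuous_on_cong[OF refl fg]) (auto intro!: continuous_intros cont that)
  moreover have "laplacian f x = 0" if "x \<in> S" for x
    unfolding laplacian_def using fg[OF that] tr[OF that] by (simp add: inner_commute)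
  ultimately show ?thesis
    using S differentiableI[OF D] differentiableI[OF dg]
    unfolding harmonic_on_def numeral_2_eq_2 by auto
qed

text \<open>First and second derivatives of a harmonic function in coordinate-free form, with the continuity of
  the second ones and the vanishing of the trace.\<close>

definition harmonic_jet ::
    "('a::euclidean_space \<Rightarrow> real) \<Rightarrow> ('a \<Rightarrow> 'a) \<Rightarrow> ('a \<Rightarrow> 'a \<Rightarrow> 'a) \<Rightarrow> 'a set \<Rightarrow> bool" where
  "harmonic_jet f D A S \<longleftrightarrow>
     (\<forall>x\<in>S. (f has_derivative (\<lambda>h. h \<bullet> D x)) (at x) \<and> (D has_derivative A x) (at x) \<and>
        (\<Sum>i\<in>Basis. A x i \<bullet> i) = 0) \<and>
     (\<forall>i\<in>Basis. continuous_on S (\<lambda>x. A x i))"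

lemma harmonic_jetD:
  assumes "harmonic_jet f D A S"
  shows "x \<in> S \<Longrightarrow> (f has_derivative (\<lambda>h. h \<bullet> D x)) (at x)"
    and "x \<in> S \<Longrightarrow> (D has_derivative A x) (at x)"
    and "i \<in> Basis \<Longrightarrow> continuous_on S (\<lambda>x. A x i)"
    and "x \<in> S \<Longrightarrow> (\<Sum>i\<in>Basis. A x i \<bullet> i) = 0"
  using assms by (auto simp: harmonic_jet_def)

lemma harmonic_onE:
  fixes f :: "'a::euclidean_space \<Rightarrow> real"
  assumes "harmonic_on f S"
  obtains D A where "harmonic_jet f D A S"
proof -
  let ?g = "\<lambda>i x. frechet_derivative f (at x) i"
  let ?D = "\<lambda>x. \<Sum>i\<in>Basis. ?g i x *\<^sub>R i"
  let ?A = "\<lambda>x h. \<Sum>i\<in>Basis. frechet_derivative (?g i) (at x) h *\<^sub>R i"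
  have *: "f differentiable (at x)" "i \<in> Basis \<Longrightarrow> ?g i differentiable (at x)"
     "i \<in> Basis \<Longrightarrow> j \<in> Basis \<Longrightarrow> continuous_on S (\<lambda>x. frechet_derivative (?g i) (at x) j)"
     "laplacian f x = 0" if "x \<in> S" for x i j
    using assms that unfolding harmonic_on_def numeral_2_eq_2 by auto
  have "(f has_derivative (\<lambda>h. h \<bullet> ?D x)) (at x)" if "x \<in> S" for x
  proof -
    have d: "(f has_derivative frechet_derivative f (at x)) (at x)"
      using *(1)[OF that] frechet_derivative_works by blast
    then have lin: "linear (frechet_derivative f (at x))" by (rule has_derivative_linear)
    have "frechet_derivative f (at x) h = h \<bullet> ?D x" for h
    proof -
      have "frechet_derivative f (at x) h = frechet_derivative f (at x) (\<Sum>i\<in>Basis. (h \<bullet> i) *\<^sub>R i)"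
        by (simp add: euclidean_representation)
      also have "\<dots> = (\<Sum>i\<in>Basis. (h \<bullet> i) * ?g i x)"
        by (simp add: linear_sum[OF lin] linear_cmul[OF lin])
      also have "\<dots> = h \<bullet> ?D x" by (simp add: inner_sum_right mult.commute)
      finally show ?thesis .
    qed
    then show ?thesis using d by (metis (no_types, lifting) ext)
  qed
  moreover have "(?D has_derivative ?A x) (at x)" if "x \<in> S" for x
    using *(2)[OF that, THEN frechet_derivative_works[THEN iffD1]]
    by (intro has_derivative_sum has_derivative_scaleR_left) auto
  moreover have "continuous_on S (\<lambda>x. ?A x i)" if "i \<in> Basis" for i
  proof (cases "S = {}")
    case False
    then show ?thesis using *(3) that by (intro continuous_intros) blast+
  qed auto
  moreover have "(\<Sum>i\<in>Basis. ?A x i \<bullet> i) = 0" if "x \<in> S" for x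
    using *(4)[OF that] unfolding laplacian_def
    by (simp add: inner_sum_left inner_Basis if_distrib sum.delta cong: if_cong)
  ultimately have "harmonic_jet f ?D ?A S" unfolding harmonic_jet_def by blast
  then show ?thesis by (rule that)
qed

lemma harmonic_on_open: "harmonic_on f S \<Longrightarrow> open S"
  by (simp add: harmonic_on_def)

text \<open>All conditions in the definition of harmonicity are local.\<close>

lemma harmonic_on_locally:
  assumes "\<And>x. x \<in> S \<Longrightarrow> \<exists>U. x \<in> U \<and> U \<subseteq> S \<and> harmonic_on f U"
  shows "harmonic_on f S"
proof -
  have op: "open S" using assms by (subst open_subopen) (meson harmonic_on_open)
  show ?thesis
    unfolding harmonic_on_def numeral_2_eq_2 times_cont_diff_on.simps
      continuous_on_eq_continuous_at[OF op]
  proof (intro conjI ballI op, goal_cases)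
    case (1 x)
    then show ?case using assms[of x] unfolding harmonic_on_def numeral_2_eq_2 by auto
  next
    case (2 i x)
    then show ?case using assms[of x] unfolding harmonic_on_def numeral_2_eq_2 by auto
  next
    case (3 i j x)
    then obtain U where U: "x \<in> U" "harmonic_on f U" using assms by blast
    then have "continuous_on U (\<lambda>x. frechet_derivative (\<lambda>x. frechet_derivative f (at x) i) (at x) j)"
      using 3 unfolding harmonic_on_def numeral_2_eq_2 by auto
    then show ?case using continuous_on_eq_continuous_at[OF harmonic_on_open] U by blast
  next
    case (4 x)
    then show ?case using assms[of x] unfolding harmonic_on_def by auto
  qed
qed

lemma harmonic_on_subset:
  assumes f: "harmonic_on f S" and T: "open T" "T \<subseteq> S"
  shows "harmonic_on f T"
proof -
  obtain D A where DAj: "harmonic_jet f D A S"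
    using f by (rule harmonic_onE)
  note DA = harmonic_jetD[OF DAj]
  show ?thesis
    by (rule harmonic_onI[where D = D and A = A])
      (use T DA in \<open>auto intro: continuous_on_subset[OF DA(3) T(2)]\<close>)
qed

lemma harmonic_on_cong:
  assumes f: "harmonic_on f S" and eq: "\<And>x. x \<in> S \<Longrightarrow> g x = f x"
  shows "harmonic_on g S"
proof -
  have S: "open S" using f by (rule harmonic_on_open)
  obtain D A where DAj: "harmonic_jet f D A S"
    using f by (rule harmonic_onE)
  note DA = harmonic_jetD[OF DAj]
  show ?thesis
    by (rule harmonic_onI[where D = D and A = A, OF S has_derivative_transform_within_open[OF DA(1)]])
      (use S DA eq in auto)
qed

lemma harmonic_on_continuous: "harmonic_on f S \<Longrightarrow> continuous_on S f"
  unfolding harmonic_on_def numeral_2_eq_2 times_cont_diff_on.simps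
  by (intro differentiable_imp_continuous_on) (auto simp: differentiable_on_def intro: differentiable_at_withinI)

lemma harmonic_on_const: "open S \<Longrightarrow> harmonic_on (\<lambda>x. c) S"
  by (rule harmonic_onI[where D = "\<lambda>_. 0" and A = "\<lambda>_ _. 0"]) auto

lemma harmonic_on_add:
  assumes f: "harmonic_on f S" and g: "harmonic_on g S"
  shows "harmonic_on (\<lambda>x. f x + g x) S"
proof -
  obtain D A where f'j: "harmonic_jet f D A S"
    using f by (rule harmonic_onE)
  note f' = harmonic_jetD[OF f'j]
  obtain D' A' where g'j: "harmonic_jet g D' A' S"
    using g by (rule harmonic_onE)
  note g' = harmonic_jetD[OF g'j]
  show ?thesis
    by (rule harmonic_onI[where D = "\<lambda>x. D x + D' x" and A = "\<lambda>x h. A x h + A' x h"])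
      (use f' g' harmonic_on_open[OF f] in
        \<open>auto intro!: derivative_eq_intros continuous_intros simp: inner_add inner_add_left sum.distrib\<close>)
qed

lemma harmonic_on_cmult:
  assumes f: "harmonic_on f S"
  shows "harmonic_on (\<lambda>x. c * f x) S"
proof -
  obtain D A where f'j: "harmonic_jet f D A S"
    using f by (rule harmonic_onE)
  note f' = harmonic_jetD[OF f'j]
  show ?thesis
    by (rule harmonic_onI[where D = "\<lambda>x. c *\<^sub>R D x" and A = "\<lambda>x h. c *\<^sub>R A x h"])
      (use f' harmonic_on_open[OF f] in
        \<open>auto intro!: derivative_eq_intros continuous_intros simp: sum_distrib_left[symmetric]\<close>)
qed

lemma harmonic_on_diff:
  "harmonic_on f S \<Longrightarrow> harmonic_on g S \<Longrightarrow> harmonic_on (\<lambda>x. f x - g x) S"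
  using harmonic_on_add[OF _ harmonic_on_cmult, of f S g "-1"] by simp

lemma harmonic_on_sum:
  assumes "open S" "\<And>i. i \<in> F \<Longrightarrow> harmonic_on (f i) S"
  shows "harmonic_on (\<lambda>x. \<Sum>i\<in>F. f i x) S"
  using assms(2)
proof (induction F rule: infinite_finite_induct)
  case (insert i F)
  then show ?case by (auto intro!: harmonic_on_add)
qed (auto intro!: harmonic_on_const assms)

lemma harmonic_on_affine:
  fixes f :: "'a::euclidean_space \<Rightarrow> real"
  assumes f: "harmonic_on f S"
  shows "harmonic_on (\<lambda>x. f (z + r *\<^sub>R x)) {x. z + r *\<^sub>R x \<in> S}"
proof -
  obtain D A where f'j: "harmonic_jet f D A S"
    using f by (rule harmonic_onE)
  note f' = harmonic_jetD[OF f'j]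
  have "{x. z + r *\<^sub>R x \<in> S} = (\<lambda>x. z + r *\<^sub>R x) -` S" by auto
  also have "open \<dots>" by (intro open_vimage harmonic_on_open[OF f] continuous_intros)
  finally have op: "open {x. z + r *\<^sub>R x \<in> S}" .
  have lin: "linear (A x)" if "x \<in> S" for x using f'(2)[OF that] by (rule has_derivative_linear)
  show ?thesis
  proof (rule harmonic_onI[where D = "\<lambda>x. r *\<^sub>R D (z + r *\<^sub>R x)" and A = "\<lambda>x h. r *\<^sub>R A (z + r *\<^sub>R x) (r *\<^sub>R h)"])
    fix x assume "x \<in> {x. z + r *\<^sub>R x \<in> S}"
    then have x: "z + r *\<^sub>R x \<in> S" by simp
    have aff: "((\<lambda>x. z + r *\<^sub>R x) has_derivative (\<lambda>h. r *\<^sub>R h)) (at x)"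
      by (auto intro!: derivative_eq_intros)
    show "((\<lambda>x. f (z + r *\<^sub>R x)) has_derivative (\<lambda>h. h \<bullet> r *\<^sub>R D (z + r *\<^sub>R x))) (at x)"
      using diff_chain_at[OF aff f'(1)[OF x]] by (simp add: o_def)
    show "((\<lambda>x. r *\<^sub>R D (z + r *\<^sub>R x)) has_derivative (\<lambda>h. r *\<^sub>R A (z + r *\<^sub>R x) (r *\<^sub>R h))) (at x)"
      using diff_chain_at[OF aff f'(2)[OF x]] by (auto simp: o_def intro!: derivative_eq_intros)
    show "(\<Sum>i\<in>Basis. r *\<^sub>R A (z + r *\<^sub>R x) (r *\<^sub>R i) \<bullet> i) = 0"
      using f'(4)[OF x] by (simp add: linear_cmul[OF lin[OF x]] sum_distrib_left[symmetric])
  next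
    fix i :: 'a assume i: "i \<in> Basis"
    have "continuous_on {x. z + r *\<^sub>R x \<in> S} (\<lambda>x. r *\<^sub>R r *\<^sub>R A (z + r *\<^sub>R x) i)"
      by (intro continuous_intros continuous_on_compose2[OF f'(3)[OF i]]) auto
    then show "continuous_on {x. z + r *\<^sub>R x \<in> S} (\<lambda>x. r *\<^sub>R A (z + r *\<^sub>R x) (r *\<^sub>R i))"
      by (subst continuous_on_cong[OF refl]) (auto simp: linear_cmul[OF lin])
  qed (rule op)
qed

lemma second_derivative_local_max:
  fixes f f' :: "real \<Rightarrow> real"
  assumes d: "d > 0" and der: "\<And>t. \<bar>t\<bar> < d \<Longrightarrow> (f has_real_derivative f' t) (at t)"
    and der2: "(f' has_real_derivative c) (at 0)"
    and max: "\<And>t. \<bar>t\<bar> < d \<Longrightarrow> f t \<le> f 0"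
  shows "c \<le> 0"
proof (rule ccontr)
  assume "\<not> c \<le> 0"
  then have "c > 0" by simp
  have f0: "f' 0 = 0"
    by (rule DERIV_local_max[OF der d]) (use d max in auto)
  obtain e where e: "e > 0" "\<And>h. 0 < h \<Longrightarrow> h < e \<Longrightarrow> f' 0 < f' h"
    using DERIV_pos_inc_right[OF der2 \<open>c > 0\<close>] by auto
  define h where "h = min d e / 2"
  have h: "0 < h" "h < d" "h < e" using d e(1) by (auto simp: h_def)
  have "f 0 < f h"
  proof (rule DERIV_pos_imp_increasing_open[OF h(1)])
    fix x assume "0 < x" "x < h"
    then show "\<exists>y. (f has_real_derivative y) (at x) \<and> 0 < y"
      using der[of x] e(2)[of x] h f0 by auto
  next
    show "continuous_on {0..h} f"
      by (rule DERIV_continuous_on[where D = f']) (use der h in \<open>auto intro: has_field_derivative_at_within\<close>)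
  qed
  with max[of h] h show False by auto
qed

text \<open>Adding \<open>\<epsilon> \<bar>x\<bar>\<^sup>2\<close> makes the Laplacian strictly positive, so the perturbed function has no maximum in
  \<open>U\<close>, where every pure second derivative would have to be nonpositive. The pair \<open>U \<subseteq> K\<close> stands for an open set
  and its closure; in applications \<open>K - U\<close> is visibly a sphere or a union of two spheres.\<close>

lemma harmonic_maximum_principle:
  fixes f :: "'a::euclidean_space \<Rightarrow> real"
  assumes K: "compact K" and U: "U \<subseteq> K" and cont: "continuous_on K f" and harm: "harmonic_on f U"
    and bd: "\<And>x. x \<in> K - U \<Longrightarrow> f x \<le> m" and x: "x \<in> K"
  shows "f x \<le> m"
proof (rule ccontr)
  assume "\<not> f x \<le> m"
  then have fx: "f x > m" by simp
  obtain B where B: "B > 0" "\<And>y. y \<in> K \<Longrightarrow> norm y \<le> B"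
    using compact_imp_bounded[OF K] bounded_pos by metis
  \<comment> \<open>Small enough for the perturbation to keep the maximum off \<open>K - U\<close>.\<close>
  define e where "e = (f x - m) / (2 * B\<^sup>2)"
  have e: "e > 0" "e * B\<^sup>2 < f x - m" using fx B by (auto simp: e_def)
  define g where "g y = f y + e * (y \<bullet> y)" for y
  have nb: "y \<bullet> y \<le> B\<^sup>2" if "y \<in> K" for y
    using B(2)[OF that] by (simp add: dot_square_norm power_mono)
  have "continuous_on K g" unfolding g_def by (intro continuous_intros cont)
  then obtain p where p: "p \<in> K" "\<And>y. y \<in> K \<Longrightarrow> g y \<le> g p"
    using continuous_attains_sup[OF K] x by blast
  have "g x \<le> g p" by (rule p(2)[OF x])
  moreover have "f x \<le> g x" using e by (simp add: g_def)
  moreover have "e * (p \<bullet> p) \<le> e * B\<^sup>2" using nb[OF p(1)] e by simp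
  ultimately have "f p > m" using e(2) by (simp add: g_def)
  then have pU: "p \<in> U" using bd[of p] p(1) by force
  obtain D A where f'j: "harmonic_jet f D A U"
    using harm by (rule harmonic_onE)
  note f' = harmonic_jetD[OF f'j]
  obtain d where d: "d > 0" "ball p d \<subseteq> U"
    using harmonic_on_open[OF harm] pU open_contains_ball by metis
  have "A p i \<bullet> i + 2 * e \<le> 0" if i: "i \<in> Basis" for i
  proof (rule second_derivative_local_max[OF d(1)])
    fix t :: real assume t: "\<bar>t\<bar> < d"
    then have "p + t *\<^sub>R i \<in> ball p d" using i by (simp add: dist_norm)
    then have tU: "p + t *\<^sub>R i \<in> U" using d by blast
    show "g (p + t *\<^sub>R i) \<le> g (p + 0 *\<^sub>R i)" using p(2) tU U by auto
    have line: "((\<lambda>t. p + t *\<^sub>R i) has_derivative (\<lambda>h. h *\<^sub>R i)) (at t)"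
      by (auto intro!: derivative_eq_intros)
    have "((\<lambda>t. f (p + t *\<^sub>R i)) has_derivative (\<lambda>h. (h *\<^sub>R i) \<bullet> D (p + t *\<^sub>R i))) (at t)"
      using diff_chain_at[OF line f'(1)[OF tU]] by (simp add: o_def)
    then have "((\<lambda>t. f (p + t *\<^sub>R i)) has_real_derivative (i \<bullet> D (p + t *\<^sub>R i))) (at t)"
      unfolding has_field_derivative_def by (rule has_derivative_eq_rhs) (auto simp: fun_eq_iff)
    moreover have "((\<lambda>t. e * ((p + t *\<^sub>R i) \<bullet> (p + t *\<^sub>R i))) has_real_derivative
        2 * e * (i \<bullet> (p + t *\<^sub>R i))) (at t)"
      unfolding has_field_derivative_def
      by (auto intro!: derivative_eq_intros ext simp: inner_commute algebra_simps)
    ultimately show "((\<lambda>t. g (p + t *\<^sub>R i)) has_real_derivative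
       i \<bullet> D (p + t *\<^sub>R i) + 2 * e * (i \<bullet> (p + t *\<^sub>R i))) (at t)"
      unfolding g_def by (rule DERIV_add)
  next
    have line: "((\<lambda>t. p + t *\<^sub>R i) has_derivative (\<lambda>h. h *\<^sub>R i)) (at 0)"
      by (auto intro!: derivative_eq_intros)
    have pU': "p + 0 *\<^sub>R i \<in> U" using pU by simp
    have lin: "linear (A p)" using f'(2)[OF pU] by (rule has_derivative_linear)
    have D0: "((\<lambda>t. D (p + t *\<^sub>R i)) has_derivative (\<lambda>h. h *\<^sub>R A p i)) (at 0)"
      using diff_chain_at[OF line f'(2)[OF pU']] by (simp add: o_def linear_cmul[OF lin])
    show "((\<lambda>t. i \<bullet> D (p + t *\<^sub>R i) + 2 * e * (i \<bullet> (p + t *\<^sub>R i))) has_real_derivative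
       A p i \<bullet> i + 2 * e) (at 0)"
      unfolding has_field_derivative_def
      by (rule derivative_eq_intros D0 refl)+
         (use i in \<open>auto intro!: ext simp: inner_commute algebra_simps inner_same_Basis\<close>)
  qed
  then have "(\<Sum>i\<in>Basis. A p i \<bullet> i + 2 * e) \<le> 0" by (rule sum_nonpos)
  then have "2 * e * real DIM('a) \<le> 0" using f'(4)[OF pU] by (simp add: sum.distrib)
  then show False using e(1) by (simp add: mult_le_0_iff)
qed

lemma harmonic_maximum_principle_abs:
  fixes f :: "'a::euclidean_space \<Rightarrow> real"
  assumes K: "compact K" and U: "U \<subseteq> K" and cont: "continuous_on K f" and harm: "harmonic_on f U"
    and bd: "\<And>x. x \<in> K - U \<Longrightarrow> \<bar>f x\<bar> \<le> m" and x: "x \<in> K"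
  shows "\<bar>f x\<bar> \<le> m"
proof -
  have "f x \<le> m"
    by (rule harmonic_maximum_principle[OF K U cont harm _ x]) (use bd in \<open>force simp: abs_le_iff\<close>)
  moreover have "-1 * f x \<le> m"
    by (rule harmonic_maximum_principle[OF K U _ harmonic_on_cmult[OF harm] _ x])
      (use bd cont in \<open>force simp: abs_le_iff intro!: continuous_intros\<close>)+
  ultimately show ?thesis by (simp add: abs_le_iff)
qed

section \<open>Sphere integrals depending on a parameter\<close>

text \<open>Uniform continuity on the compact product of a small ball with the sphere.\<close>

lemma sphere_uniform_in_parameter:
  fixes F :: "'a::euclidean_space \<Rightarrow> 'a \<Rightarrow> 'b::real_normed_vector"
  assumes U: "open U" "x0 \<in> U" and F: "continuous_on (U \<times> usphere) (\<lambda>(x,y). F x y)" and e: "e > 0"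
  obtains d where "d > 0" "ball x0 d \<subseteq> U"
    "\<And>x y. x \<in> ball x0 d \<Longrightarrow> y \<in> usphere \<Longrightarrow> norm (F x y - F x0 y) < e"
proof -
  obtain r where r: "r > 0" "cball x0 r \<subseteq> U" using U open_contains_cball by metis
  have "uniformly_continuous_on (cball x0 r \<times> usphere) (\<lambda>(x,y). F x y)"
    by (intro compact_uniformly_continuous continuous_on_subset[OF F] compact_Times)
      (use r in auto)
  then obtain d where d: "d > 0" "\<And>p q. p \<in> cball x0 r \<times> usphere \<Longrightarrow> q \<in> cball x0 r \<times> usphere \<Longrightarrow>
      dist p q < d \<Longrightarrow> dist (case p of (x,y) \<Rightarrow> F x y) (case q of (x,y) \<Rightarrow> F x y) < e"
    unfolding uniformly_continuous_on_def using e by metis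
  show thesis
  proof (rule that[of "min r d"])
    fix x y :: 'a assume "x \<in> ball x0 (min r d)" "y \<in> usphere"
    then show "norm (F x y - F x0 y) < e"
      using d(2)[of "(x,y)" "(x0,y)"] r(1) by (auto simp: dist_Pair_Pair dist_norm norm_minus_commute)
  qed (use r d ball_subset_cball in auto)
qed

lemma sphere_integral_norm_le:
  fixes f :: "'a::euclidean_space \<Rightarrow> 'b::euclidean_space"
  assumes "continuous_on usphere f" "\<And>y. y \<in> usphere \<Longrightarrow> norm (f y) \<le> B"
  shows "norm (LINT y|sphere_measure. f y) \<le> B * sphere_area TYPE('a)"
proof -
  have "norm (LINT y|sphere_measure. f y) \<le> (LINT y|sphere_measure. norm (f y))"
    by (rule integral_norm_bound)
  also have "\<dots> \<le> (LINT y|(sphere_measure::'a measure). B)"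
    using assms by (intro sphere_integral_mono continuous_intros) auto
  finally show ?thesis by (simp only: sphere_integral_const)
qed

lemma continuous_on_slice:
  assumes "continuous_on (U \<times> V) (\<lambda>(x,y). F x y)" "x \<in> U"
  shows "continuous_on V (F x)"
proof -
  have "continuous_on V (\<lambda>y. (\<lambda>(x,y). F x y) (x, y))"
    by (rule continuous_on_compose2[OF assms(1)]) (use assms(2) in \<open>auto intro!: continuous_intros\<close>)
  then show ?thesis by simp
qed

lemma sphere_integral_continuous:
  fixes F :: "'a::euclidean_space \<Rightarrow> 'a \<Rightarrow> 'b::euclidean_space"
  assumes U: "open U" and F: "continuous_on (U \<times> usphere) (\<lambda>(x,y). F x y)"
  shows "continuous_on U (\<lambda>x. LINT y|sphere_measure. F x y)"
  unfolding continuous_on_iff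
proof (intro ballI allI impI)
  fix x0 and e :: real assume x0: "x0 \<in> U" and e: "e > 0"
  let ?a = "sphere_area TYPE('a)"
  have a: "?a > 0" by (rule sphere_area_pos)
  obtain d where d: "d > 0" "ball x0 d \<subseteq> U"
    "\<And>x y. x \<in> ball x0 d \<Longrightarrow> y \<in> usphere \<Longrightarrow> norm (F x y - F x0 y) < e / (2 * ?a)"
    using sphere_uniform_in_parameter[OF U x0 F, of "e / (2 * ?a)"] e a by auto
  have "dist (LINT y|sphere_measure. F x y) (LINT y|sphere_measure. F x0 y) < e"
    if "x \<in> U" "dist x x0 < d" for x
  proof -
    have c: "continuous_on usphere (F x)" "continuous_on usphere (F x0)"
      using continuous_on_slice[OF F] that x0 by auto
    have "(LINT y|sphere_measure. F x y) - (LINT y|sphere_measure. F x0 y)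
        = (LINT y|sphere_measure. F x y - F x0 y)"
      by (intro Bochner_Integration.integral_diff[symmetric] continuous_on_integrable_sphere c)
    moreover have "norm (LINT y|sphere_measure. F x y - F x0 y) \<le> e / (2 * ?a) * ?a"
      by (intro sphere_integral_norm_le continuous_intros c less_imp_le d(3))
        (use that in \<open>auto simp: dist_commute\<close>)
    ultimately show ?thesis using a e by (simp add: dist_norm)
  qed
  then show "\<exists>d>0. \<forall>x'\<in>U. dist x' x0 < d \<longrightarrow>
      dist (LINT y|sphere_measure. F x' y) (LINT y|sphere_measure. F x0 y) < e"
    using d(1) by blast
qed

text \<open>The remainder of the first-order expansion is bounded by the oscillation of the derivative, which is
  uniformly small in \<open>y\<close>; it can therefore be integrated.\<close>

lemma sphere_integral_has_derivative:
  fixes f :: "'a::euclidean_space \<Rightarrow> 'a \<Rightarrow> 'b::euclidean_space"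
  assumes U: "open U" and x0: "x0 \<in> U"
    and f: "\<And>x. x \<in> U \<Longrightarrow> continuous_on usphere (f x)"
    and der: "\<And>x y. x \<in> U \<Longrightarrow> y \<in> usphere \<Longrightarrow> ((\<lambda>x. f x y) has_derivative f' x y) (at x)"
    and f': "\<And>i. i \<in> Basis \<Longrightarrow> continuous_on (U \<times> usphere) (\<lambda>(x,y). f' x y i)"
  shows "((\<lambda>x. LINT y|sphere_measure. f x y) has_derivative
          (\<lambda>h. LINT y|sphere_measure. f' x0 y h)) (at x0)"
proof -
  let ?a = "sphere_area TYPE('a)"
  have a: "?a > 0" by (rule sphere_area_pos)
  have lin: "linear (f' x y)" if "x \<in> U" "y \<in> usphere" for x y
    using der[OF that] by (rule has_derivative_linear)
  have expand: "f' x y h = (\<Sum>i\<in>Basis. (h \<bullet> i) *\<^sub>R f' x y i)" if "x \<in> U" "y \<in> usphere" for x y h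
  proof -
    have "f' x y h = f' x y (\<Sum>i\<in>Basis. (h \<bullet> i) *\<^sub>R i)" by (simp add: euclidean_representation)
    then show ?thesis by (simp add: linear_sum[OF lin[OF that]] linear_cmul[OF lin[OF that]])
  qed
  have slice: "continuous_on usphere (\<lambda>y. f' x0 y i)" if "i \<in> Basis" for i
    by (rule continuous_on_slice[OF f'[OF that] x0])
  have slice_h: "continuous_on usphere (\<lambda>y. f' x0 y h)" for h
    by (subst continuous_on_cong[OF refl expand[OF x0]]) (auto intro!: continuous_intros slice)
  have int_expand: "(LINT y|sphere_measure. f' x0 y h) =
      (\<Sum>i\<in>Basis. (h \<bullet> i) *\<^sub>R (LINT y|sphere_measure. f' x0 y i))" for h
  proof -
    have "(LINT y|sphere_measure. f' x0 y h) =
        (LINT y|sphere_measure. (\<Sum>i\<in>Basis. (h \<bullet> i) *\<^sub>R f' x0 y i))"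
      by (rule sphere_integral_cong) (rule expand[OF x0])
    then show ?thesis
      using continuous_on_integrable_sphere[OF slice]
      by (simp add: Bochner_Integration.integral_sum)
  qed
  have G: "continuous_on (U \<times> usphere) (\<lambda>(x,y). \<Sum>i\<in>Basis. norm (f' x y i - f' x0 y i))"
  proof -
    have "continuous_on (U \<times> usphere) (\<lambda>p. f' x0 (snd p) i)" if "i \<in> Basis" for i
      by (rule continuous_on_compose2[OF slice[OF that]]) (auto intro!: continuous_intros)
    then show ?thesis using f' unfolding case_prod_beta
      by (intro continuous_intros) auto
  qed
  show ?thesis unfolding has_derivative_at_alt
  proof (intro conjI allI impI)
    show "bounded_linear (\<lambda>h. LINT y|sphere_measure. f' x0 y h)"
      by (subst ext[OF int_expand]) (intro bounded_linear_sum bounded_linear_scaleR_const bounded_linear_inner_left)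
    fix e :: real assume e: "e > 0"
    obtain d where d: "d > 0" "ball x0 d \<subseteq> U"
      "\<And>x y. x \<in> ball x0 d \<Longrightarrow> y \<in> usphere \<Longrightarrow>
         norm ((\<Sum>i\<in>Basis. norm (f' x y i - f' x0 y i)) - (\<Sum>i\<in>Basis. norm (f' x0 y i - f' x0 y i))) < e / ?a"
      using sphere_uniform_in_parameter[OF U x0 G, of "e / ?a"] e a by auto
    have "norm ((LINT y|sphere_measure. f z y) - (LINT y|sphere_measure. f x0 y) -
        (LINT y|sphere_measure. f' x0 y (z - x0))) \<le> e * norm (z - x0)" if z: "norm (z - x0) < d" for z
    proof -
      have zb: "z \<in> ball x0 d" using z by (simp add: dist_norm norm_minus_commute)
      then have zU: "z \<in> U" using d by auto
      have "norm (f z y - f x0 y - f' x0 y (z - x0)) \<le> norm (z - x0) * (e / ?a)"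
        if y: "y \<in> usphere" for y
      proof -
        have seg: "x0 + t *\<^sub>R (z - x0) \<in> ball x0 d" if "t \<in> {0..1}" for t
        proof -
          have "norm (t *\<^sub>R (z - x0)) \<le> norm (z - x0)" using that by (simp add: mult_left_le_one_le)
          then show ?thesis using z by (simp add: dist_norm)
        qed
        show ?thesis
        proof (rule differentiable_bound_linearization[where f = "\<lambda>x. f x y" and S = "ball x0 d" and f' = "\<lambda>x. f' x y"])
          fix x assume x: "x \<in> ball x0 d"
          then have xU: "x \<in> U" using d by auto
          show "((\<lambda>x. f x y) has_derivative f' x y) (at x within ball x0 d)"
            using der[OF xU y] by (rule has_derivative_at_withinI)
          show "onorm (f' x y - f' x0 y) \<le> e / ?a" unfolding fun_diff_def
          proof (rule onorm_bound)
            fix h :: 'a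
            have "f' x y h - f' x0 y h = (\<Sum>i\<in>Basis. (h \<bullet> i) *\<^sub>R (f' x y i - f' x0 y i))"
              unfolding expand[OF xU y, of h] expand[OF x0 y, of h]
              by (simp add: scaleR_diff_right sum_subtractf)
            also have "norm \<dots> \<le> (\<Sum>i\<in>Basis. norm h * norm (f' x y i - f' x0 y i))"
              by (intro sum_norm_le) (auto intro!: mult_right_mono Basis_le_norm)
            also have "\<dots> = norm h * (\<Sum>i\<in>Basis. norm (f' x y i - f' x0 y i))"
              by (simp add: sum_distrib_left)
            also have "\<dots> \<le> norm h * (e / ?a)"
              using d(3)[OF x y] by (intro mult_left_mono) auto
            finally show "norm (f' x y h - f' x0 y h) \<le> e / ?a * norm h" by (simp add: mult.commute)
          qed (use e a in auto)
        qed (use seg d in auto)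
      qed
      then have "norm (LINT y|sphere_measure. f z y - f x0 y - f' x0 y (z - x0))
          \<le> norm (z - x0) * (e / ?a) * ?a"
        by (intro sphere_integral_norm_le continuous_intros f zU x0 slice_h)
      moreover have "(LINT y|sphere_measure. f z y - f x0 y - f' x0 y (z - x0)) =
          (LINT y|sphere_measure. f z y) - (LINT y|sphere_measure. f x0 y) -
          (LINT y|sphere_measure. f' x0 y (z - x0))"
        using f[OF zU] f[OF x0] slice_h[of "z - x0"]
        by (simp add: continuous_on_integrable_sphere)
      ultimately show ?thesis using a by (simp add: mult.commute)
    qed
    then show "\<exists>d>0. \<forall>z. norm (z - x0) < d \<longrightarrow>
       norm ((LINT y|sphere_measure. f z y) - (LINT y|sphere_measure. f x0 y) -
        (LINT y|sphere_measure. f' x0 y (z - x0))) \<le> e * norm (z - x0)"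
      using d(1) by blast
  qed
qed

text \<open>Differentiation under the integral, applied to the function and to its gradient.\<close>

lemma sphere_integral_harmonic:
  fixes f :: "'a::euclidean_space \<Rightarrow> 'a \<Rightarrow> real"
  assumes U: "open U"
    and f: "\<And>x. x \<in> U \<Longrightarrow> continuous_on usphere (f x)"
    and jet: "\<And>y. y \<in> usphere \<Longrightarrow> harmonic_jet (\<lambda>x. f x y) (\<lambda>x. D x y) (\<lambda>x. A x y) U"
    and D: "continuous_on (U \<times> usphere) (\<lambda>(x,y). D x y)"
    and A: "\<And>i. i \<in> Basis \<Longrightarrow> continuous_on (U \<times> usphere) (\<lambda>(x,y). A x y i)"
  shows "harmonic_on (\<lambda>x. LINT y|sphere_measure. f x y) U"
proof (rule harmonic_onI[where D = "\<lambda>x. LINT y|sphere_measure. D x y" and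
        A = "\<lambda>x h. LINT y|sphere_measure. A x y h"])
  have Di: "integrable sphere_measure (D x)" if "x \<in> U" for x
    by (rule continuous_on_integrable_sphere[OF continuous_on_slice[OF D that]])
  fix x assume x: "x \<in> U"
  have "((\<lambda>x. LINT y|sphere_measure. f x y) has_derivative
      (\<lambda>h. LINT y|sphere_measure. h \<bullet> D x y)) (at x)"
  proof (rule sphere_integral_has_derivative[OF U x f])
    fix i :: 'a assume "i \<in> Basis"
    show "continuous_on (U \<times> usphere) (\<lambda>(x, y). i \<bullet> D x y)"
      using D unfolding case_prod_beta by (intro continuous_intros)
  qed (use harmonic_jetD(1)[OF jet] in auto)
  then show "((\<lambda>x. LINT y|sphere_measure. f x y) has_derivative
      (\<lambda>h. h \<bullet> (LINT y|sphere_measure. D x y))) (at x)"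
    using Di[OF x] by simp
  show "((\<lambda>x. LINT y|sphere_measure. D x y) has_derivative (\<lambda>h. LINT y|sphere_measure. A x y h)) (at x)"
    by (rule sphere_integral_has_derivative[OF U x])
      (use harmonic_jetD(2)[OF jet] continuous_on_slice[OF D] A in auto)
  have "(\<Sum>i\<in>Basis. (LINT y|sphere_measure. A x y i) \<bullet> i) =
      (\<Sum>i\<in>Basis. (LINT y|sphere_measure. A x y i \<bullet> i))"
    using continuous_on_integrable_sphere[OF continuous_on_slice[OF A x]] by simp
  also have "\<dots> = (LINT y|sphere_measure. (\<Sum>i\<in>Basis. A x y i \<bullet> i))"
    using continuous_on_integrable_sphere[OF continuous_on_slice[OF A x]]
    by (intro Bochner_Integration.integral_sum[symmetric]) simp
  also have "\<dots> = (LINT y|(sphere_measure::'a measure). 0)"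
    by (rule sphere_integral_cong) (use harmonic_jetD(4)[OF jet] x in auto)
  finally show "(\<Sum>i\<in>Basis. (LINT y|sphere_measure. A x y i) \<bullet> i) = 0" by simp
next
  fix i :: 'a assume i: "i \<in> Basis"
  show "continuous_on U (\<lambda>x. LINT y|sphere_measure. A x y i)"
    using sphere_integral_continuous[OF U A[OF i]] .
qed (rule U)

section \<open>The Poisson kernel\<close>

text \<open>The squared distance is a polynomial, and its real powers are differentiated by the chain rule.\<close>

lemma poisson_kernel_eq:
  "poisson_kernel x y =
     (1 - x \<bullet> x) * ((x - y) \<bullet> (x - y)) powr (- (real DIM('a) / 2)) / sphere_area TYPE('a)"
  if "x \<noteq> y" for x y :: "'a::euclidean_space"
proof -
  have nz: "norm (x - y) > 0" using that by simp
  have "((x - y) \<bullet> (x - y)) powr (- (real DIM('a) / 2)) = (norm (x - y) powr 2) powr (- (real DIM('a) / 2))"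
    using nz by (simp add: dot_square_norm powr_numeral)
  also have "\<dots> = norm (x - y) powr (- real DIM('a))"
    by (subst powr_powr) simp
  also have "\<dots> = 1 / norm (x - y) ^ DIM('a)"
    using nz by (simp add: powr_minus powr_realpow divide_inverse)
  finally show ?thesis
    by (simp add: poisson_kernel_def sphere_area_def dot_square_norm mult_ac)
qed

lemma ball_neq_usphere: "x \<in> ball 0 1 \<Longrightarrow> y \<in> usphere \<Longrightarrow> x \<noteq> (y::'a::euclidean_space)"
  by auto

abbreviation sq_dist :: "'a::euclidean_space \<Rightarrow> 'a \<Rightarrow> real" where
  "sq_dist x y \<equiv> (x - y) \<bullet> (x - y)"

definition kernel_exponent :: "'a::euclidean_space itself \<Rightarrow> real" where
  "kernel_exponent _ = - (real DIM('a) / 2)"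

text \<open>Gradient and second derivative of \<open>(1 - \<bar>x\<bar>\<^sup>2) \<bar>x - y\<bar>\<^sup>-\<^sup>n\<close> in \<open>x\<close>, which is the Poisson kernel up to a
  constant.\<close>

definition kernel_gradient :: "'a::euclidean_space \<Rightarrow> 'a \<Rightarrow> 'a" where
  "kernel_gradient x y = (let m = kernel_exponent TYPE('a) in
     (- 2 * sq_dist x y powr m) *\<^sub>R x +
     ((1 - x \<bullet> x) * (m * sq_dist x y powr (m - 1)) * 2) *\<^sub>R (x - y))"

definition kernel_hessian :: "'a::euclidean_space \<Rightarrow> 'a \<Rightarrow> 'a \<Rightarrow> 'a" where
  "kernel_hessian x y h = (let m = kernel_exponent TYPE('a) in
     (- 2 * sq_dist x y powr m) *\<^sub>R h
     - (4 * (m * sq_dist x y powr (m - 1)) * ((x - y) \<bullet> h)) *\<^sub>R x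
     - (4 * (m * sq_dist x y powr (m - 1)) * (x \<bullet> h)) *\<^sub>R (x - y)
     + (4 * (1 - x \<bullet> x) * (m * (m - 1) * sq_dist x y powr (m - 2)) * ((x - y) \<bullet> h)) *\<^sub>R (x - y)
     + (2 * (1 - x \<bullet> x) * (m * sq_dist x y powr (m - 1))) *\<^sub>R h)"

text \<open>The trace of the second derivative is \<open>\<bar>x - y\<bar>\<^sup>-\<^sup>n\<^sup>-\<^sup>2\<close> times a multiple of
  \<open>2 x \<bullet> (x - y) - \<bar>x - y\<bar>\<^sup>2 + 1 - \<bar>x\<bar>\<^sup>2\<close>, and this vanishes for \<open>\<bar>y\<bar> = 1\<close>.\<close>

lemma kernel_jet:
  fixes y :: "'a::euclidean_space"
  shows "y \<in> usphere \<Longrightarrow>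
      harmonic_jet (\<lambda>x. (1 - x \<bullet> x) * sq_dist x y powr kernel_exponent TYPE('a))
        (\<lambda>x. kernel_gradient x y) (\<lambda>x. kernel_hessian x y) (ball 0 1)" (is "_ \<Longrightarrow> ?jet")
    and "continuous_on (ball 0 1 \<times> usphere) (\<lambda>(x,y::'a). kernel_gradient x y)" (is ?cD)
    and "continuous_on (ball 0 1 \<times> usphere) (\<lambda>(x,y::'a). kernel_hessian x y i)" (is ?cA)
proof -
  define m where "m = kernel_exponent TYPE('a)"
  define s where "s x y = sq_dist x y" for x y :: 'a
  define D where "D x y = kernel_gradient x y" for x y :: 'a
  define A where "A x y h = kernel_hessian x y h" for x y h :: 'a
  note D_def = D_def[unfolded kernel_gradient_def Let_def, folded m_def, folded s_def]
  note A_def = A_def[unfolded kernel_hessian_def Let_def, folded m_def, folded s_def]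
  have "\<forall>p\<in>ball 0 1 \<times> usphere. (fst p - snd p) \<bullet> (fst p - snd (p :: 'a \<times> 'a)) \<noteq> 0"
    using ball_neq_usphere by auto
  then have cD: "continuous_on (ball 0 1 \<times> usphere) (\<lambda>(x,y). D x y)"
      and cA: "continuous_on (ball 0 1 \<times> usphere) (\<lambda>(x,y). A x y i)" for i
    unfolding D_def A_def s_def case_prod_beta by (intro continuous_intros; assumption)+
  from cD show ?cD by (simp add: kernel_gradient_def D_def s_def m_def Let_def)
  from cA[of i] show ?cA by (simp add: kernel_hessian_def A_def s_def m_def Let_def)
  assume y: "y \<in> usphere"
  have pos: "s x y > 0" if "x \<in> ball 0 1" for x
    using ball_neq_usphere[OF that y] by (simp add: s_def)
  have ds: "((\<lambda>x. s x y powr a) has_derivative (\<lambda>h. a * s x y powr (a - 1) * (2 * ((x - y) \<bullet> h)))) (at x)"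
    if "x \<in> ball 0 1" for x a
  proof -
    have 1: "((\<lambda>x. s x y) has_derivative (\<lambda>h. 2 * ((x - y) \<bullet> h))) (at x)"
      unfolding s_def by (auto intro!: derivative_eq_intros simp: inner_commute)
    have 2: "((\<lambda>t. t powr a) has_real_derivative a * s x y powr (a - 1)) (at (s x y))"
      using pos[OF that] by (auto intro!: derivative_eq_intros)
    show ?thesis by (rule has_derivative_eq_rhs[OF DERIV_compose_FDERIV[OF 2 1]]) (simp add: fun_eq_iff)
  qed
  have "harmonic_jet (\<lambda>x. (1 - x \<bullet> x) * s x y powr m) (\<lambda>x. D x y) (\<lambda>x. A x y) (ball 0 1)"
    unfolding harmonic_jet_def
  proof (intro conjI ballI)
    fix x :: 'a assume x: "x \<in> ball 0 1"
    show "((\<lambda>x. (1 - x \<bullet> x) * s x y powr m) has_derivative (\<lambda>h. h \<bullet> D x y)) (at x)"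
      by (rule derivative_eq_intros ds[OF x] refl)+
        (auto simp: D_def fun_eq_iff inner_add_right algebra_simps inner_commute)
    show "((\<lambda>x. D x y) has_derivative A x y) (at x)"
      unfolding D_def
      by (rule derivative_eq_intros ds[OF x] refl)+
        (auto simp: A_def fun_eq_iff algebra_simps inner_commute scaleR_left_diff_distrib scaleR_right_diff_distrib scaleR_add_left scaleR_add_right)
    define n where "n = real DIM('a)"
    define p where "p = s x y powr (m - 2)"
    have p1: "s x y powr (m - 1) = s x y * p" and p0: "s x y powr m = s x y * s x y * p"
      using pos[OF x] unfolding p_def
      by (simp_all add: powr_diff powr_numeral power2_eq_square)
    have tr: "(\<Sum>i\<in>Basis. i \<bullet> (i::'a)) = n" unfolding n_def by simp
    have ip: "(\<Sum>i\<in>Basis. (u \<bullet> i) * (v \<bullet> i)) = u \<bullet> v" for u v :: 'a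
      by (rule euclidean_inner[symmetric])
    have "(\<Sum>i\<in>Basis. A x y i \<bullet> i) = (\<Sum>i\<in>Basis. (- 2 * s x y powr m + 2 * (1 - x \<bullet> x) * (m * s x y powr (m - 1))) * (i \<bullet> i)
       - 8 * (m * s x y powr (m - 1)) * ((x \<bullet> i) * ((x - y) \<bullet> i))
       + 4 * (1 - x \<bullet> x) * (m * (m - 1) * s x y powr (m - 2)) * (((x - y) \<bullet> i) * ((x - y) \<bullet> i)))"
      by (intro sum.cong refl) (simp add: A_def inner_add_left inner_diff_left algebra_simps)
    also have "\<dots> = (- 2 * s x y powr m + 2 * (1 - x \<bullet> x) * (m * s x y powr (m - 1))) * n
       - 8 * (m * s x y powr (m - 1)) * (x \<bullet> (x - y))
       + 4 * (1 - x \<bullet> x) * (m * (m - 1) * s x y powr (m - 2)) * s x y"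
      by (simp only: sum.distrib sum_subtractf sum_distrib_left[symmetric] tr ip s_def)
    also have "\<dots> = 2 * n * s x y * p * (2 * (x \<bullet> (x - y)) - s x y + 1 - x \<bullet> x)"
      unfolding p0 p1 p_def[symmetric] unfolding m_def kernel_exponent_def n_def[symmetric] by (simp add: field_simps)
    also have "2 * (x \<bullet> (x - y)) - s x y + 1 - x \<bullet> x = 0"
    proof -
      have "y \<bullet> y = 1" using y by (simp add: dot_square_norm)
      then show ?thesis by (simp add: s_def inner_diff_left inner_diff_right inner_commute)
    qed
    finally show "(\<Sum>i\<in>Basis. A x y i \<bullet> i) = 0" by simp
  next
    fix i :: 'a
    have "continuous_on (ball 0 1) (\<lambda>x. (\<lambda>(x,y). A x y i) (x, y))"
      by (rule continuous_on_compose2[OF cA[of i]]) (use y in \<open>auto intro!: continuous_intros\<close>)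
    then show "continuous_on (ball 0 1) (\<lambda>x. A x y i)" by simp
  qed
  moreover have "(\<lambda>x. D x y) = (\<lambda>x. kernel_gradient x y)" "(\<lambda>x. A x y) = (\<lambda>x. kernel_hessian x y)"
    by (simp_all add: fun_eq_iff kernel_gradient_def kernel_hessian_def A_def D_def s_def m_def Let_def)
  ultimately show ?jet by (simp add: s_def m_def)
qed

definition poisson_integral :: "('a::euclidean_space \<Rightarrow> real) \<Rightarrow> 'a \<Rightarrow> real" where
  "poisson_integral g x = (LINT y|sphere_measure. g y * poisson_kernel x y)"

lemma continuous_poisson_kernel:
  "continuous_on (ball 0 1 \<times> usphere) (\<lambda>(x, y::'a::euclidean_space). poisson_kernel x y)"
proof -
  have "\<forall>p\<in>ball 0 1 \<times> usphere. norm (fst p - snd (p :: 'a \<times> 'a)) ^ DIM('a) \<noteq> 0"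
    using ball_neq_usphere by auto
  then show ?thesis unfolding poisson_kernel_def case_prod_beta
    by (intro continuous_intros; assumption)
qed

lemma continuous_poisson_kernel_snd:
  "x \<in> ball 0 1 \<Longrightarrow> continuous_on usphere (poisson_kernel (x::'a::euclidean_space))"
  by (rule continuous_on_slice[OF continuous_poisson_kernel])

lemma harmonic_poisson_integral:
  fixes g :: "'a::euclidean_space \<Rightarrow> real"
  assumes g: "continuous_on usphere g"
  shows "harmonic_on (poisson_integral g) (ball 0 1)"
proof -
  define m where "m = kernel_exponent TYPE('a)"
  define s where "s x y = sq_dist x y" for x y :: 'a
  define D where "D x y = kernel_gradient x y" for x y :: 'a
  define A where "A x y h = kernel_hessian x y h" for x y h :: 'a
  have D_eq: "kernel_gradient = D" and A_eq: "kernel_hessian = A" by (simp_all add: D_def A_def fun_eq_iff)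
  note jet = kernel_jet[where 'a='a, folded m_def, folded s_def, unfolded D_eq A_eq]
  define c where "c = 1 / sphere_area TYPE('a)"
  have gs: "continuous_on (ball 0 1 \<times> usphere) (\<lambda>p::'a\<times>'a. g (snd p))"
    by (rule continuous_on_compose2[OF g]) (auto intro!: continuous_intros)
  have "harmonic_on (\<lambda>x. LINT y|sphere_measure. (c * g y) * ((1 - x \<bullet> x) * s x y powr m)) (ball 0 1)"
  proof (rule sphere_integral_harmonic[where D = "\<lambda>x y. (c * g y) *\<^sub>R D x y" and A = "\<lambda>x y h. (c * g y) *\<^sub>R A x y h"])
    fix x :: 'a assume "x \<in> ball 0 1"
    then have "\<forall>y\<in>usphere. s x y \<noteq> 0" using ball_neq_usphere by (auto simp: s_def)
    then show "continuous_on usphere (\<lambda>y. (c * g y) * ((1 - x \<bullet> x) * s x y powr m))"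
      unfolding s_def by (intro continuous_intros g)
  next
    fix y :: 'a assume y: "y \<in> usphere"
    note j = harmonic_jetD[OF jet(1)[OF y]]
    show "harmonic_jet (\<lambda>x. (c * g y) * ((1 - x \<bullet> x) * s x y powr m)) (\<lambda>x. (c * g y) *\<^sub>R D x y)
       (\<lambda>x h. (c * g y) *\<^sub>R A x y h) (ball 0 1)"
      unfolding harmonic_jet_def
    proof (intro conjI ballI)
      fix x :: 'a assume x: "x \<in> ball 0 1"
      show "((\<lambda>x. (c * g y) * ((1 - x \<bullet> x) * s x y powr m)) has_derivative (\<lambda>h. h \<bullet> (c * g y) *\<^sub>R D x y)) (at x)"
        using has_derivative_mult_right[OF j(1)[OF x], of "c * g y"] by simp
      show "((\<lambda>x. (c * g y) *\<^sub>R D x y) has_derivative (\<lambda>h. (c * g y) *\<^sub>R A x y h)) (at x)"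
        by (rule has_derivative_scaleR_right[OF j(2)[OF x]])
      show "(\<Sum>i\<in>Basis. (c * g y) *\<^sub>R A x y i \<bullet> i) = 0"
        using j(4)[OF x] by (simp add: sum_distrib_left[symmetric])
    next
      fix i :: 'a assume "i \<in> Basis"
      then show "continuous_on (ball 0 1) (\<lambda>x. (c * g y) *\<^sub>R A x y i)"
        by (intro continuous_intros j(3))
    qed
  next
    show "continuous_on (ball 0 1 \<times> usphere) (\<lambda>(x, y). (c * g y) *\<^sub>R D x y)"
      using jet(2) gs unfolding case_prod_beta by (intro continuous_intros)
    show "continuous_on (ball 0 1 \<times> usphere) (\<lambda>(x, y). (c * g y) *\<^sub>R A x y i)" for i
      using jet(3)[of i] gs unfolding case_prod_beta by (intro continuous_intros)
  qed simp
  then show ?thesis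
  proof (rule harmonic_on_cong)
    fix x :: 'a assume x: "x \<in> ball 0 1"
    show "poisson_integral g x = (LINT y|sphere_measure. (c * g y) * ((1 - x \<bullet> x) * s x y powr m))"
      unfolding poisson_integral_def
      by (rule sphere_integral_cong)
        (simp add: poisson_kernel_eq[OF ball_neq_usphere[OF x]] s_def m_def kernel_exponent_def c_def)
  qed
qed

text \<open>The reflection in the hyperplane orthogonal to \<open>a - b\<close> exchanges \<open>a\<close> and \<open>b\<close>.\<close>

lemma orthogonal_transformation_exists:
  fixes a b :: "'a::euclidean_space"
  assumes "norm a = norm b"
  obtains T where "orthogonal_transformation T" "T a = b"
proof (cases "a = b")
  case True
  then show ?thesis using that[of "\<lambda>x. x"] by simp
next
  case False
  define w where "w = a - b"
  have w: "w \<bullet> w \<noteq> 0" using False by (simp add: w_def)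
  have aa: "a \<bullet> a = b \<bullet> b" using assms by (simp add: dot_square_norm)
  define T where "T x = x - (2 * (x \<bullet> w) / (w \<bullet> w)) *\<^sub>R w" for x
  have "linear T"
    by (rule linearI) (simp_all add: T_def inner_add_left algebra_simps add_divide_distrib)
  moreover have "T u \<bullet> T v = u \<bullet> v" for u v
    using w by (simp add: T_def inner_diff_left inner_diff_right field_simps inner_commute)
  moreover have "2 * (a \<bullet> w) = w \<bullet> w"
    using aa by (simp add: w_def inner_diff_left inner_diff_right inner_commute)
  then have "T a = b" using w by (simp add: T_def) (simp add: w_def)
  ultimately show ?thesis using that[of T] by (simp add: orthogonal_transformation_def)
qed

lemma poisson_kernel_orthogonal:
  fixes T :: "'a::euclidean_space \<Rightarrow> 'a"
  assumes "orthogonal_transformation T"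
  shows "poisson_kernel (T x) (T y) = poisson_kernel x y"
  using orthogonal_transformation_norm[OF assms]
    linear_diff[OF orthogonal_transformation_linear[OF assms], symmetric]
  by (simp add: poisson_kernel_def)

lemma poisson_kernel_nonneg: "x \<in> ball 0 1 \<Longrightarrow> poisson_kernel x (y::'a::euclidean_space) \<ge> 0"
  unfolding poisson_kernel_def
  by (intro mult_nonneg_nonneg divide_nonneg_nonneg)
    (auto simp: power_le_one intro!: Gamma_real_nonneg)

text \<open>The integral is a harmonic function of \<open>x\<close> that depends only on \<open>\<bar>x\<bar>\<close>, since the kernel and the
  surface measure are invariant under orthogonal maps. Being constant on spheres it is constant by the maximum
  principle, and at \<open>0\<close> its value is \<open>1\<close>.\<close>

lemma poisson_kernel_integral:
  fixes x :: "'a::euclidean_space"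
  assumes x: "x \<in> ball 0 1"
  shows "(LINT y|sphere_measure. poisson_kernel x y) = 1"
proof -
  define p where "p = poisson_integral (\<lambda>y::'a. 1)"
  have harm: "harmonic_on p (ball 0 1)" unfolding p_def by (intro harmonic_poisson_integral continuous_intros)
  have rot: "p (T z) = p z" if T: "orthogonal_transformation T" and z: "z \<in> ball 0 1" for T z
  proof -
    have "T z \<in> ball 0 1" using z orthogonal_transformation_norm[OF T] by simp
    then have "p (T z) = (LINT y|sphere_measure. poisson_kernel (T z) (T y))"
      unfolding p_def poisson_integral_def
      by (simp add: sphere_integral_orthogonal[OF T continuous_poisson_kernel_snd])
    then show ?thesis by (simp add: p_def poisson_integral_def poisson_kernel_orthogonal[OF T])
  qed
  have "\<bar>p 0 - p x\<bar> \<le> 0"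
  proof (rule harmonic_maximum_principle_abs[where f = "\<lambda>z. p z - p x" and x = 0 and
        K = "cball 0 (norm x)" and U = "ball 0 (norm x)"])
    have sub: "cball 0 (norm x) \<subseteq> ball (0::'a) 1" using x by auto
    show "harmonic_on (\<lambda>z. p z - p x) (ball 0 (norm x))"
      using harmonic_on_subset[OF harm] sub ball_subset_cball
      by (intro harmonic_on_diff harmonic_on_const) blast+
    show "continuous_on (cball 0 (norm x)) (\<lambda>z. p z - p x)"
      by (intro continuous_intros continuous_on_subset[OF harmonic_on_continuous[OF harm] sub])
    fix z :: 'a assume "z \<in> cball 0 (norm x) - ball 0 (norm x)"
    then have "norm x = norm z" by auto
    then obtain T where "orthogonal_transformation T" "T x = z" by (rule orthogonal_transformation_exists)
    then show "\<bar>p z - p x\<bar> \<le> 0" using rot x by auto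
  qed auto
  then have "p x = p 0" by simp
  also have "p 0 = (LINT y|(sphere_measure::'a measure). 1 / sphere_area TYPE('a))"
    unfolding p_def poisson_integral_def
    by (rule sphere_integral_cong) (simp add: poisson_kernel_def sphere_area_def)
  also have "\<dots> = 1" using sphere_area_pos[where 'a='a] by (simp only: sphere_integral_const) simp
  finally show ?thesis by (simp add: p_def poisson_integral_def)
qed

section \<open>The Poisson formula\<close>

lemma poisson_integral_abs_le:
  fixes h :: "'a::euclidean_space \<Rightarrow> real"
  assumes h: "continuous_on usphere h" and bd: "\<And>y. y \<in> usphere \<Longrightarrow> \<bar>h y\<bar> \<le> e" and x: "x \<in> ball 0 1"
  shows "\<bar>poisson_integral h x\<bar> \<le> e"
proof -
  have K: "continuous_on usphere (poisson_kernel x)" by (rule continuous_poisson_kernel_snd[OF x])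
  have "\<bar>poisson_integral h x\<bar> \<le> (LINT y|sphere_measure. \<bar>h y * poisson_kernel x y\<bar>)"
    unfolding poisson_integral_def by (rule integral_abs_bound)
  also have "\<dots> \<le> (LINT y|sphere_measure. e * poisson_kernel x y)"
    using bd poisson_kernel_nonneg[OF x]
    by (intro sphere_integral_mono continuous_intros h K) (auto simp: abs_mult intro!: mult_right_mono)
  also have "\<dots> = e" using poisson_kernel_integral[OF x] by simp
  finally show ?thesis .
qed

lemma poisson_integral_cong:
  "(\<And>y. y \<in> usphere \<Longrightarrow> g y = h y) \<Longrightarrow> poisson_integral g x = poisson_integral h x"
  unfolding poisson_integral_def by (rule sphere_integral_cong) simp

lemma poisson_integral_add:
  assumes "continuous_on usphere g" "continuous_on usphere h" and x: "x \<in> ball (0::'a::euclidean_space) 1"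
  shows "poisson_integral (\<lambda>y. g y + h y) x = poisson_integral g x + poisson_integral h x"
  unfolding poisson_integral_def distrib_right
  by (intro sphere_integral_add continuous_intros assms continuous_poisson_kernel_snd[OF x])

lemma poisson_integral_cmult: "poisson_integral (\<lambda>y. c * g y) x = c * poisson_integral g x"
  by (simp add: poisson_integral_def mult.assoc)

lemma poisson_integral_diff:
  assumes "continuous_on usphere g" "continuous_on usphere h" and x: "x \<in> ball (0::'a::euclidean_space) 1"
  shows "poisson_integral (\<lambda>y. g y - h y) x = poisson_integral g x - poisson_integral h x"
  using poisson_integral_add[OF assms(1) continuous_on_minus[OF assms(2)] x]
    poisson_integral_cmult[of "-1" h x] by simp

lemma poisson_integral_const: "x \<in> ball (0::'a::euclidean_space) 1 \<Longrightarrow> poisson_integral (\<lambda>y. c) x = c"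
  by (simp add: poisson_integral_def poisson_kernel_integral)

text \<open>The exponent is that of the singularity of the Poisson kernel: the error term, multiplied by the
  kernel, becomes a multiple of \<open>1 - \<bar>x\<bar>\<^sup>2\<close>.\<close>

lemma sphere_modulus_of_continuity:
  fixes g :: "'a::euclidean_space \<Rightarrow> real"
  assumes g: "continuous_on usphere g" and e: "e > 0"
  obtains C where "C \<ge> 0"
    "\<And>x y. x \<in> usphere \<Longrightarrow> y \<in> usphere \<Longrightarrow> \<bar>g x - g y\<bar> \<le> e + C * norm (x - y) ^ DIM('a)"
proof -
  have "uniformly_continuous_on usphere g" by (intro compact_uniformly_continuous g compact_sphere)
  then obtain d where d: "d > 0"
    "\<And>x y. x \<in> usphere \<Longrightarrow> y \<in> usphere \<Longrightarrow> dist x y < d \<Longrightarrow> dist (g x) (g y) < e"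
    unfolding uniformly_continuous_on_def using e by metis
  have "compact (g ` usphere)" by (intro compact_continuous_image g compact_sphere)
  then obtain B where B: "B > 0" "\<And>x. x \<in> usphere \<Longrightarrow> \<bar>g x\<bar> \<le> B"
    using compact_imp_bounded bounded_pos by (metis imageI real_norm_def)
  show thesis
  proof (rule that[of "2 * B / d ^ DIM('a)"])
    show "2 * B / d ^ DIM('a) \<ge> 0" using B d by simp
    fix x y :: 'a assume xy: "x \<in> usphere" "y \<in> usphere"
    show "\<bar>g x - g y\<bar> \<le> e + 2 * B / d ^ DIM('a) * norm (x - y) ^ DIM('a)"
    proof (cases "dist x y < d")
      case True
      then have "\<bar>g x - g y\<bar> < e" using d(2)[OF xy] by (simp add: dist_real_def)
      moreover have "0 \<le> 2 * B / d ^ DIM('a) * norm (x - y) ^ DIM('a)" using B d by simp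
      ultimately show ?thesis by linarith
    next
      case False
      then have "d ^ DIM('a) \<le> norm (x - y) ^ DIM('a)"
        using d by (intro power_mono) (auto simp: dist_norm)
      then have "2 * B * d ^ DIM('a) \<le> 2 * B * norm (x - y) ^ DIM('a)" using B by simp
      then have "2 * B \<le> 2 * B / d ^ DIM('a) * norm (x - y) ^ DIM('a)" using d by (simp add: field_simps)
      moreover have "\<bar>g x - g y\<bar> \<le> 2 * B" using B(2)[OF xy(1)] B(2)[OF xy(2)] by linarith
      ultimately show ?thesis using e by linarith
    qed
  qed
qed

lemma scaleR_usphere_ball: "0 \<le> r \<Longrightarrow> r < 1 \<Longrightarrow> t \<in> usphere \<Longrightarrow> r *\<^sub>R t \<in> ball (0::'a::euclidean_space) 1"
  by simp

text \<open>Because the kernel has mass one, the difference is the integral of \<open>(g y - g t) K\<close>. The bound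
  \<open>\<epsilon> + C \<bar>y - t\<bar>\<^sup>n\<close> for the first factor and \<open>\<bar>y - t\<bar> \<le> 2 \<bar>r t - y\<bar>\<close> cancel the singularity of the
  kernel on the whole sphere at once.\<close>

lemma poisson_integral_boundary:
  fixes g :: "'a::euclidean_space \<Rightarrow> real"
  assumes g: "continuous_on usphere g" and e: "e > 0"
  obtains r0 where "0 \<le> r0" "r0 < 1"
    "\<And>r t. r0 \<le> r \<Longrightarrow> r < 1 \<Longrightarrow> t \<in> usphere \<Longrightarrow> \<bar>poisson_integral g (r *\<^sub>R t) - g t\<bar> \<le> e"
proof -
  obtain C where C: "C \<ge> 0" "\<And>x y. x \<in> usphere \<Longrightarrow> y \<in> usphere \<Longrightarrow>
      \<bar>g x - g y\<bar> \<le> e / 2 + C * norm (x - y) ^ DIM('a)"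
    using sphere_modulus_of_continuity[OF g, of "e / 2"] e by auto
  define C' where "C' = C * 2 ^ DIM('a)"
  have C': "C' \<ge> 0" using C by (simp add: C'_def)
  \<comment> \<open>\<open>1 - r\<^sup>2 \<le> 2 (1 - r) \<le> 2 d\<close>, and \<open>2 C' d \<le> e / 2\<close>.\<close>
  define d where "d = min 1 (e / (4 * (C' + 1)))"
  have d: "0 < d" "d \<le> 1" using e C' by (auto simp: d_def)
  have "C' * d \<le> (C' + 1) * (e / (4 * (C' + 1)))"
    using C' d by (intro mult_mono) (auto simp: d_def)
  also have "\<dots> = e / 4" using C' by (simp add: field_simps)
  finally have Cd: "C' * d \<le> e / 4" .
  show thesis
  proof (rule that[of "1 - d"])
    fix r :: real and t :: 'a assume r: "1 - d \<le> r" "r < 1" and t: "t \<in> usphere"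
    have r0: "r \<ge> 0" using r d by linarith
    have x: "r *\<^sub>R t \<in> ball 0 1" by (rule scaleR_usphere_ball[OF r0 r(2) t])
    let ?K = "poisson_kernel (r *\<^sub>R t)" and ?a = "sphere_area TYPE('a)"
    have K: "continuous_on usphere ?K" by (rule continuous_poisson_kernel_snd[OF x])
    have "\<bar>poisson_integral g (r *\<^sub>R t) - g t\<bar> = \<bar>poisson_integral (\<lambda>y. g y - g t) (r *\<^sub>R t)\<bar>"
      using poisson_integral_diff[OF g continuous_on_const x] poisson_integral_const[OF x] by simp
    also have "\<dots> \<le> (LINT y|sphere_measure. \<bar>(g y - g t) * ?K y\<bar>)"
      unfolding poisson_integral_def by (rule integral_abs_bound)
    also have "\<dots> \<le> (LINT y|sphere_measure. e / 2 * ?K y + C' * (1 - r\<^sup>2) / ?a)"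
    proof (intro sphere_integral_mono continuous_intros g K)
      fix y :: 'a assume y: "y \<in> usphere"
      have "norm (t - r *\<^sub>R t) = 1 - r"
        using t r by (metis norm_scaleR scaleR_left_diff_distrib scaleR_one abs_of_nonneg
            diff_ge_0_iff_ge less_imp_le mem_sphere_0 mult.right_neutral)
      moreover have "1 - r \<le> norm (r *\<^sub>R t - y)"
        using norm_triangle_ineq2[of y "r *\<^sub>R t"] y t r0 by (simp add: norm_minus_commute)
      ultimately have "norm (y - t) \<le> 2 * norm (r *\<^sub>R t - y)"
        using norm_triangle_ineq[of "t - r *\<^sub>R t" "r *\<^sub>R t - y"] by (simp add: norm_minus_commute)
      then have "norm (y - t) ^ DIM('a) \<le> (2 * norm (r *\<^sub>R t - y)) ^ DIM('a)"
        by (intro power_mono) auto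
      then have "C * norm (y - t) ^ DIM('a) \<le> C' * norm (r *\<^sub>R t - y) ^ DIM('a)"
        unfolding C'_def power_mult_distrib mult.assoc by (rule mult_left_mono[OF _ C(1)])
      then have "\<bar>g y - g t\<bar> \<le> e / 2 + C' * norm (r *\<^sub>R t - y) ^ DIM('a)"
        using C(2)[OF y t] by linarith
      then have "\<bar>(g y - g t) * ?K y\<bar> \<le> (e / 2 + C' * norm (r *\<^sub>R t - y) ^ DIM('a)) * ?K y"
        using poisson_kernel_nonneg[OF x] by (simp add: abs_mult mult_right_mono)
      also have "\<dots> = e / 2 * ?K y + C' * (norm (r *\<^sub>R t - y) ^ DIM('a) * ?K y)"
        by (simp add: algebra_simps)
      also have "norm (r *\<^sub>R t - y) ^ DIM('a) * ?K y = (1 - r\<^sup>2) / ?a"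
        using ball_neq_usphere[OF x y] t by (simp add: poisson_kernel_def sphere_area_def)
      finally show "\<bar>(g y - g t) * ?K y\<bar> \<le> e / 2 * ?K y + C' * (1 - r\<^sup>2) / ?a" by simp
    qed
    also have "\<dots> = (LINT y|sphere_measure. e / 2 * ?K y) + (LINT y|(sphere_measure::'a measure). C' * (1 - r\<^sup>2) / ?a)"
      by (intro Bochner_Integration.integral_add continuous_on_integrable_sphere continuous_intros K)
    also have "\<dots> = e / 2 + C' * (1 - r\<^sup>2)"
      unfolding sphere_integral_const using poisson_kernel_integral[OF x] sphere_area_pos[where 'a='a] by simp
    also have "\<dots> \<le> e / 2 + C' * (2 * d)"
    proof -
      have "1 - r\<^sup>2 = (1 - r) * (1 + r)" by (simp add: power2_eq_square algebra_simps)
      also have "\<dots> \<le> d * 2" using r r0 d by (intro mult_mono) auto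
      finally show ?thesis using C' by (simp add: mult_left_mono mult.commute)
    qed
    also have "\<dots> \<le> e" using Cd by simp
    finally show "\<bar>poisson_integral g (r *\<^sub>R t) - g t\<bar> \<le> e" .
  qed (use d in auto)
qed

text \<open>The difference of the two sides is harmonic in the ball and uniformly small on spheres of radius
  close to one; the maximum principle carries this into the interior.\<close>

theorem poisson_formula:
  fixes u :: "'a::euclidean_space \<Rightarrow> real"
  assumes u: "continuous_on (cball 0 1) u" and harm: "harmonic_on u (ball 0 1)" and x: "x \<in> ball 0 1"
  shows "poisson_integral u x = u x"
proof -
  have us: "continuous_on usphere u" by (rule continuous_on_subset[OF u]) auto
  have "\<bar>poisson_integral u x - u x\<bar> \<le> e" if e: "e > 0" for e
  proof -
    obtain r0 where r0: "0 \<le> r0" "r0 < 1" "\<And>r t. r0 \<le> r \<Longrightarrow> r < 1 \<Longrightarrow> t \<in> usphere \<Longrightarrow>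
        \<bar>poisson_integral u (r *\<^sub>R t) - u t\<bar> \<le> e / 2"
      using poisson_integral_boundary[OF us, of "e / 2"] e by auto
    have "uniformly_continuous_on (cball 0 1) u" by (intro compact_uniformly_continuous u compact_cball)
    then obtain d where d: "d > 0"
      "\<And>x y. x \<in> cball 0 1 \<Longrightarrow> y \<in> cball 0 1 \<Longrightarrow> dist x y < d \<Longrightarrow> dist (u x) (u y) < e / 2"
      unfolding uniformly_continuous_on_def using e by (metis half_gt_zero)
    define r where "r = max (max r0 (norm x)) (max (1 / 2) (1 - d / 2))"
    have r: "r0 \<le> r" "norm x \<le> r" "1 - d < r" "r < 1" "0 < r"
      using r0 d x by (auto simp: r_def)
    show ?thesis
    proof (rule harmonic_maximum_principle_abs[where f = "\<lambda>z. poisson_integral u z - u z" and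
          K = "cball 0 r" and U = "ball 0 r"])
      have "harmonic_on (\<lambda>z. poisson_integral u z - u z) (ball 0 1)"
        by (intro harmonic_on_diff harmonic_poisson_integral us harm)
      moreover have "ball 0 r \<subseteq> ball (0::'a) 1" "cball 0 r \<subseteq> ball (0::'a) 1" using r by auto
      ultimately show "harmonic_on (\<lambda>z. poisson_integral u z - u z) (ball 0 r)"
        "continuous_on (cball 0 r) (\<lambda>z. poisson_integral u z - u z)"
        by (auto intro: harmonic_on_subset continuous_on_subset harmonic_on_continuous)
      fix z :: 'a assume "z \<in> cball 0 r - ball 0 r"
      then have nz: "norm z = r" by auto
      define t where "t = z /\<^sub>R r"
      have t: "t \<in> usphere" "z = r *\<^sub>R t" using nz r by (auto simp: t_def)
      have "\<bar>poisson_integral u z - u t\<bar> \<le> e / 2" using r0(3)[OF r(1,4) t(1)] t(2) by simp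
      moreover have "dist t z = 1 - r"
        using t r by (metis abs_of_nonneg diff_ge_0_iff_ge dist_norm less_imp_le mem_sphere_0
            mult.right_neutral norm_scaleR scaleR_left_diff_distrib scaleR_one)
      then have "dist (u t) (u z) < e / 2" using d(2)[of t z] t nz r by simp
      ultimately show "\<bar>poisson_integral u z - u z\<bar> \<le> e" unfolding dist_real_def by linarith
    qed (use r in auto)
  qed
  then have "\<bar>poisson_integral u x - u x\<bar> \<le> 0" by (rule field_le_epsilon[where y = 0, simplified])
  then show ?thesis by simp
qed

lemma poisson_formula_affine:
  fixes u :: "'a::euclidean_space \<Rightarrow> real"
  assumes u: "continuous_on (cball z r) u" and harm: "harmonic_on u (ball z r)" and r: "r > 0"
    and x: "x \<in> ball 0 1"
  shows "poisson_integral (\<lambda>y. u (z + r *\<^sub>R y)) x = u (z + r *\<^sub>R x)"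
proof (rule poisson_formula[OF _ _ x])
  have "norm (r *\<^sub>R y) \<le> r" if "norm y \<le> 1" for y :: 'a using that r by simp
  then show "continuous_on (cball 0 1) (\<lambda>y. u (z + r *\<^sub>R y))"
    by (intro continuous_on_compose2[OF u] continuous_intros) (auto simp: dist_norm)
  have "{y. z + r *\<^sub>R y \<in> ball z r} = ball 0 1" using r by (auto simp: dist_norm)
  then show "harmonic_on (\<lambda>y. u (z + r *\<^sub>R y)) (ball 0 1)"
    using harmonic_on_affine[OF harm, of z r] by simp
qed

text \<open>On a small ball the Poisson formula passes to the uniform limit, so the limit is a Poisson integral of
  a continuous function there.\<close>

theorem harmonic_on_uniform_limit:
  fixes g :: "'a::euclidean_space \<Rightarrow> real"
  assumes approx: "\<And>x. x \<in> S \<Longrightarrow> \<exists>d>0. cball x d \<subseteq> S \<and>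
     (\<forall>e>0. \<exists>f. harmonic_on f S \<and> (\<forall>y\<in>cball x d. \<bar>f y - g y\<bar> \<le> e))"
  shows "harmonic_on g S"
proof (rule harmonic_on_locally)
  fix x assume "x \<in> S"
  then obtain d where d: "d > 0" "cball x d \<subseteq> S"
    and ap: "\<And>e. e > 0 \<Longrightarrow> \<exists>f. harmonic_on f S \<and> (\<forall>y\<in>cball x d. \<bar>f y - g y\<bar> \<le> e)"
    using approx by blast
  have "\<forall>n. \<exists>f. harmonic_on f S \<and> (\<forall>y\<in>cball x d. \<bar>f y - g y\<bar> \<le> inverse (real (Suc n)))"
    using ap by simp
  then obtain f where f: "\<And>n. harmonic_on (f n) S"
    "\<And>n y. y \<in> cball x d \<Longrightarrow> \<bar>f n y - g y\<bar> \<le> inverse (real (Suc n))" by metis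
  have fc: "continuous_on (cball x d) (f n)" for n
    by (rule continuous_on_subset[OF harmonic_on_continuous[OF f(1)] d(2)])
  have gc: "continuous_on (cball x d) g"
  proof (rule uniform_limit_theorem)
    show "uniform_limit (cball x d) f g sequentially"
    proof (rule uniform_limitI)
      fix e :: real assume "e > 0"
      then have "\<forall>\<^sub>F n in sequentially. inverse (real (Suc n)) < e"
        using LIMSEQ_inverse_real_of_nat by (auto dest: order_tendstoD(2))
      then show "\<forall>\<^sub>F n in sequentially. \<forall>y\<in>cball x d. dist (f n y) (g y) < e"
      proof eventually_elim
        case (elim n)
        then show ?case using f(2)[of _ n] unfolding dist_real_def by (meson le_less_trans)
      qed
    qed
  qed (auto simp: fc)
  have inb: "x + d *\<^sub>R y \<in> cball x d" if "norm y \<le> 1" for y :: 'a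
    using that d(1) by (simp add: dist_norm)
  have cmp: "continuous_on usphere (\<lambda>y. h (x + d *\<^sub>R y))" if "continuous_on (cball x d) h" for h :: "'a \<Rightarrow> real"
  proof (rule continuous_on_compose2[OF that])
    show "continuous_on usphere (\<lambda>y. x + d *\<^sub>R y)" by (intro continuous_intros)
    show "(\<lambda>y. x + d *\<^sub>R y) ` usphere \<subseteq> cball x d"
      using inb by auto
  qed
  have eq: "poisson_integral (\<lambda>y. g (x + d *\<^sub>R y)) y = g (x + d *\<^sub>R y)" if y: "y \<in> ball 0 1" for y
  proof -
    let ?p = "poisson_integral (\<lambda>y. g (x + d *\<^sub>R y)) y"
    have "\<bar>?p - g (x + d *\<^sub>R y)\<bar> \<le> 0 + e" if e: "e > 0" for e
    proof -
      obtain n where n: "inverse (real (Suc n)) < e / 2"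
        using reals_Archimedean[of "e / 2"] e by auto
      have "poisson_integral (\<lambda>y. f n (x + d *\<^sub>R y)) y = f n (x + d *\<^sub>R y)"
        by (rule poisson_formula_affine[OF fc harmonic_on_subset[OF f(1) open_ball] d(1) y])
          (use d(2) ball_subset_cball in blast)
      moreover have "\<bar>poisson_integral (\<lambda>y. g (x + d *\<^sub>R y) - f n (x + d *\<^sub>R y)) y\<bar> \<le> inverse (real (Suc n))"
      proof (intro poisson_integral_abs_le continuous_on_diff cmp fc gc y)
        fix y :: 'a assume "y \<in> usphere"
        then have "\<bar>f n (x + d *\<^sub>R y) - g (x + d *\<^sub>R y)\<bar> \<le> inverse (real (Suc n))"
          by (intro f(2) inb) simp
        then show "\<bar>g (x + d *\<^sub>R y) - f n (x + d *\<^sub>R y)\<bar> \<le> inverse (real (Suc n))"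
          by linarith
      qed
      moreover have "poisson_integral (\<lambda>y. g (x + d *\<^sub>R y) - f n (x + d *\<^sub>R y)) y =
          ?p - poisson_integral (\<lambda>y. f n (x + d *\<^sub>R y)) y"
        by (intro poisson_integral_diff cmp fc gc y)
      moreover have "\<bar>f n (x + d *\<^sub>R y) - g (x + d *\<^sub>R y)\<bar> \<le> inverse (real (Suc n))"
        using y by (intro f(2) inb) simp
      ultimately show ?thesis using n by linarith
    qed
    then have "\<bar>?p - g (x + d *\<^sub>R y)\<bar> \<le> 0" by (rule field_le_epsilon)
    then show ?thesis by simp
  qed
  have "harmonic_on (\<lambda>y. g (x + d *\<^sub>R y)) (ball 0 1)"
    using harmonic_poisson_integral[OF cmp[OF gc]] by (rule harmonic_on_cong) (simp add: eq)
  moreover have "x + d *\<^sub>R (- (1 / d) *\<^sub>R x + (1 / d) *\<^sub>R y) = y" for y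
    using d(1) by (simp only: scaleR_add_right scaleR_scaleR) simp
  ultimately have "harmonic_on g {y. - (1 / d) *\<^sub>R x + (1 / d) *\<^sub>R y \<in> ball 0 1}"
    using harmonic_on_affine[of "\<lambda>y. g (x + d *\<^sub>R y)" "ball 0 1" "- (1 / d) *\<^sub>R x" "1 / d"] by (simp only:)
  moreover have "{y. - (1 / d) *\<^sub>R x + (1 / d) *\<^sub>R y \<in> ball 0 1} = ball x d"
  proof (rule set_eqI)
    fix y
    have "- (1 / d) *\<^sub>R x + (1 / d) *\<^sub>R y = (1 / d) *\<^sub>R (y - x)" by (simp add: scaleR_diff_right)
    then have "norm (- (1 / d) *\<^sub>R x + (1 / d) *\<^sub>R y) = dist x y / d"
      using d(1) by (simp only: norm_scaleR dist_norm norm_minus_commute[of x y]) simp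
    then show "y \<in> {y. - (1 / d) *\<^sub>R x + (1 / d) *\<^sub>R y \<in> ball 0 1} \<longleftrightarrow> y \<in> ball x d"
      using d(1) by (simp only: mem_Collect_eq mem_ball dist_0_norm) simp
  qed
  ultimately show "\<exists>U. x \<in> U \<and> U \<subseteq> S \<and> harmonic_on g U"
    using d ball_subset_cball by (intro exI[of _ "ball x d"]) auto
qed

lemma poisson_kernel_symmetric:
  fixes s t :: "'a::euclidean_space"
  assumes "s \<in> usphere" "t \<in> usphere"
  shows "poisson_kernel (r *\<^sub>R s) t = poisson_kernel (r *\<^sub>R t) s"
proof -
  have "s \<bullet> s = 1" "t \<bullet> t = 1" using assms by (simp_all add: dot_square_norm)
  then have "norm (r *\<^sub>R s - t) = norm (r *\<^sub>R t - s)"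
    by (simp add: norm_eq inner_diff_left inner_diff_right inner_commute)
  then show ?thesis using assms by (simp add: poisson_kernel_def)
qed

text \<open>Fubini together with \<open>K (r s) t = K (r t) s\<close>. Taking \<open>h\<close> to be a spherical harmonic, the effect of
  the Poisson integral on spherical coefficients can be read off.\<close>

lemma poisson_integral_symmetric:
  fixes g h :: "'a::euclidean_space \<Rightarrow> real"
  assumes g: "continuous_on usphere g" and h: "continuous_on usphere h" and r: "0 \<le> r" "r < 1"
  shows "(LINT t|sphere_measure. h t * poisson_integral g (r *\<^sub>R t)) =
         (LINT s|sphere_measure. g s * poisson_integral h (r *\<^sub>R s))"
proof -
  let ?S = "sphere_measure :: 'a measure"
  interpret finite_measure ?S by (rule finite_measure_sphere)
  interpret P: pair_sigma_finite ?S ?S ..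
  have fin: "finite_measure (?S \<Otimes>\<^sub>M ?S)" 
    by (rule finite_measure_pair_measure[OF finite_measure_sphere finite_measure_sphere])
  interpret PP: finite_measure "?S \<Otimes>\<^sub>M ?S" by (rule fin)
  define F where "F t s = h t * (g s * poisson_kernel (r *\<^sub>R t) s)" for t s
  have [measurable]: "g \<in> borel_measurable ?S" "h \<in> borel_measurable ?S" "(\<lambda>x. x) \<in> borel_measurable ?S"
    by (intro continuous_on_borel_measurable_sphere g h continuous_intros)+
  have Fm: "(\<lambda>(t,s). F t s) \<in> borel_measurable (?S \<Otimes>\<^sub>M ?S)"
    unfolding F_def poisson_kernel_def case_prod_beta by measurable
  have cont: "continuous_on (usphere \<times> usphere) (\<lambda>p. F (fst p) (snd p))"
  proof -
    have "continuous_on (usphere \<times> usphere) (\<lambda>p::'a\<times>'a. (\<lambda>(x, y). poisson_kernel x y) (r *\<^sub>R fst p, snd p))"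
      by (rule continuous_on_compose2[OF continuous_poisson_kernel])
        (use r in \<open>auto intro!: continuous_intros\<close>)
    moreover have "continuous_on (usphere \<times> usphere) (\<lambda>p::'a\<times>'a. g (snd p))"
      "continuous_on (usphere \<times> usphere) (\<lambda>p::'a\<times>'a. h (fst p))"
      by (rule continuous_on_compose2[OF g] continuous_on_compose2[OF h]; auto intro!: continuous_intros)+
    ultimately show ?thesis unfolding F_def by (auto intro!: continuous_intros)
  qed
  have "compact ((\<lambda>p. F (fst p) (snd p)) ` (usphere \<times> usphere))"
    by (intro compact_continuous_image cont compact_Times compact_sphere)
  then obtain B where B: "\<forall>v\<in>(\<lambda>p. F (fst p) (snd p)) ` (usphere \<times> usphere). norm v \<le> B"
    using compact_imp_bounded bounded_iff by metis
  then have B: "\<bar>F t s\<bar> \<le> B" if "t \<in> usphere" "s \<in> usphere" for t s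
    using that by force
  have int: "integrable (?S \<Otimes>\<^sub>M ?S) (\<lambda>(t,s). F t s)"
    by (rule PP.integrable_const_bound[where B = B])
      (auto intro!: AE_I2 B Fm simp: space_pair_measure)
  have "(LINT t|?S. h t * poisson_integral g (r *\<^sub>R t)) = (LINT t|?S. (LINT s|?S. F t s))"
    by (simp add: poisson_integral_def F_def)
  also have "\<dots> = (LINT s|?S. (LINT t|?S. F t s))"
    by (rule P.Fubini_integral[symmetric, OF int])
  also have "\<dots> = (LINT s|?S. g s * poisson_integral h (r *\<^sub>R s))"
  proof (rule sphere_integral_cong)
    fix s :: 'a assume s: "s \<in> usphere"
    have "(LINT t|?S. F t s) = (LINT t|?S. g s * (h t * poisson_kernel (r *\<^sub>R s) t))"
      by (rule sphere_integral_cong) (simp add: F_def poisson_kernel_symmetric[OF s])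
    then show "(LINT t|?S. F t s) = g s * poisson_integral h (r *\<^sub>R s)"
      by (simp add: poisson_integral_def)
  qed
  finally show ?thesis .
qed

section \<open>Expansions in spherical harmonics\<close>

text \<open>The variance of \<open>\<bar>f\<bar>\<close> is nonnegative.\<close>

lemma sphere_integral_L1_L2:
  fixes f :: "'a::euclidean_space \<Rightarrow> real"
  assumes f: "continuous_on usphere f"
  shows "(LINT x|sphere_measure. \<bar>f x\<bar>)\<^sup>2 \<le> sphere_area TYPE('a) * (LINT x|sphere_measure. (f x)\<^sup>2)"
proof -
  let ?a = "sphere_area TYPE('a)"
  have a: "?a > 0" by (rule sphere_area_pos)
  \<comment> \<open>The mean of \<open>\<bar>f\<bar>\<close>.\<close>
  define m where "m = (LINT x|sphere_measure. \<bar>f x\<bar>) / ?a"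
  have i1: "integrable sphere_measure (\<lambda>x. (f x)\<^sup>2)" "integrable sphere_measure (\<lambda>x. 2 * m * \<bar>f x\<bar>)"
     "integrable (sphere_measure :: 'a measure) (\<lambda>x. m\<^sup>2)"
    by (intro continuous_on_integrable_sphere continuous_intros f)+
  have "0 \<le> (LINT x|sphere_measure. (\<bar>f x\<bar> - m)\<^sup>2)" by (rule Bochner_Integration.integral_nonneg) simp
  also have "\<dots> = (LINT x|sphere_measure. (f x)\<^sup>2 - 2 * m * \<bar>f x\<bar> + m\<^sup>2)"
    by (rule sphere_integral_cong) (simp add: power2_diff)
  also have "\<dots> = (LINT x|sphere_measure. (f x)\<^sup>2) - 2 * m * (LINT x|sphere_measure. \<bar>f x\<bar>) + m\<^sup>2 * ?a"
    using i1 by (simp add: sphere_integral_const measure_usphere mult.commute)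
  also have "\<dots> = (LINT x|sphere_measure. (f x)\<^sup>2) - (LINT x|sphere_measure. \<bar>f x\<bar>)\<^sup>2 / ?a"
    using a by (simp add: m_def field_simps power2_eq_square)
  finally show ?thesis using a by (simp add: field_simps)
qed

text \<open>Spherical harmonics are represented by their homogeneous harmonic extensions \<open>P i\<close>, because all
  arguments move between spheres of different radii.\<close>

locale harmonic_basis =
  fixes I :: "'i set" and deg :: "'i \<Rightarrow> nat" and P :: "'i \<Rightarrow> 'a::euclidean_space \<Rightarrow> real"
  assumes harm: "i \<in> I \<Longrightarrow> harmonic_on (P i) UNIV"
    and homog: "i \<in> I \<Longrightarrow> P i (t *\<^sub>R x) = t ^ deg i * P i x"
    and orth: "i \<in> I \<Longrightarrow> j \<in> I \<Longrightarrow> (LINT x|sphere_measure. P i x * P j x) = (if i = j then 1 else 0)"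
    and complete: "continuous_on usphere g \<Longrightarrow> e > 0 \<Longrightarrow>
       \<exists>F c. finite F \<and> F \<subseteq> I \<and> (LINT x|sphere_measure. (g x - (\<Sum>i\<in>F. c i * P i x))\<^sup>2) < e"
begin

definition coeff :: "('a \<Rightarrow> real) \<Rightarrow> 'i \<Rightarrow> real" where
  "coeff g i = (LINT x|sphere_measure. g x * P i x)"

lemma continuous_P: "i \<in> I \<Longrightarrow> continuous_on S (P i)"
  using harmonic_on_continuous[OF harm] continuous_on_subset by blast

lemma continuous_combination: "F \<subseteq> I \<Longrightarrow> continuous_on S (\<lambda>x. \<Sum>i\<in>F. c i * P i x)"
  by (intro continuous_intros continuous_P) auto

lemma harmonic_combination: "F \<subseteq> I \<Longrightarrow> harmonic_on (\<lambda>x. \<Sum>i\<in>F. c i * P i x) UNIV"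
  by (intro harmonic_on_sum harmonic_on_cmult harm) auto

lemma coeff_cmult: "coeff (\<lambda>x. a * g x) i = a * coeff g i"
  by (simp add: coeff_def mult.assoc)

lemma coeff_add:
  assumes "continuous_on usphere f" "continuous_on usphere g" "i \<in> I"
  shows "coeff (\<lambda>x. f x + g x) i = coeff f i + coeff g i"
  unfolding coeff_def distrib_right
  by (intro Bochner_Integration.integral_add continuous_on_integrable_sphere continuous_intros assms continuous_P)

lemma coeff_diff:
  assumes "continuous_on usphere f" "continuous_on usphere g" "i \<in> I"
  shows "coeff (\<lambda>x. f x - g x) i = coeff f i - coeff g i"
  unfolding coeff_def left_diff_distrib
  by (intro Bochner_Integration.integral_diff continuous_on_integrable_sphere continuous_intros assms continuous_P)

lemma coeff_cong: "(\<And>x. x \<in> usphere \<Longrightarrow> f x = g x) \<Longrightarrow> coeff f i = coeff g i"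
  unfolding coeff_def by (rule sphere_integral_cong) simp

lemma integral_combination:
  assumes F: "F \<subseteq> I" and g: "continuous_on usphere g"
  shows "(LINT x|sphere_measure. g x * (\<Sum>i\<in>F. c i * P i x)) = (\<Sum>i\<in>F. c i * coeff g i)"
proof -
  have "(LINT x|sphere_measure. g x * (\<Sum>i\<in>F. c i * P i x)) = (LINT x|sphere_measure. (\<Sum>i\<in>F. c i * (g x * P i x)))"
    by (rule sphere_integral_cong) (simp add: sum_distrib_left mult_ac)
  also have "\<dots> = (\<Sum>i\<in>F. (LINT x|sphere_measure. c i * (g x * P i x)))"
    using F by (intro Bochner_Integration.integral_sum continuous_on_integrable_sphere continuous_intros g continuous_P) auto
  finally show ?thesis by (simp add: coeff_def)
qed

lemma coeff_combination:
  assumes F: "finite F" "F \<subseteq> I" and i: "i \<in> I"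
  shows "coeff (\<lambda>x. \<Sum>j\<in>F. c j * P j x) i = (if i \<in> F then c i else 0)"
proof -
  have "coeff (\<lambda>x. \<Sum>j\<in>F. c j * P j x) i = (LINT x|sphere_measure. P i x * (\<Sum>j\<in>F. c j * P j x))"
    by (simp add: coeff_def mult.commute)
  also have "\<dots> = (\<Sum>j\<in>F. c j * coeff (P i) j)"
    by (rule integral_combination[OF F(2) continuous_P[OF i]])
  also have "\<dots> = (\<Sum>j\<in>F. if i = j then c j else 0)"
    using F i by (intro sum.cong) (auto simp: coeff_def orth)
  finally show ?thesis using F by simp
qed

lemma integral_combination_squared:
  assumes F: "finite F" "F \<subseteq> I"
  shows "(LINT x|sphere_measure. (\<Sum>i\<in>F. c i * P i x)\<^sup>2) = (\<Sum>i\<in>F. (c i)\<^sup>2)"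
  using integral_combination[OF F(2) continuous_combination[OF F(2)], of c c] F
  by (simp add: power2_eq_square coeff_combination subset_iff cong: sum.cong)

lemma integral_residual_squared:
  assumes F: "finite F" "F \<subseteq> I" and g: "continuous_on usphere g"
  shows "(LINT x|sphere_measure. (g x - (\<Sum>i\<in>F. c i * P i x))\<^sup>2) =
     (LINT x|sphere_measure. (g x)\<^sup>2) - 2 * (\<Sum>i\<in>F. c i * coeff g i) + (\<Sum>i\<in>F. (c i)\<^sup>2)"
proof -
  let ?s = "\<lambda>x. \<Sum>i\<in>F. c i * P i x"
  have s: "continuous_on usphere ?s" by (rule continuous_combination[OF F(2)])
  have "(LINT x|sphere_measure. (g x - ?s x)\<^sup>2) =
     (LINT x|sphere_measure. (g x)\<^sup>2 - 2 * (g x * ?s x) + (?s x)\<^sup>2)"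
    by (rule sphere_integral_cong) (simp add: power2_diff)
  also have "\<dots> = (LINT x|sphere_measure. (g x)\<^sup>2) - (LINT x|sphere_measure. 2 * (g x * ?s x))
      + (LINT x|sphere_measure. (?s x)\<^sup>2)"
  proof -
    have "integrable sphere_measure (\<lambda>x. (g x)\<^sup>2)" "integrable sphere_measure (\<lambda>x. 2 * (g x * ?s x))"
       "integrable sphere_measure (\<lambda>x. (?s x)\<^sup>2)"
      by (intro continuous_on_integrable_sphere continuous_intros g s)+
    then show ?thesis by (simp del: integral_mult_right_zero integral_mult_right)
  qed
  finally show ?thesis using integral_combination_squared[OF F] integral_combination[OF F(2) g] by simp
qed

lemma bessel:
  assumes F: "finite F" "F \<subseteq> I" and g: "continuous_on usphere g"
  shows "(\<Sum>i\<in>F. (coeff g i)\<^sup>2) \<le> (LINT x|sphere_measure. (g x)\<^sup>2)"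
proof -
  have "0 \<le> (LINT x|sphere_measure. (g x - (\<Sum>i\<in>F. coeff g i * P i x))\<^sup>2)"
    by (rule Bochner_Integration.integral_nonneg) simp
  then show ?thesis unfolding integral_residual_squared[OF F g] by (simp add: power2_eq_square)
qed

lemma bessel_summable:
  assumes g: "continuous_on usphere g"
  shows "(\<lambda>i. (coeff g i)\<^sup>2) summable_on I"
  by (rule nonneg_bdd_above_summable_on)
    (auto intro!: bdd_aboveI[of _ "LINT x|sphere_measure. (g x)\<^sup>2"] bessel g)

text \<open>A function orthogonal to all \<open>P i\<close> is approximated by combinations no better than by zero, so
  completeness forces its \<open>L\<^sub>2\<close> norm to be zero.\<close>

lemma coeff_zero_imp_zero:
  assumes g: "continuous_on usphere g" and z: "\<And>i. i \<in> I \<Longrightarrow> coeff g i = 0" and x: "x \<in> usphere"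
  shows "g x = 0"
proof -
  let ?J = "LINT x|sphere_measure. (g x)\<^sup>2"
  have "?J \<le> 0 + e" if e: "e > 0" for e
  proof -
    obtain F c where F: "finite F" "F \<subseteq> I" "(LINT x|sphere_measure. (g x - (\<Sum>i\<in>F. c i * P i x))\<^sup>2) < e"
      using complete[OF g e] by blast
    have "(\<Sum>i\<in>F. c i * coeff g i) = 0" using z F by (intro sum.neutral) auto
    then show ?thesis
      using integral_residual_squared[OF F(1,2) g, of c] F(3) sum_nonneg[of F "\<lambda>i. (c i)\<^sup>2"] by simp
  qed
  then have "?J \<le> 0" by (rule field_le_epsilon)
  moreover have "?J \<ge> 0" by (rule Bochner_Integration.integral_nonneg) simp
  ultimately have "?J = 0" by linarith
  then have "(g x)\<^sup>2 = 0"
    by (intro sphere_integral_eq_0_imp[where f = "\<lambda>x. (g x)\<^sup>2", OF _ _ _ x] continuous_intros g) auto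
  then show ?thesis by simp
qed

lemma combination_scale:
  assumes "F \<subseteq> I"
  shows "(\<Sum>i\<in>F. c i * P i (r *\<^sub>R x)) = (\<Sum>i\<in>F. (c i * r ^ deg i) * P i x)"
  using assms by (intro sum.cong refl) (auto simp: homog)

text \<open>The Poisson formula bounds the values in a smaller ball by the \<open>L\<^sub>1\<close> norm on the sphere, hence by the
  \<open>L\<^sub>2\<close> norm, which orthonormality expresses through the coefficients. Homogeneity rescales this to any radius.
  The point is that \<open>C\<close> depends on \<open>s\<close> only and not on the combination.\<close>

lemma combination_bound:
  assumes s: "0 \<le> s" "s < 1"
  obtains C where "C \<ge> 0"
    "\<And>F c r x. finite F \<Longrightarrow> F \<subseteq> I \<Longrightarrow> r > 0 \<Longrightarrow> norm x \<le> s * r \<Longrightarrow>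
        \<bar>\<Sum>i\<in>F. c i * P i x\<bar> \<le> C * sqrt (\<Sum>i\<in>F. (c i)\<^sup>2 * r ^ (2 * deg i))"
proof -
  have "compact ((\<lambda>(x,y::'a). poisson_kernel x y) ` (cball 0 s \<times> usphere))"
    by (intro compact_continuous_image compact_Times compact_sphere compact_cball
        continuous_on_subset[OF continuous_poisson_kernel]) (use s in auto)
  then obtain B where B: "\<forall>v\<in>(\<lambda>(x,y::'a). poisson_kernel x y) ` (cball 0 s \<times> usphere). norm v \<le> B"
    using compact_imp_bounded bounded_iff by metis
  then have B: "\<bar>poisson_kernel x y\<bar> \<le> \<bar>B\<bar>" if "norm x \<le> s" "y \<in> usphere" for x y :: 'a
    using that by force
  let ?C = "\<bar>B\<bar> * sqrt (sphere_area TYPE('a))"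
  have bound1: "\<bar>\<Sum>i\<in>F. c i * P i x\<bar> \<le> ?C * sqrt (\<Sum>i\<in>F. (c i)\<^sup>2)"
    if F: "finite F" "F \<subseteq> I" and x: "norm x \<le> s" for F c x
  proof -
    let ?H = "\<lambda>x. \<Sum>i\<in>F. c i * P i x"
    have cont: "continuous_on S ?H" for S by (rule continuous_combination[OF F(2)])
    have xb: "x \<in> ball 0 1" using x s by simp
    have "\<bar>?H x\<bar> = \<bar>poisson_integral ?H x\<bar>"
      by (subst poisson_formula[OF cont harmonic_on_subset[OF harmonic_combination[OF F(2)]] xb])
        (rule open_ball subset_UNIV refl)+
    also have "\<dots> \<le> (LINT y|sphere_measure. \<bar>?H y * poisson_kernel x y\<bar>)"
      unfolding poisson_integral_def by (rule integral_abs_bound)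
    also have "\<dots> \<le> (LINT y|sphere_measure. \<bar>B\<bar> * \<bar>?H y\<bar>)"
    proof (intro sphere_integral_mono continuous_on_rabs continuous_on_mult continuous_on_const cont
          continuous_poisson_kernel_snd[OF xb])
      fix y :: 'a assume "y \<in> usphere"
      then show "\<bar>?H y * poisson_kernel x y\<bar> \<le> \<bar>B\<bar> * \<bar>?H y\<bar>"
        unfolding abs_mult mult.commute[of "\<bar>B\<bar>"] by (intro mult_left_mono B[OF x] abs_ge_zero)
    qed
    also have "\<dots> = \<bar>B\<bar> * (LINT y|sphere_measure. \<bar>?H y\<bar>)" by simp
    also have "(LINT y|sphere_measure. \<bar>?H y\<bar>) \<le> sqrt (sphere_area TYPE('a) * (\<Sum>i\<in>F. (c i)\<^sup>2))"
      using sphere_integral_L1_L2[OF cont] unfolding integral_combination_squared[OF F]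
      by (rule real_le_rsqrt)
    finally show ?thesis by (simp add: real_sqrt_mult mult.assoc mult_left_mono)
  qed
  show thesis
  proof (rule that[of ?C])
    fix F c r and x :: 'a assume F: "finite F" "F \<subseteq> I" and r: "r > (0::real)" and x: "norm x \<le> s * r"
    have "(\<Sum>i\<in>F. c i * P i x) = (\<Sum>i\<in>F. c i * P i (r *\<^sub>R (x /\<^sub>R r)))" using r by simp
    also have "\<dots> = (\<Sum>i\<in>F. (c i * r ^ deg i) * P i (x /\<^sub>R r))" by (rule combination_scale[OF F(2)])
    also have "\<bar>\<dots>\<bar> \<le> ?C * sqrt (\<Sum>i\<in>F. (c i * r ^ deg i)\<^sup>2)"
      using r x by (intro bound1 F) (simp add: field_simps)
    finally show "\<bar>\<Sum>i\<in>F. c i * P i x\<bar> \<le> ?C * sqrt (\<Sum>i\<in>F. (c i)\<^sup>2 * r ^ (2 * deg i))"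
      by (simp add: power_mult_distrib power_mult mult.commute)
  qed (use sphere_area_pos[where 'a='a] in simp)
qed

definition series :: "('i \<Rightarrow> real) \<Rightarrow> 'a \<Rightarrow> real" where
  "series c x = (\<Sum>\<^sub>\<infinity>i\<in>I. c i * P i x)"

text \<open>The \<open>L\<^sub>2\<close> norm of the series on the sphere of radius \<open>r\<close> is finite; by \<open>combination_bound\<close> this is
  enough for convergence inside the ball of radius \<open>r\<close>.\<close>

definition admissible :: "('i \<Rightarrow> real) \<Rightarrow> real \<Rightarrow> bool" where
  "admissible c r \<longleftrightarrow> (\<lambda>i. (c i)\<^sup>2 * r ^ (2 * deg i)) summable_on I"

lemma admissible_sum_le:
  assumes "admissible c r" "finite F" "F \<subseteq> I"
  shows "(\<Sum>i\<in>F. (c i)\<^sup>2 * r ^ (2 * deg i)) \<le> (\<Sum>\<^sub>\<infinity>i\<in>I. (c i)\<^sup>2 * r ^ (2 * deg i))"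
  using assms unfolding admissible_def by (intro finite_sum_le_infsum) (auto simp: power_mult)

text \<open>Absolute convergence: replacing \<open>c i\<close> by \<open>- c i\<close> where necessary turns the sum of absolute values
  into a combination with the same bound.\<close>

lemma admissible_has_sum:
  assumes adm: "admissible c r" and x: "norm x < r"
  shows "((\<lambda>i. c i * P i x) has_sum series c x) I"
proof -
  have r: "r > 0" using x by (meson norm_ge_zero le_less_trans)
  define s where "s = norm x / r"
  have s: "0 \<le> s" "s < 1" "norm x \<le> s * r" using r x by (auto simp: s_def)
  obtain C where C: "C \<ge> 0" 
    "\<And>F c r x. finite F \<Longrightarrow> F \<subseteq> I \<Longrightarrow> r > 0 \<Longrightarrow> norm x \<le> s * r \<Longrightarrow>
        \<bar>\<Sum>i\<in>F. c i * P i x\<bar> \<le> C * sqrt (\<Sum>i\<in>F. (c i)\<^sup>2 * r ^ (2 * deg i))"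
    by (rule combination_bound[OF s(1,2)]) blast
  have "(\<lambda>i. norm (c i * P i x)) summable_on I"
  proof (rule nonneg_bdd_above_summable_on)
    show "bdd_above (sum (\<lambda>i. norm (c i * P i x)) ` {F. F \<subseteq> I \<and> finite F})"
    proof (rule bdd_aboveI, safe)
      fix F assume F: "F \<subseteq> I" "finite F"
      \<comment> \<open>Signs chosen so that every term is nonnegative at \<open>x\<close>.\<close>
      define c' where "c' i = (if c i * P i x \<ge> 0 then c i else - c i)" for i
      have "(\<Sum>i\<in>F. norm (c i * P i x)) = (\<Sum>i\<in>F. c' i * P i x)"
        by (intro sum.cong) (auto simp: c'_def)
      also have "\<dots> \<le> C * sqrt (\<Sum>i\<in>F. (c' i)\<^sup>2 * r ^ (2 * deg i))"
        by (rule order_trans[OF abs_ge_self C(2)[OF F(2,1) r s(3)]])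
      also have "(\<Sum>i\<in>F. (c' i)\<^sup>2 * r ^ (2 * deg i)) = (\<Sum>i\<in>F. (c i)\<^sup>2 * r ^ (2 * deg i))"
        by (intro sum.cong) (simp_all add: c'_def)
      also have "C * sqrt \<dots> \<le> C * sqrt (\<Sum>\<^sub>\<infinity>i\<in>I. (c i)\<^sup>2 * r ^ (2 * deg i))"
        by (rule mult_left_mono[OF real_sqrt_le_mono[OF admissible_sum_le[OF adm F(2,1)]] C(1)])
      finally show "(\<Sum>i\<in>F. norm (c i * P i x)) \<le> C * sqrt (\<Sum>\<^sub>\<infinity>i\<in>I. (c i)\<^sup>2 * r ^ (2 * deg i))" .
    qed
  qed simp
  then show ?thesis unfolding series_def by (rule has_sum_infsum[OF abs_summable_summable])
qed

lemma series_uniform_approx: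
  assumes adm: "admissible c r" and s: "0 \<le> s" "s < 1" and r: "r > 0" and e: "e > 0"
  obtains F where "finite F" "F \<subseteq> I"
    "\<And>G x. finite G \<Longrightarrow> F \<subseteq> G \<Longrightarrow> G \<subseteq> I \<Longrightarrow> norm x \<le> s * r \<Longrightarrow> \<bar>(\<Sum>i\<in>G. c i * P i x) - series c x\<bar> \<le> e"
proof -
  obtain C where C: "C \<ge> 0" 
    "\<And>F c r x. finite F \<Longrightarrow> F \<subseteq> I \<Longrightarrow> r > 0 \<Longrightarrow> norm x \<le> s * r \<Longrightarrow>
        \<bar>\<Sum>i\<in>F. c i * P i x\<bar> \<le> C * sqrt (\<Sum>i\<in>F. (c i)\<^sup>2 * r ^ (2 * deg i))"
    by (rule combination_bound[OF s(1,2)]) blast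
  let ?q = "\<lambda>i. (c i)\<^sup>2 * r ^ (2 * deg i)"
  \<comment> \<open>A tail with square sum below \<open>d\<close> contributes at most \<open>C * sqrt d \<le> e\<close>.\<close>
  define d where "d = (e / (C + 1))\<^sup>2"
  have d: "d > 0" using C(1) e by (simp add: d_def)
  have Cd: "C * sqrt d \<le> e"
  proof -
    have "C * sqrt d = C * (e / (C + 1))" using C(1) e by (simp add: d_def)
    also have "\<dots> \<le> (C + 1) * (e / (C + 1))" using C(1) e by (intro mult_right_mono) auto
    finally show ?thesis using C(1) by simp
  qed
  have "(sum ?q \<longlongrightarrow> infsum ?q I) (finite_subsets_at_top I)"
    using adm unfolding admissible_def by (rule infsum_tendsto)
  then have "\<forall>\<^sub>F F in finite_subsets_at_top I. sum ?q F > infsum ?q I - d"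
    using d by (intro order_tendstoD(1)) auto
  then obtain F where F: "finite F" "F \<subseteq> I" "infsum ?q I - d < sum ?q F"
    unfolding eventually_finite_subsets_at_top by blast
  show thesis
  proof (rule that[OF F(1,2)])
    fix G and x :: 'a assume G: "finite G" "F \<subseteq> G" "G \<subseteq> I" and x: "norm x \<le> s * r"
    have "s * r < r" using s r by simp
    then have xr: "norm x < r" using x by linarith
    have lim: "((\<lambda>H. sum (\<lambda>i. c i * P i x) H) \<longlongrightarrow> series c x) (finite_subsets_at_top I)"
      using admissible_has_sum[OF adm xr] unfolding has_sum_def .
    have "((\<lambda>H. \<bar>(\<Sum>i\<in>G. c i * P i x) - sum (\<lambda>i. c i * P i x) H\<bar>) \<longlongrightarrow>
        \<bar>(\<Sum>i\<in>G. c i * P i x) - series c x\<bar>) (finite_subsets_at_top I)"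
      by (intro tendsto_intros lim)
    then show "\<bar>(\<Sum>i\<in>G. c i * P i x) - series c x\<bar> \<le> e"
    proof (rule tendsto_upperbound)
      have "\<bar>(\<Sum>i\<in>G. c i * P i x) - (\<Sum>i\<in>H. c i * P i x)\<bar> \<le> e"
        if H: "finite H" "G \<subseteq> H" "H \<subseteq> I" for H
      proof -
        have "(\<Sum>i\<in>H. c i * P i x) - (\<Sum>i\<in>G. c i * P i x) = (\<Sum>i\<in>H - G. c i * P i x)"
          using H by (simp add: sum_diff)
        moreover have "\<bar>\<Sum>i\<in>H - G. c i * P i x\<bar> \<le> C * sqrt (sum ?q (H - G))"
          using H by (intro C(2) r x) auto
        moreover have "sum ?q (H - G) \<le> d"
        proof -
          have "sum ?q (H - G) = sum ?q H - sum ?q G" using H by (simp add: sum_diff)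
          moreover have "sum ?q F \<le> sum ?q G" by (rule sum_mono2) (use G in \<open>auto simp: power_mult\<close>)
          ultimately show ?thesis using admissible_sum_le[OF adm H(1,3)] F(3) by linarith
        qed
        then have "C * sqrt (sum ?q (H - G)) \<le> C * sqrt d"
          by (intro mult_left_mono[OF real_sqrt_le_mono C(1)])
        ultimately show ?thesis using Cd by linarith
      qed
      then show "\<forall>\<^sub>F H in finite_subsets_at_top I. \<bar>(\<Sum>i\<in>G. c i * P i x) - (\<Sum>i\<in>H. c i * P i x)\<bar> \<le> e"
        unfolding eventually_finite_subsets_at_top using G by blast
    qed simp
  qed
qed

lemma harmonic_series:
  assumes adm: "admissible c r"
  shows "harmonic_on (series c) (ball 0 r)"
proof (rule harmonic_on_uniform_limit)
  fix x :: 'a assume x: "x \<in> ball 0 r"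
  then have r: "r > 0" by (auto intro: le_less_trans[OF norm_ge_zero])
  define d where "d = (r - norm x) / 2"
  define s where "s = (norm x + d) / r"
  have d: "d > 0" using x by (simp add: d_def)
  have s: "0 \<le> s" "s < 1" "s * r = norm x + d" using x d r by (auto simp: s_def d_def field_simps)
  have sub: "norm y \<le> s * r" if "y \<in> cball x d" for y
    using that norm_triangle_ineq[of x "y - x"] by (simp add: s(3) dist_norm norm_minus_commute)
  have sr: "s * r < r" using s(2) r by simp
  show "\<exists>d>0. cball x d \<subseteq> ball 0 r \<and>
     (\<forall>e>0. \<exists>f. harmonic_on f (ball 0 r) \<and> (\<forall>y\<in>cball x d. \<bar>f y - series c y\<bar> \<le> e))"
  proof (rule exI[of _ d], intro conjI allI impI d)
    show "cball x d \<subseteq> ball 0 r" using sub sr by fastforce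
    fix e :: real assume e: "e > 0"
    obtain F where F: "finite F" "F \<subseteq> I"
      "\<And>G x. finite G \<Longrightarrow> F \<subseteq> G \<Longrightarrow> G \<subseteq> I \<Longrightarrow> norm x \<le> s * r \<Longrightarrow> \<bar>(\<Sum>i\<in>G. c i * P i x) - series c x\<bar> \<le> e"
      by (rule series_uniform_approx[OF adm s(1,2) r e]) blast
    show "\<exists>f. harmonic_on f (ball 0 r) \<and> (\<forall>y\<in>cball x d. \<bar>f y - series c y\<bar> \<le> e)"
      using F(3)[OF F(1) _ F(2)] sub
      by (intro exI[of _ "\<lambda>x. \<Sum>i\<in>F. c i * P i x"]) (auto intro: harmonic_on_subset[OF harmonic_combination[OF F(2)]])
  qed
qed

lemma coeff_abs_bound:
  assumes g: "continuous_on usphere g" and i: "i \<in> I" and bd: "\<And>x. x \<in> usphere \<Longrightarrow> \<bar>g x\<bar> \<le> e"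
  shows "\<bar>coeff g i\<bar> \<le> e * (LINT x|sphere_measure. \<bar>P i x\<bar>)"
proof -
  have "\<bar>coeff g i\<bar> \<le> (LINT x|sphere_measure. \<bar>g x * P i x\<bar>)"
    unfolding coeff_def by (rule integral_abs_bound)
  also have "\<dots> \<le> (LINT x|sphere_measure. e * \<bar>P i x\<bar>)"
    using bd by (intro sphere_integral_mono continuous_intros g continuous_P i)
      (auto simp: abs_mult intro!: mult_right_mono)
  finally show ?thesis by simp
qed

lemma coeff_series:
  assumes adm: "admissible c r" and t: "0 \<le> t" "t < r" and i: "i \<in> I"
  shows "coeff (\<lambda>x. series c (t *\<^sub>R x)) i = c i * t ^ deg i"
proof -
  have r: "r > 0" using t by simp
  define s where "s = t / r"
  have s: "0 \<le> s" "s < 1" "s * r = t" using t by (auto simp: s_def)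
  have cont: "continuous_on usphere (\<lambda>x. series c (t *\<^sub>R x))"
    by (rule continuous_on_compose2[OF harmonic_on_continuous[OF harmonic_series[OF adm]]])
      (use t in \<open>auto intro!: continuous_intros\<close>)
  let ?A = "LINT x|sphere_measure. \<bar>P i x\<bar>"
  have A: "?A \<ge> 0" by (rule Bochner_Integration.integral_nonneg) simp
  have "\<bar>coeff (\<lambda>x. series c (t *\<^sub>R x)) i - c i * t ^ deg i\<bar> \<le> 0 + e" if e: "e > 0" for e
  proof -
    have e': "e / (?A + 1) > 0" using e A by (intro divide_pos_pos add_nonneg_pos) auto
    obtain F where F: "finite F" "F \<subseteq> I"
      "\<And>G x. finite G \<Longrightarrow> F \<subseteq> G \<Longrightarrow> G \<subseteq> I \<Longrightarrow> norm x \<le> s * r \<Longrightarrow>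
          \<bar>(\<Sum>i\<in>G. c i * P i x) - series c x\<bar> \<le> e / (?A + 1)"
      by (rule series_uniform_approx[OF adm s(1,2) r e']) blast
    define G where "G = insert i F"
    have G: "finite G" "F \<subseteq> G" "G \<subseteq> I" "i \<in> G" using F i by (auto simp: G_def)
    let ?g = "\<lambda>x. \<Sum>j\<in>G. (c j * t ^ deg j) * P j x"
    have g: "continuous_on usphere ?g" by (rule continuous_combination[OF G(3)])
    have "\<bar>series c (t *\<^sub>R x) - ?g x\<bar> \<le> e / (?A + 1)" if "x \<in> usphere" for x
      using F(3)[OF G(1-3), of "t *\<^sub>R x"] that s t by (simp add: combination_scale[OF G(3)] abs_minus_commute)
    then have "\<bar>coeff (\<lambda>x. series c (t *\<^sub>R x) - ?g x) i\<bar> \<le> e / (?A + 1) * ?A"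
      by (intro coeff_abs_bound continuous_intros cont g i)
    also have "\<dots> \<le> e / (?A + 1) * (?A + 1)" using e' A by (intro mult_left_mono) auto
    also have "\<dots> = e"
    proof -
      have "?A + 1 \<noteq> 0" using A by linarith
      then show ?thesis by simp
    qed
    finally show ?thesis using G by (simp add: coeff_diff[OF cont g i] coeff_combination[OF G(1,3) i])
  qed
  then have "\<bar>coeff (\<lambda>x. series c (t *\<^sub>R x)) i - c i * t ^ deg i\<bar> \<le> 0" by (rule field_le_epsilon)
  then show ?thesis by simp
qed

text \<open>Symmetry of the kernel moves the Poisson integral onto \<open>P i\<close>, which it reproduces at \<open>r *\<^sub>R s\<close>.\<close>

lemma coeff_poisson_integral:
  assumes g: "continuous_on usphere g" and r: "0 \<le> r" "r < 1" and i: "i \<in> I"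
  shows "coeff (\<lambda>x. poisson_integral g (r *\<^sub>R x)) i = r ^ deg i * coeff g i"
proof -
  have "coeff (\<lambda>x. poisson_integral g (r *\<^sub>R x)) i =
      (LINT s|sphere_measure. g s * poisson_integral (P i) (r *\<^sub>R s))"
    using poisson_integral_symmetric[OF g continuous_P[OF i] r] by (simp add: coeff_def mult.commute)
  also have "\<dots> = (LINT s|sphere_measure. r ^ deg i * (g s * P i s))"
  proof (rule sphere_integral_cong)
    fix s :: 'a assume s: "s \<in> usphere"
    have "poisson_integral (P i) (r *\<^sub>R s) = P i (r *\<^sub>R s)"
      using s r by (intro poisson_formula continuous_P i harmonic_on_subset[OF harm]) auto
    then show "g s * poisson_integral (P i) (r *\<^sub>R s) = r ^ deg i * (g s * P i s)"
      using i by (simp add: homog)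
  qed
  finally show ?thesis by (simp add: coeff_def)
qed

text \<open>The Poisson integral at a radius \<open>r < 1\<close> close to one is uniformly close to \<open>g\<close>. It has the coefficients
  \<open>r ^ deg i * coeff g i\<close>, so it equals a series which converges uniformly on the sphere of radius \<open>r\<close>.\<close>

lemma uniformly_dense:
  assumes g: "continuous_on usphere g" and e: "e > 0"
  obtains F c where "finite F" "F \<subseteq> I" "\<And>x. x \<in> usphere \<Longrightarrow> \<bar>g x - (\<Sum>i\<in>F. c i * P i x)\<bar> \<le> e"
proof -
  obtain r0 where r0: "0 \<le> r0" "r0 < 1"
    "\<And>r t. r0 \<le> r \<Longrightarrow> r < 1 \<Longrightarrow> t \<in> usphere \<Longrightarrow> \<bar>poisson_integral g (r *\<^sub>R t) - g t\<bar> \<le> e / 2"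
    using poisson_integral_boundary[OF g, of "e / 2"] e by auto
  have adm: "admissible (coeff g) 1" unfolding admissible_def using bessel_summable[OF g] by simp
  have c1: "continuous_on usphere (\<lambda>x. poisson_integral g (r0 *\<^sub>R x))"
    by (rule continuous_on_compose2[OF harmonic_on_continuous[OF harmonic_poisson_integral[OF g]]])
      (use r0 in \<open>auto intro!: continuous_intros\<close>)
  have c2: "continuous_on usphere (\<lambda>x. series (coeff g) (r0 *\<^sub>R x))"
    by (rule continuous_on_compose2[OF harmonic_on_continuous[OF harmonic_series[OF adm]]])
      (use r0 in \<open>auto intro!: continuous_intros\<close>)
  have eq: "poisson_integral g (r0 *\<^sub>R x) - series (coeff g) (r0 *\<^sub>R x) = 0" if x: "x \<in> usphere" for x
    by (rule coeff_zero_imp_zero[OF continuous_on_diff[OF c1 c2] _ x])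
      (simp add: coeff_diff[OF c1 c2] coeff_poisson_integral[OF g r0(1,2)] coeff_series[OF adm r0(1,2)])
  obtain F where F: "finite F" "F \<subseteq> I"
    "\<And>G x. finite G \<Longrightarrow> F \<subseteq> G \<Longrightarrow> G \<subseteq> I \<Longrightarrow> norm x \<le> r0 * 1 \<Longrightarrow>
       \<bar>(\<Sum>i\<in>G. coeff g i * P i x) - series (coeff g) x\<bar> \<le> e / 2"
    by (rule series_uniform_approx[OF adm r0(1,2) zero_less_one half_gt_zero[OF e]]) blast
  show thesis
  proof (rule that[OF F(1,2)])
    fix x :: 'a assume x: "x \<in> usphere"
    have "\<bar>(\<Sum>i\<in>F. coeff g i * P i (r0 *\<^sub>R x)) - series (coeff g) (r0 *\<^sub>R x)\<bar> \<le> e / 2"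
      using F(3)[OF F(1) _ F(2)] x r0 by simp
    then show "\<bar>g x - (\<Sum>i\<in>F. (coeff g i * r0 ^ deg i) * P i x)\<bar> \<le> e"
      using r0(3)[OF _ r0(2) x] eq[OF x] unfolding combination_scale[OF F(2)] by linarith
  qed
qed

end

section \<open>Singular solutions and spherical coefficients in an annulus\<close>

lemma homogeneous_euler:
  fixes P :: "'a::euclidean_space \<Rightarrow> real"
  assumes hom: "\<And>t. P (t *\<^sub>R x) = t ^ k * P x"
    and der: "(P has_derivative (\<lambda>h. h \<bullet> D)) (at x)"
  shows "x \<bullet> D = real k * P x"
proof -
  have line: "((\<lambda>t. t *\<^sub>R x) has_derivative (\<lambda>h. h *\<^sub>R x)) (at (1::real))"
    by (auto intro!: derivative_eq_intros)
  have "(P has_derivative (\<lambda>h. h \<bullet> D)) (at (1 *\<^sub>R x))" using der by simp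
  from diff_chain_at[OF line this]
  have "((\<lambda>t. P (t *\<^sub>R x)) has_derivative (\<lambda>h. (x \<bullet> D) * h)) (at 1)"
    by (simp add: o_def mult.commute)
  then have "((\<lambda>t. t ^ k * P x) has_real_derivative (x \<bullet> D)) (at 1)"
    unfolding has_field_derivative_def hom .
  moreover have "((\<lambda>t. t ^ k * P x) has_real_derivative (real k * P x)) (at 1)"
    by (auto intro!: derivative_eq_intros)
  ultimately show ?thesis by (rule DERIV_unique)
qed

text \<open>For homogeneous harmonic \<open>P\<close> of degree \<open>k\<close>, Euler's identity turns the Laplacian of
  \<open>P x * g (\<bar>x\<bar>\<^sup>2)\<close> into \<open>2 P x\<close> times the left-hand side of the ordinary differential equation for \<open>g\<close>.\<close>

lemma harmonic_on_mult_radial: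
  fixes P :: "'a::euclidean_space \<Rightarrow> real" and g g' g'' :: "real \<Rightarrow> real"
  assumes harm: "harmonic_on P UNIV" and hom: "\<And>t x. P (t *\<^sub>R x) = t ^ k * P x"
    and g: "\<And>s. s > 0 \<Longrightarrow> (g has_real_derivative g' s) (at s)"
    and g': "\<And>s. s > 0 \<Longrightarrow> (g' has_real_derivative g'' s) (at s)"
    and g'': "continuous_on {0<..} g''"
    and ode: "\<And>s. s > 0 \<Longrightarrow> 2 * s * g'' s + (real DIM('a) + 2 * real k) * g' s = 0"
  shows "harmonic_on (\<lambda>x. P x * g (x \<bullet> x)) (- {0})"
proof -
  obtain D A where j0: "harmonic_jet P D A UNIV" using harm by (rule harmonic_onE)
  note j = harmonic_jetD(1,2,4)[OF j0 UNIV_I] and jc = harmonic_jetD(3)[OF j0]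
  have Dc: "continuous_on S D" for S
    by (rule has_derivative_continuous_on[OF has_derivative_at_withinI[OF j(2)]])
  have Pc: "continuous_on S P" for S
    by (rule has_derivative_continuous_on[OF has_derivative_at_withinI[OF j(1)]])
  have gc: "continuous_on {0<..} g" "continuous_on {0<..} g'"
    using g g' by (auto intro!: DERIV_continuous_on intro: has_field_derivative_at_within)
  have comp: "continuous_on (- {0}) (\<lambda>x::'a. q (x \<bullet> x))" if "continuous_on {0<..} q" for q :: "real \<Rightarrow> real"
    by (rule continuous_on_compose2[OF that]) (auto intro!: continuous_intros)
  let ?A = "\<lambda>x h. (2 * (x \<bullet> h) * g' (x \<bullet> x)) *\<^sub>R D x + g (x \<bullet> x) *\<^sub>R A x h +
     (2 * ((h \<bullet> D x) * g' (x \<bullet> x) + P x * (2 * (x \<bullet> h) * g'' (x \<bullet> x)))) *\<^sub>R x + (2 * P x * g' (x \<bullet> x)) *\<^sub>R h"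
  show ?thesis
  proof (rule harmonic_onI[where D = "\<lambda>x. g (x \<bullet> x) *\<^sub>R D x + (2 * P x * g' (x \<bullet> x)) *\<^sub>R x" and A = ?A])
    fix x :: 'a assume "x \<in> - {0}"
    then have s: "x \<bullet> x > 0" by simp
    have sq: "((\<lambda>x. x \<bullet> x) has_derivative (\<lambda>h. 2 * (x \<bullet> h))) (at x)"
      by (auto intro!: derivative_eq_intros simp: inner_commute)
    have dg: "((\<lambda>x. g (x \<bullet> x)) has_derivative (\<lambda>h. 2 * (x \<bullet> h) * g' (x \<bullet> x))) (at x)"
      by (rule DERIV_compose_FDERIV[OF g[OF s] sq])
    have dg': "((\<lambda>x. g' (x \<bullet> x)) has_derivative (\<lambda>h. 2 * (x \<bullet> h) * g'' (x \<bullet> x))) (at x)"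
      by (rule DERIV_compose_FDERIV[OF g'[OF s] sq])
    show "((\<lambda>x. P x * g (x \<bullet> x)) has_derivative
        (\<lambda>h. h \<bullet> (g (x \<bullet> x) *\<^sub>R D x + (2 * P x * g' (x \<bullet> x)) *\<^sub>R x))) (at x)"
      by (rule has_derivative_eq_rhs[OF has_derivative_mult[OF j(1) dg]])
        (simp add: fun_eq_iff inner_add_right algebra_simps inner_commute)
    have "((\<lambda>x. (2 * P x * g' (x \<bullet> x)) *\<^sub>R x) has_derivative
       (\<lambda>h. (2 * P x * g' (x \<bullet> x)) *\<^sub>R h +
        (2 * ((h \<bullet> D x) * g' (x \<bullet> x) + P x * (2 * (x \<bullet> h) * g'' (x \<bullet> x)))) *\<^sub>R x)) (at x)"
      by (rule has_derivative_eq_rhs[OF has_derivative_scaleR[OF has_derivative_mult[OF has_derivative_mult_right[OF j(1)] dg'] has_derivative_ident]])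
        (simp add: fun_eq_iff algebra_simps)
    from has_derivative_add[OF has_derivative_scaleR[OF dg j(2)] this]
    show "((\<lambda>x. g (x \<bullet> x) *\<^sub>R D x + (2 * P x * g' (x \<bullet> x)) *\<^sub>R x) has_derivative ?A x) (at x)"
      by (rule has_derivative_eq_rhs) (simp add: fun_eq_iff algebra_simps)
    have ip: "(\<Sum>i\<in>Basis. (u \<bullet> i) * (v \<bullet> i)) = u \<bullet> v" for u v :: 'a
      by (rule euclidean_inner[symmetric])
    have tr: "(\<Sum>i\<in>Basis. i \<bullet> (i::'a)) = real DIM('a)" by simp
    have "(\<Sum>i\<in>Basis. ?A x i \<bullet> i) = (\<Sum>i\<in>Basis. 4 * g' (x \<bullet> x) * ((x \<bullet> i) * (D x \<bullet> i)) + g (x \<bullet> x) * (A x i \<bullet> i)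
        + 4 * P x * g'' (x \<bullet> x) * ((x \<bullet> i) * (x \<bullet> i)) + 2 * P x * g' (x \<bullet> x) * (i \<bullet> i))"
      by (intro sum.cong refl) (simp add: inner_add_left algebra_simps inner_commute)
    also have "\<dots> = 4 * g' (x \<bullet> x) * (x \<bullet> D x) + g (x \<bullet> x) * 0 + 4 * P x * g'' (x \<bullet> x) * (x \<bullet> x) +
        2 * P x * g' (x \<bullet> x) * real DIM('a)"
      by (simp only: sum.distrib sum_distrib_left[symmetric] ip tr j(3))
    also have "x \<bullet> D x = real k * P x" by (rule homogeneous_euler[OF hom j(1)])
    also have "4 * g' (x \<bullet> x) * (real k * P x) + g (x \<bullet> x) * 0 + 4 * P x * g'' (x \<bullet> x) * (x \<bullet> x) +
        2 * P x * g' (x \<bullet> x) * real DIM('a) =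
        2 * P x * (2 * (x \<bullet> x) * g'' (x \<bullet> x) + (real DIM('a) + 2 * real k) * g' (x \<bullet> x))"
      by (simp add: algebra_simps)
    also have "\<dots> = 0" by (simp only: ode[OF s] mult_zero_right)
    finally show "(\<Sum>i\<in>Basis. ?A x i \<bullet> i) = 0" .
  next
    fix i :: 'a assume i: "i \<in> Basis"
    show "continuous_on (- {0}) (\<lambda>x. ?A x i)"
      by (intro continuous_intros comp gc g'' Dc Pc continuous_on_subset[OF jc[OF i]]) auto
  qed auto
qed

text \<open>The radial factor, on spheres, of the solution that is singular at the origin. In the plane constants
  have the logarithm as their singular partner.\<close>

definition singular_profile :: "nat \<Rightarrow> nat \<Rightarrow> real \<Rightarrow> real" where
  "singular_profile n k r = (if n = 2 \<and> k = 0 then ln r else 1 / r ^ (n - 2 + k))"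

text \<open>The boundary value problem for one spherical harmonic in an annulus is uniquely solvable.\<close>

lemma singular_profile_det:
  assumes "n \<ge> 2" "0 < a" "a < b"
  shows "a ^ k * singular_profile n k b - b ^ k * singular_profile n k a \<noteq> 0"
proof (cases "n = 2 \<and> k = 0")
  case True
  then show ?thesis using assms by (simp add: singular_profile_def)
next
  case False
  then have m: "n - 2 + k > 0" using assms by auto
  have "a ^ k * (1 / b ^ (n - 2 + k)) \<le> b ^ k * (1 / b ^ (n - 2 + k))"
    using assms by (intro mult_right_mono power_mono) auto
  also have "\<dots> < b ^ k * (1 / a ^ (n - 2 + k))"
    using assms m by (intro mult_strict_left_mono divide_strict_left_mono power_strict_mono) auto
  finally show ?thesis unfolding singular_profile_def if_not_P[OF False] by linarith
qed

context harmonic_basis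
begin

text \<open>The Kelvin transform of \<open>P i\<close>.\<close>

definition kelvin :: "'i \<Rightarrow> 'a \<Rightarrow> real" where
  "kelvin i x = P i x / norm x ^ (DIM('a) - 2 + 2 * deg i)"

definition singular :: "'i \<Rightarrow> 'a \<Rightarrow> real" where
  "singular i x = (if DIM('a) = 2 \<and> deg i = 0 then P i x * ln (norm x) else kelvin i x)"

lemma harmonic_kelvin:
  assumes i: "i \<in> I" and dim: "DIM('a) \<ge> 2"
  shows "harmonic_on (kelvin i) (- {0})"
proof -
  define m where "m = - (real DIM('a) - 2 + 2 * real (deg i)) / 2"
  have "harmonic_on (\<lambda>x. P i x * ((x \<bullet> x) powr m)) (- {0})"
  proof (rule harmonic_on_mult_radial[OF harm[OF i] homog[OF i], where g' = "\<lambda>s. m * s powr (m - 1)" and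
        g'' = "\<lambda>s. m * ((m - 1) * s powr (m - 2))"])
    fix s :: real assume s: "s > 0"
    show "((\<lambda>s. s powr m) has_real_derivative m * s powr (m - 1)) (at s)"
      using s by (auto intro!: derivative_eq_intros)
    show "((\<lambda>s. m * s powr (m - 1)) has_real_derivative m * ((m - 1) * s powr (m - 2))) (at s)"
      using s by (auto intro!: derivative_eq_intros)
    have "s powr (m - 1) = s * s powr (m - 2)" using s by (simp add: powr_diff powr_numeral power2_eq_square)
    then show "2 * s * (m * ((m - 1) * s powr (m - 2))) + (real DIM('a) + 2 * real (deg i)) * (m * s powr (m - 1)) = 0"
      by (simp add: m_def field_simps)
  qed (auto intro!: continuous_intros)
  then show ?thesis
  proof (rule harmonic_on_cong)
    fix x :: 'a assume "x \<in> - {0}"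
    then have x: "norm x > 0" by simp
    have "(x \<bullet> x) powr m = (norm x powr 2) powr m" using x by (simp add: dot_square_norm powr_numeral)
    also have "\<dots> = norm x powr (2 * m)" by (rule powr_powr)
    also have "2 * m = - real (DIM('a) - 2 + 2 * deg i)"
      using dim by (simp add: m_def of_nat_diff field_simps)
    also have "norm x powr (- real (DIM('a) - 2 + 2 * deg i)) = 1 / norm x ^ (DIM('a) - 2 + 2 * deg i)"
      using x by (simp only: powr_minus powr_realpow divide_inverse mult_1)
    finally show "kelvin i x = P i x * ((x \<bullet> x) powr m)" by (simp add: kelvin_def)
  qed
qed

lemma harmonic_log:
  assumes "DIM('a) = 2"
  shows "harmonic_on (\<lambda>x::'a. ln (norm x)) (- {0})"
proof -
  have "harmonic_on (\<lambda>x::'a. 1 * (ln (x \<bullet> x) / 2)) (- {0})"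
  proof (rule harmonic_on_mult_radial[where k = 0 and g' = "\<lambda>s. 1 / (2 * s)" and g'' = "\<lambda>s. - 1 / (2 * s\<^sup>2)"])
    show "continuous_on {0<..} (\<lambda>s::real. - 1 / (2 * s\<^sup>2))" by (intro continuous_intros) auto
  qed (auto intro!: derivative_eq_intros harmonic_on_const simp: assms power2_eq_square field_simps)
  then show ?thesis
    by (rule harmonic_on_cong) (simp add: dot_square_norm ln_realpow)
qed

lemma harmonic_singular:
  assumes i: "i \<in> I" and dim: "DIM('a) \<ge> 2"
  shows "harmonic_on (singular i) (- {0})"
proof (cases "DIM('a) = 2 \<and> deg i = 0")
  case True
  have "P i x = P i 0" for x using homog[OF i, of 0 x] True by simp
  then have "singular i = (\<lambda>x. P i 0 * ln (norm x))" using True by (metis singular_def)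
  then show ?thesis using harmonic_on_cmult[OF harmonic_log] True by simp
next
  case False
  then have "singular i = kelvin i" by (auto simp: singular_def)
  then show ?thesis using harmonic_kelvin[OF i dim] by simp
qed

lemma kelvin_polar:
  assumes i: "i \<in> I" and r: "r > 0" and x: "x \<in> usphere"
  shows "kelvin i (r *\<^sub>R x) = 1 / r ^ (DIM('a) - 2 + deg i) * P i x"
  using assms by (simp add: kelvin_def homog power_add mult_2)

lemma singular_polar:
  assumes i: "i \<in> I" and r: "r > 0" and x: "x \<in> usphere"
  shows "singular i (r *\<^sub>R x) = singular_profile DIM('a) (deg i) r * P i x"
  using kelvin_polar[OF assms] assms by (simp add: singular_def singular_profile_def homog)

text \<open>Both \<open>r ^ deg i\<close> and the singular profile satisfy this three-point relation in \<open>a\<close>, \<open>r\<close>, \<open>b\<close>. On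
  the two boundary spheres \<open>u\<close> is uniformly close to finite combinations of spherical harmonics; these are the
  boundary values of a finite sum \<open>H\<close> of regular and singular solutions. By the maximum principle \<open>H\<close> is uniformly
  close to \<open>u\<close> in the whole annulus, and the relation, which holds for \<open>H\<close>, passes to the limit.\<close>

lemma coeff_annulus_relation:
  fixes u :: "'a \<Rightarrow> real"
  assumes dim: "DIM('a) \<ge> 2" and ab: "0 < a" "a < b"
    and u: "harmonic_on u S" "cball 0 b - ball 0 a \<subseteq> S" and i: "i \<in> I" and r: "a \<le> r" "r \<le> b"
  defines "f \<equiv> \<lambda>r. coeff (\<lambda>x. u (r *\<^sub>R x)) i" and "\<phi> \<equiv> \<lambda>j. singular_profile DIM('a) (deg j)"
  shows "f r * (a ^ deg i * \<phi> i b - b ^ deg i * \<phi> i a) =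
     f a * (r ^ deg i * \<phi> i b - b ^ deg i * \<phi> i r) + f b * (a ^ deg i * \<phi> i r - r ^ deg i * \<phi> i a)"
proof -
  define k where "k = deg i"
  let ?A = "LINT x|sphere_measure. \<bar>P i x\<bar>"
  have A: "?A \<ge> 0" by (rule Bochner_Integration.integral_nonneg) simp
  \<comment> \<open>The functional vanishes on \<open>t ^ k\<close> and on the singular profile; it has to vanish at \<open>f\<close>.\<close>
  define \<Lambda> where "\<Lambda> h = h r * (a ^ k * \<phi> i b - b ^ k * \<phi> i a) -
     h a * (r ^ k * \<phi> i b - b ^ k * \<phi> i r) - h b * (a ^ k * \<phi> i r - r ^ k * \<phi> i a)" for h :: "real \<Rightarrow> real"
  define M where "M = \<bar>a ^ k * \<phi> i b - b ^ k * \<phi> i a\<bar> + \<bar>r ^ k * \<phi> i b - b ^ k * \<phi> i r\<bar> +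
     \<bar>a ^ k * \<phi> i r - r ^ k * \<phi> i a\<bar>"
  have M: "M \<ge> 0" by (simp add: M_def)
  have \<Lambda>_bound: "\<bar>\<Lambda> h\<bar> \<le> e * M" if "\<And>t. t \<in> {a, r, b} \<Longrightarrow> \<bar>h t\<bar> \<le> e" for h e
  proof -
    have "\<bar>\<Lambda> h\<bar> \<le> \<bar>h r\<bar> * \<bar>a ^ k * \<phi> i b - b ^ k * \<phi> i a\<bar> + \<bar>h a\<bar> * \<bar>r ^ k * \<phi> i b - b ^ k * \<phi> i r\<bar> +
        \<bar>h b\<bar> * \<bar>a ^ k * \<phi> i r - r ^ k * \<phi> i a\<bar>"
      unfolding \<Lambda>_def abs_mult[symmetric] by linarith
    also have "\<dots> \<le> e * M" unfolding M_def distrib_left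
      by (intro add_mono mult_right_mono that) auto
    finally show ?thesis .
  qed
  have inS: "t *\<^sub>R x \<in> S" if "a \<le> t" "t \<le> b" "x \<in> usphere" for t x
    using u(2) that ab by auto
  have ucont: "continuous_on usphere (\<lambda>x. u (t *\<^sub>R x))" if "a \<le> t" "t \<le> b" for t
    by (rule continuous_on_compose2[OF harmonic_on_continuous[OF u(1)]])
      (use that inS in \<open>auto intro!: continuous_intros\<close>)
  have det: "a ^ deg j * \<phi> j b - b ^ deg j * \<phi> j a \<noteq> 0" for j
    unfolding \<phi>_def using singular_profile_det[OF dim ab] .
  have "\<bar>\<Lambda> f\<bar> \<le> 0 + e" if e: "e > 0" for e
  proof -
    define d where "d = e / (?A * M + 1)"
    have AM: "?A * M \<ge> 0" using A M by simp
    then have d: "d > 0" using e by (simp add: d_def)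
    obtain F1 c1 where F1: "finite F1" "F1 \<subseteq> I" "\<And>x. x \<in> usphere \<Longrightarrow> \<bar>u (a *\<^sub>R x) - (\<Sum>j\<in>F1. c1 j * P j x)\<bar> \<le> d"
      using uniformly_dense[OF ucont[of a] d] ab by auto
    obtain F2 c2 where F2: "finite F2" "F2 \<subseteq> I" "\<And>x. x \<in> usphere \<Longrightarrow> \<bar>u (b *\<^sub>R x) - (\<Sum>j\<in>F2. c2 j * P j x)\<bar> \<le> d"
      using uniformly_dense[OF ucont[of b] d] ab by auto
    define F where "F = F1 \<union> F2"
    define p where "p j = (if j \<in> F1 then c1 j else 0)" for j
    define q where "q j = (if j \<in> F2 then c2 j else 0)" for j
    have F: "finite F" "F \<subseteq> I" using F1 F2 by (auto simp: F_def)
    have sp: "(\<Sum>j\<in>F1. c1 j * P j x) = (\<Sum>j\<in>F. p j * P j x)" for x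
      by (rule sum.mono_neutral_cong_left) (use F in \<open>auto simp: F_def p_def\<close>)
    have sq: "(\<Sum>j\<in>F2. c2 j * P j x) = (\<Sum>j\<in>F. q j * P j x)" for x
      by (rule sum.mono_neutral_cong_left) (use F in \<open>auto simp: F_def q_def\<close>)
    \<comment> \<open>Cramer's rule for the solution with boundary coefficients \<open>p j\<close> on radius \<open>a\<close> and \<open>q j\<close> on radius \<open>b\<close>.\<close>
    define \<alpha> where "\<alpha> j = (p j * \<phi> j b - q j * \<phi> j a) / (a ^ deg j * \<phi> j b - b ^ deg j * \<phi> j a)" for j
    define \<beta> where "\<beta> j = (q j * a ^ deg j - p j * b ^ deg j) / (a ^ deg j * \<phi> j b - b ^ deg j * \<phi> j a)" for j
    define \<gamma> where "\<gamma> t j = \<alpha> j * t ^ deg j + \<beta> j * \<phi> j t" for t j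
    have \<gamma>_eq: "\<gamma> t j = (p j * (t ^ deg j * \<phi> j b - b ^ deg j * \<phi> j t) + q j * (a ^ deg j * \<phi> j t - t ^ deg j * \<phi> j a))
        / (a ^ deg j * \<phi> j b - b ^ deg j * \<phi> j a)" for t j
      unfolding \<gamma>_def \<alpha>_def \<beta>_def times_divide_eq_left add_divide_distrib[symmetric]
      by (rule arg_cong[where f = "\<lambda>z. z / _"]) (simp add: algebra_simps)
    have \<gamma>a: "\<gamma> a j = p j" and \<gamma>b: "\<gamma> b j = q j" for j
      unfolding \<gamma>_eq using det[of j] by simp_all
    define H where "H x = (\<Sum>j\<in>F. \<alpha> j * P j x + \<beta> j * singular j x)" for x
    have Hpolar: "H (t *\<^sub>R x) = (\<Sum>j\<in>F. \<gamma> t j * P j x)" if "t > 0" "x \<in> usphere" for t x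
      unfolding H_def
      by (rule sum.cong) (use F that in \<open>auto simp: homog singular_polar \<gamma>_def \<phi>_def algebra_simps\<close>)
    have Hharm: "harmonic_on H (- {0})"
      unfolding H_def using F
      by (intro harmonic_on_sum harmonic_on_add harmonic_on_cmult harmonic_singular dim
          harmonic_on_subset[OF harm]) auto
    define K where "K = cball 0 b - ball (0::'a) a"
    have Kc: "compact K" unfolding K_def by (intro compact_diff) auto
    have KS: "K \<subseteq> S" "K \<subseteq> - {0}" using u(2) ab by (auto simp: K_def)
    define U where "U = ball 0 b - cball (0::'a) a"
    have Uo: "open U" unfolding U_def by (intro open_Diff) auto
    have UK: "U \<subseteq> K" by (auto simp: U_def K_def)
    have close: "\<bar>u x - H x\<bar> \<le> d" if x: "x \<in> K" for x
    proof (rule harmonic_maximum_principle_abs[where f = "\<lambda>x. u x - H x" and K = K and U = U, OF Kc UK _ _ _ x])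
      show "continuous_on K (\<lambda>x. u x - H x)"
        using KS by (intro continuous_intros continuous_on_subset[OF harmonic_on_continuous[OF u(1)]]
            continuous_on_subset[OF harmonic_on_continuous[OF Hharm]])
      show "harmonic_on (\<lambda>x. u x - H x) U"
        using KS UK by (intro harmonic_on_diff harmonic_on_subset[OF u(1) Uo] harmonic_on_subset[OF Hharm Uo]) auto
      fix z assume "z \<in> K - U"
      then have "norm z = a \<or> norm z = b" by (auto simp: K_def U_def)
      then obtain t where t: "norm z = t" "t = a \<or> t = b" by blast
      then have t0: "t > 0" using ab by auto
      define x where "x = z /\<^sub>R t"
      have x: "x \<in> usphere" "z = t *\<^sub>R x" using t t0 by (auto simp: x_def)
      show "\<bar>u z - H z\<bar> \<le> d"
        using t(2) F1(3)[OF x(1)] F2(3)[OF x(1)] Hpolar[OF t0 x(1)] \<gamma>a \<gamma>b x(2) sp sq by auto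
    qed
    have \<Lambda>\<gamma>: "\<Lambda> (\<lambda>t. \<gamma> t i) = 0" by (simp add: \<Lambda>_def \<gamma>_def k_def algebra_simps)
    have approx: "\<bar>f t - (if i \<in> F then \<gamma> t i else 0)\<bar> \<le> d * ?A" if t: "a \<le> t" "t \<le> b" for t
    proof -
      have c: "continuous_on usphere (\<lambda>x. \<Sum>j\<in>F. \<gamma> t j * P j x)" by (rule continuous_combination[OF F(2)])
      have "\<bar>coeff (\<lambda>x. u (t *\<^sub>R x) - (\<Sum>j\<in>F. \<gamma> t j * P j x)) i\<bar> \<le> d * ?A"
      proof (rule coeff_abs_bound[OF continuous_on_diff[OF ucont[OF t] c] i])
        fix x :: 'a assume x: "x \<in> usphere"
        have "t *\<^sub>R x \<in> K" using x t ab by (simp add: K_def)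
        from close[OF this] show "\<bar>u (t *\<^sub>R x) - (\<Sum>j\<in>F. \<gamma> t j * P j x)\<bar> \<le> d"
          using Hpolar[OF _ x, of t] t ab by simp
      qed
      then show ?thesis
        by (simp add: f_def coeff_diff[OF ucont[OF t] c i] coeff_combination[OF F i])
    qed
    have "\<Lambda> f = \<Lambda> (\<lambda>t. f t - (if i \<in> F then \<gamma> t i else 0))"
      using \<Lambda>\<gamma> unfolding \<Lambda>_def by (cases "i \<in> F") (simp_all add: algebra_simps)
    also have "\<bar>\<dots>\<bar> \<le> (d * ?A) * M"
      by (rule \<Lambda>_bound) (use approx r ab in auto)
    also have "\<dots> = d * (?A * M)" by simp
    also have "\<dots> \<le> d * (?A * M + 1)" using d by simp
    also have "\<dots> = e"
    proof -
      have "?A * M + 1 \<noteq> 0" using AM by linarith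
      then show ?thesis by (simp add: d_def)
    qed
    finally show ?thesis by simp
  qed
  then have "\<bar>\<Lambda> f\<bar> \<le> 0" by (rule field_le_epsilon)
  then show ?thesis by (simp add: \<Lambda>_def k_def)
qed

text \<open>The relation with fixed radii \<open>R / 2\<close> and \<open>R\<close>, solved for the value at \<open>r\<close>.\<close>

lemma coeff_punctured_ball:
  fixes u :: "'a \<Rightarrow> real"
  assumes dim: "DIM('a) \<ge> 2" and R: "R > 0"
    and u: "harmonic_on u S" "cball 0 R - {0} \<subseteq> S" and i: "i \<in> I"
  shows "\<exists>\<alpha> \<beta>. \<forall>r. 0 < r \<longrightarrow> r \<le> R \<longrightarrow>
     coeff (\<lambda>x. u (r *\<^sub>R x)) i = \<alpha> * r ^ deg i + \<beta> * singular_profile DIM('a) (deg i) r"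
proof -
  define f where "f r = coeff (\<lambda>x. u (r *\<^sub>R x)) i" for r
  define \<phi> where "\<phi> = singular_profile DIM('a) (deg i)"
  define k where "k = deg i"
  have rel: "f t * (a ^ k * \<phi> b - b ^ k * \<phi> a) =
     f a * (t ^ k * \<phi> b - b ^ k * \<phi> t) + f b * (a ^ k * \<phi> t - t ^ k * \<phi> a)"
    if "0 < a" "a < b" "b \<le> R" "a \<le> t" "t \<le> b" for a b t
  proof -
    have "cball 0 b - ball 0 a \<subseteq> S" using that u(2) by force
    from coeff_annulus_relation[OF dim that(1,2) u(1) this i that(4,5)]
    show ?thesis by (simp add: f_def \<phi>_def k_def)
  qed
  define a where "a = R / 2"
  define \<Delta> where "\<Delta> = a ^ k * \<phi> R - R ^ k * \<phi> a"
  have aR: "0 < a" "a < R" using R by (auto simp: a_def)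
  have \<Delta>: "\<Delta> \<noteq> 0" unfolding \<Delta>_def \<phi>_def k_def using singular_profile_det[OF dim aR] .
  have *: "f r * \<Delta> = f a * (r ^ k * \<phi> R - R ^ k * \<phi> r) + f R * (a ^ k * \<phi> r - r ^ k * \<phi> a)"
    if r: "0 < r" "r \<le> R" for r
  proof (cases "a \<le> r")
    case True
    then show ?thesis unfolding \<Delta>_def using rel[OF aR _ True r(2)] by simp
  next
    case False
    then have "r < R" using aR by simp
    from rel[OF r(1) this order_refl, of a] False aR
    show ?thesis unfolding \<Delta>_def by (simp add: algebra_simps)
  qed
  have "f r = ((f a * \<phi> R - f R * \<phi> a) / \<Delta>) * r ^ k + ((f R * a ^ k - f a * R ^ k) / \<Delta>) * \<phi> r"
    if "0 < r" "r \<le> R" for r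
  proof -
    have "f r = (f a * (r ^ k * \<phi> R - R ^ k * \<phi> r) + f R * (a ^ k * \<phi> r - r ^ k * \<phi> a)) / \<Delta>"
      unfolding *[OF that, symmetric] using \<Delta> by simp
    also have "\<dots> = ((f a * \<phi> R - f R * \<phi> a) / \<Delta>) * r ^ k + ((f R * a ^ k - f a * R ^ k) / \<Delta>) * \<phi> r"
      unfolding times_divide_eq_left add_divide_distrib[symmetric]
      by (rule arg_cong[where f = "\<lambda>z. z / _"]) (simp add: algebra_simps)
    finally show ?thesis .
  qed
  then show ?thesis unfolding f_def \<phi>_def k_def by blast
qed

end

section \<open>Decomposition near an isolated singularity\<close>

lemma poisson_kernel_0: "y \<in> usphere \<Longrightarrow> poisson_kernel 0 (y::'a::euclidean_space) = 1 / sphere_area TYPE('a)"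
  by (simp add: poisson_kernel_def sphere_area_def)

lemma sphere_mean_value:
  fixes u :: "'a::euclidean_space \<Rightarrow> real"
  assumes u: "continuous_on (cball 0 1) u" "harmonic_on u (ball 0 1)"
  shows "(LINT y|sphere_measure. u y) = sphere_area TYPE('a) * u 0"
proof -
  have "u 0 = poisson_integral u 0" using poisson_formula[OF u, of 0] by simp
  also have "\<dots> = (LINT y|sphere_measure. u y * (1 / sphere_area TYPE('a)))"
    unfolding poisson_integral_def by (rule sphere_integral_cong) (simp add: poisson_kernel_0)
  also have "\<dots> = (LINT y|sphere_measure. u y) / sphere_area TYPE('a)" by simp
  finally show ?thesis using sphere_area_pos[where 'a='a] by (simp add: field_simps)
qed

text \<open>Eliminating one of the two unknowns between the radii \<open>r\<close> and \<open>2 r\<close>. Up to the natural powers of \<open>r\<close>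
  the constants do not depend on \<open>k\<close>, so square summability of the spherical coefficients on the two spheres is inherited.\<close>

lemma two_radii_bounds:
  fixes \<alpha> \<beta> r :: real and k :: nat
  assumes n: "n \<ge> 2" and r: "r > 0"
  defines "f \<equiv> \<lambda>r. \<alpha> * r ^ k + \<beta> * singular_profile n k r"
  shows "\<bar>\<beta>\<bar> \<le> 2 * r ^ (n - 2 + k) * (\<bar>f r\<bar> + \<bar>f (2 * r)\<bar>)"
    and "\<bar>\<alpha> * r ^ k\<bar> \<le> (3 + 2 * \<bar>ln r\<bar>) * (\<bar>f r\<bar> + \<bar>f (2 * r)\<bar>)"
proof -
  define m where "m = n - 2 + k"
  let ?s = "\<bar>f r\<bar> + \<bar>f (2 * r)\<bar>"
  have rm: "r ^ m > 0" using r by simp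
  show 1: "\<bar>\<beta>\<bar> \<le> 2 * r ^ (n - 2 + k) * ?s"
  proof (cases "n = 2 \<and> k = 0")
    case True
    then have "f (2 * r) - f r = \<beta> * ln 2"
      using r by (simp add: f_def singular_profile_def ln_mult algebra_simps)
    moreover have "\<bar>\<beta>\<bar> * (1 / 2) \<le> \<bar>\<beta>\<bar> * ln 2"
      using ln2_ge_two_thirds by (intro mult_left_mono) auto
    ultimately have "\<bar>\<beta>\<bar> * (1 / 2) \<le> \<bar>f (2 * r) - f r\<bar>" by (simp add: abs_mult)
    then have "\<bar>\<beta>\<bar> \<le> 2 * ?s"
      using abs_triangle_ineq4[of "f (2 * r)" "f r"] by argo
    then show ?thesis using True by simp
  next
    case False
    then have mk: "m + k > 0" using n by (auto simp: m_def)
    have \<phi>: "singular_profile n k t = 1 / t ^ m" for t using False by (auto simp: singular_profile_def m_def)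
    have *: "2 ^ k * f r - f (2 * r) = \<beta> / r ^ m * (2 ^ k - 1 / 2 ^ m)"
      unfolding f_def \<phi> using r by (simp add: power_mult_distrib field_simps)
    have h: "2 ^ k / 2 \<le> 2 ^ k - 1 / (2::real) ^ m"
    proof -
      have "(2::real) ^ 1 \<le> 2 ^ (m + k)" using mk by (intro power_increasing) auto
      then show ?thesis by (simp add: power_add field_simps)
    qed
    have "\<bar>\<beta> / r ^ m\<bar> * (2 ^ k / 2) \<le> \<bar>2 ^ k * f r - f (2 * r)\<bar>"
      unfolding * abs_mult by (intro mult_left_mono order_trans[OF h abs_ge_self] abs_ge_zero)
    also have "\<dots> \<le> 2 ^ k * \<bar>f r\<bar> + 1 * \<bar>f (2 * r)\<bar>"
      using abs_triangle_ineq4[of "2 ^ k * f r" "f (2 * r)"] by (simp add: abs_mult)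
    also have "\<dots> \<le> 2 ^ k * ?s"
      unfolding distrib_left by (intro add_left_mono mult_right_mono) auto
    finally have "2 ^ k * (\<bar>\<beta> / r ^ m\<bar> / 2) \<le> 2 ^ k * ?s" by (simp only: times_divide_eq_right mult.commute)
    then have "\<bar>\<beta> / r ^ m\<bar> / 2 \<le> ?s" by (subst (asm) mult_le_cancel_left_pos) simp_all
    then have "\<bar>\<beta> / r ^ m\<bar> \<le> 2 * ?s"
      by (simp only: pos_divide_le_eq zero_less_numeral mult.commute)
    then have "\<bar>\<beta>\<bar> / r ^ m \<le> 2 * ?s" using rm by simp
    then have "\<bar>\<beta>\<bar> \<le> 2 * ?s * r ^ m" by (simp only: pos_divide_le_eq[OF rm])
    then show ?thesis unfolding m_def by (simp only: mult_ac)
  qed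
  have "\<bar>singular_profile n k r\<bar> \<le> (1 + \<bar>ln r\<bar>) / r ^ m"
    using r by (auto simp: singular_profile_def m_def intro!: divide_right_mono)
  then have "\<bar>\<beta> * singular_profile n k r\<bar> \<le> (2 * r ^ m * ?s) * ((1 + \<bar>ln r\<bar>) / r ^ m)"
    unfolding abs_mult using 1 rm unfolding m_def[symmetric] by (intro mult_mono) auto
  also have "\<dots> = 2 * (1 + \<bar>ln r\<bar>) * ?s" using r by simp
  finally have "\<bar>\<beta> * singular_profile n k r\<bar> \<le> 2 * (1 + \<bar>ln r\<bar>) * ?s" .
  moreover have "\<alpha> * r ^ k = f r - \<beta> * singular_profile n k r" by (simp add: f_def)
  ultimately have "\<bar>\<alpha> * r ^ k\<bar> \<le> ?s + 2 * (1 + \<bar>ln r\<bar>) * ?s" by linarith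
  also have "\<dots> = (3 + 2 * \<bar>ln r\<bar>) * ?s" by (simp add: algebra_simps)
  finally show "\<bar>\<alpha> * r ^ k\<bar> \<le> (3 + 2 * \<bar>ln r\<bar>) * ?s" .
qed

lemma square_le_two_squares:
  fixes x y z C :: real
  assumes "\<bar>x\<bar> \<le> C * (\<bar>y\<bar> + \<bar>z\<bar>)"
  shows "x\<^sup>2 \<le> 2 * C\<^sup>2 * (y\<^sup>2 + z\<^sup>2)"
proof -
  have "x\<^sup>2 \<le> (C * (\<bar>y\<bar> + \<bar>z\<bar>))\<^sup>2" using power_mono[OF assms, of 2] by simp
  also have "\<dots> = C\<^sup>2 * (\<bar>y\<bar> + \<bar>z\<bar>)\<^sup>2" by (simp add: power_mult_distrib)
  also have "(\<bar>y\<bar> + \<bar>z\<bar>)\<^sup>2 \<le> 2 * (y\<^sup>2 + z\<^sup>2)"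
    using sum_squares_bound[of "\<bar>y\<bar>" "\<bar>z\<bar>"] by (simp add: power2_sum)
  finally have "x\<^sup>2 \<le> C\<^sup>2 * (2 * (y\<^sup>2 + z\<^sup>2))" by (simp add: mult_left_mono)
  then show ?thesis by (simp only: mult_ac)
qed

context harmonic_basis
begin

lemma admissible_mono:
  assumes "admissible c r" "0 \<le> t" "t \<le> r"
  shows "admissible c t"
  unfolding admissible_def
proof (rule summable_on_comparison_test)
  show "(\<lambda>i. (c i)\<^sup>2 * r ^ (2 * deg i)) summable_on I" using assms(1) by (simp add: admissible_def)
  show "(c i)\<^sup>2 * t ^ (2 * deg i) \<le> (c i)\<^sup>2 * r ^ (2 * deg i)" for i
    using assms by (intro mult_left_mono power_mono) auto
qed (use assms in auto)

definition entire :: "('i \<Rightarrow> real) \<Rightarrow> bool" where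
  "entire c \<longleftrightarrow> (\<forall>r>0. admissible c r)"

lemma entire_admissible: "entire c \<Longrightarrow> r > 0 \<Longrightarrow> admissible c r"
  by (simp add: entire_def)

lemma harmonic_series_entire: "entire c \<Longrightarrow> harmonic_on (series c) UNIV"
proof (rule harmonic_on_locally)
  fix x :: 'a assume "entire c"
  then have "harmonic_on (series c) (ball 0 (norm x + 1))"
    by (intro harmonic_series entire_admissible) (auto intro: add_nonneg_pos)
  then show "\<exists>U. x \<in> U \<and> U \<subseteq> UNIV \<and> harmonic_on (series c) U"
    by (intro exI[of _ "ball 0 (norm x + 1)"]) simp
qed

text \<open>The Kelvin transform of the entire function \<open>series c\<close>. For \<open>n = 2\<close> the added term replaces its constant
  part \<open>series c 0\<close> by \<open>series c 0 * ln (norm x)\<close>, so that one family \<open>c\<close> describes the singular part in every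
  dimension.\<close>

definition singular_part :: "('i \<Rightarrow> real) \<Rightarrow> 'a \<Rightarrow> real" where
  "singular_part c x = series c (x /\<^sub>R (norm x)\<^sup>2) / norm x ^ (DIM('a) - 2) +
     (if DIM('a) = 2 then series c 0 * (ln (norm x) - 1) else 0)"

text \<open>Inversion maps compact sets off the origin to compact sets, so the finite sums of the Kelvin transforms
  converge locally uniformly.\<close>

lemma harmonic_singular_part:
  assumes c: "entire c" and dim: "DIM('a) \<ge> 2"
  shows "harmonic_on (singular_part c) (- {0})"
proof -
  have "harmonic_on (\<lambda>x. series c (x /\<^sub>R (norm x)\<^sup>2) / norm x ^ (DIM('a) - 2)) (- {0})"
  proof (rule harmonic_on_uniform_limit)
    fix x :: 'a assume "x \<in> - {0}"
    then have x: "norm x > 0" by simp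
    define d where "d = norm x / 2"
    have d: "d > 0" using x by (simp add: d_def)
    have nb: "norm y \<ge> d" if "y \<in> cball x d" for y
      using that norm_triangle_ineq2[of x "x - y"] by (simp add: d_def dist_norm)
    show "\<exists>d>0. cball x d \<subseteq> - {0} \<and> (\<forall>e>0. \<exists>f. harmonic_on f (- {0}) \<and>
       (\<forall>y\<in>cball x d. \<bar>f y - series c (y /\<^sub>R (norm y)\<^sup>2) / norm y ^ (DIM('a) - 2)\<bar> \<le> e))"
    proof (rule exI[of _ d], intro conjI allI impI d)
      show "cball x d \<subseteq> - {0}" using nb[of 0] d by auto
      fix e :: real assume e: "e > 0"
      define e' where "e' = e * d ^ (DIM('a) - 2)"
      have e': "e' > 0" using e d by (simp add: e'_def)
      have rr: "2 / d > 0" using d by simp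
      obtain F where F: "finite F" "F \<subseteq> I"
        "\<And>G x. finite G \<Longrightarrow> F \<subseteq> G \<Longrightarrow> G \<subseteq> I \<Longrightarrow> norm x \<le> (1/2) * (2 / d) \<Longrightarrow>
           \<bar>(\<Sum>i\<in>G. c i * P i x) - series c x\<bar> \<le> e'"
        by (rule series_uniform_approx[OF entire_admissible[OF c rr] _ _ rr e', of "1/2"]) (simp, simp, blast)
      have "\<bar>(\<Sum>i\<in>F. c i * kelvin i y) - series c (y /\<^sub>R (norm y)\<^sup>2) / norm y ^ (DIM('a) - 2)\<bar> \<le> e"
        if y: "y \<in> cball x d" for y
      proof -
        have ny: "norm y > 0" "norm y \<ge> d" using nb[OF y] d by auto
        let ?y = "y /\<^sub>R (norm y)\<^sup>2"
        have "norm ?y = 1 / norm y" using ny by (simp add: power2_eq_square field_simps)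
        also have "\<dots> \<le> 1 / d" using ny d by (intro divide_left_mono) auto
        finally have ry: "norm ?y \<le> (1/2) * (2 / d)" by simp
        have pw: "d ^ (DIM('a) - 2) \<le> norm y ^ (DIM('a) - 2)" using ny d by (intro power_mono) auto
        have "kelvin i y = P i ?y / norm y ^ (DIM('a) - 2)" if "i \<in> F" for i
        proof -
          have "P i ?y = P i y / norm y ^ (2 * deg i)"
          proof -
            have "inverse ((norm y)\<^sup>2) ^ deg i = inverse (norm y ^ (2 * deg i))"
              by (simp only: power_inverse power_mult)
            then show ?thesis using homog[of i "inverse ((norm y)\<^sup>2)" y] that F(2)
              by (simp only: subsetD divide_inverse mult.commute)
          qed
          then show ?thesis by (simp add: kelvin_def power_add)
        qed
        then have "(\<Sum>i\<in>F. c i * kelvin i y) = (\<Sum>i\<in>F. c i * P i ?y) / norm y ^ (DIM('a) - 2)"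
          by (simp add: sum_divide_distrib)
        then have "\<bar>(\<Sum>i\<in>F. c i * kelvin i y) - series c ?y / norm y ^ (DIM('a) - 2)\<bar> =
            \<bar>(\<Sum>i\<in>F. c i * P i ?y) - series c ?y\<bar> / norm y ^ (DIM('a) - 2)"
          using ny by (simp add: diff_divide_distrib[symmetric] abs_divide)
        also have "\<dots> \<le> e' / norm y ^ (DIM('a) - 2)"
          using F(3)[OF F(1) order_refl F(2) ry] by (intro divide_right_mono) auto
        also have "\<dots> \<le> e' / d ^ (DIM('a) - 2)"
          using pw e' d ny by (intro divide_left_mono) auto
        also have "\<dots> = e" using d by (simp add: e'_def)
        finally show ?thesis .
      qed
      moreover have "harmonic_on (\<lambda>y. \<Sum>i\<in>F. c i * kelvin i y) (- {0})"
        using F by (intro harmonic_on_sum harmonic_on_cmult harmonic_kelvin dim) auto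
      ultimately show "\<exists>f. harmonic_on f (- {0}) \<and>
         (\<forall>y\<in>cball x d. \<bar>f y - series c (y /\<^sub>R (norm y)\<^sup>2) / norm y ^ (DIM('a) - 2)\<bar> \<le> e)" by blast
    qed
  qed
  moreover have "harmonic_on (\<lambda>x::'a. if DIM('a) = 2 then series c 0 * (ln (norm x) - 1) else 0) (- {0})"
    using harmonic_log by (cases "DIM('a) = 2")
      (auto intro!: harmonic_on_cmult harmonic_on_diff harmonic_on_const)
  ultimately show ?thesis unfolding singular_part_def by (rule harmonic_on_add)
qed

lemma singular_part_polar:
  assumes "r > 0" "x \<in> usphere"
  shows "singular_part c (r *\<^sub>R x) = 1 / r ^ (DIM('a) - 2) * series c ((1 / r) *\<^sub>R x) +
     (if DIM('a) = 2 then series c 0 * (ln r - 1) else 0)"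
proof -
  have "(r *\<^sub>R x) /\<^sub>R (norm (r *\<^sub>R x))\<^sup>2 = (1 / r) *\<^sub>R x"
  proof -
    have "inverse ((norm (r *\<^sub>R x))\<^sup>2) * r = 1 / r" using assms by (simp add: power2_eq_square field_simps)
    then show ?thesis by (metis scaleR_scaleR)
  qed
  then show ?thesis unfolding singular_part_def by (simp only:) (use assms in simp)
qed

lemma integral_basis_zero: "i \<in> I \<Longrightarrow> deg i > 0 \<Longrightarrow> (LINT x|sphere_measure. P i x) = 0"
  using sphere_mean_value[OF continuous_P harmonic_on_subset[OF harm], of i] homog[of i 0 0]
  by (simp add: power_0_left)

lemma series_continuous_sphere: "entire c \<Longrightarrow> continuous_on usphere (\<lambda>x. series c (t *\<^sub>R x))"
  by (rule continuous_on_compose2[OF harmonic_on_continuous[OF harmonic_series_entire]])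
    (auto intro!: continuous_intros)

lemma coeff_series_entire:
  assumes "entire c" "0 \<le> t" "i \<in> I"
  shows "coeff (\<lambda>x. series c (t *\<^sub>R x)) i = c i * t ^ deg i"
  by (rule coeff_series[of c "t + 1"]) (use assms in \<open>auto intro: entire_admissible\<close>)

text \<open>Spherical harmonics of positive degree have mean value zero, and those of degree zero are constant.\<close>

lemma coeff_const_series_0:
  assumes c: "entire c" and i: "i \<in> I"
  shows "series c 0 * (LINT x|sphere_measure. P i x) = (if deg i = 0 then c i else 0)"
proof (cases "deg i = 0")
  case True
  then have P: "P i x = P i 0" for x using homog[OF i, of 0 x] by simp
  have "c i = coeff (\<lambda>x. series c (1 *\<^sub>R x)) i" using coeff_series_entire[OF c _ i, of 1] by simp
  also have "\<dots> = (LINT x|sphere_measure. series c x) * P i 0"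
    unfolding coeff_def by (subst P) simp
  also have "(LINT x|sphere_measure. series c x) = sphere_area TYPE('a) * series c 0"
    using harmonic_series_entire[OF c]
    by (intro sphere_mean_value) (auto intro: continuous_on_subset[OF harmonic_on_continuous] harmonic_on_subset)
  also have "sphere_area TYPE('a) * series c 0 * P i 0 = series c 0 * (LINT x|(sphere_measure::'a measure). P i 0)"
    unfolding sphere_integral_const by simp
  also have "(LINT x|(sphere_measure::'a measure). P i 0) = (LINT x|sphere_measure. P i x)"
    by (rule sphere_integral_cong) (rule P[symmetric])
  finally show ?thesis using True by simp
next
  case False
  then show ?thesis using integral_basis_zero[OF i] by simp
qed

lemma coeff_singular_part:
  assumes c: "entire c" and r: "r > 0" and i: "i \<in> I"
  shows "coeff (\<lambda>x. singular_part c (r *\<^sub>R x)) i = c i * singular_profile DIM('a) (deg i) r"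
proof -
  let ?k = "if DIM('a) = 2 then series c 0 * (ln r - 1) else 0"
  have "coeff (\<lambda>x. singular_part c (r *\<^sub>R x)) i =
      coeff (\<lambda>x. 1 / r ^ (DIM('a) - 2) * series c ((1 / r) *\<^sub>R x) + ?k) i"
    by (rule coeff_cong) (rule singular_part_polar[OF r])
  also have "\<dots> = 1 / r ^ (DIM('a) - 2) * (c i * (1 / r) ^ deg i) + ?k * (LINT x|sphere_measure. P i x)"
  proof -
    have c1: "continuous_on usphere (\<lambda>x. 1 / r ^ (DIM('a) - 2) * series c ((1 / r) *\<^sub>R x))"
      by (intro continuous_on_mult continuous_on_const series_continuous_sphere c)
    have "coeff (\<lambda>x. ?k) i = ?k * (LINT x|sphere_measure. P i x)"
      unfolding coeff_def by (rule integral_mult_right_zero)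
    then show ?thesis
      using coeff_series_entire[OF c _ i, of "1 / r"] r
      unfolding coeff_add[OF c1 continuous_on_const i] coeff_cmult by simp
  qed
  also have "\<dots> = c i * singular_profile DIM('a) (deg i) r"
    using coeff_const_series_0[OF c i] r
    by (auto simp: singular_profile_def power_add power_one_over algebra_simps)
  finally show ?thesis .
qed

text \<open>The coefficients of \<open>u\<close> on spheres determine \<open>\<alpha>\<close> and \<open>\<beta>\<close>. Bessel's inequality on two spheres gives
  convergence of both series; the radii may be taken arbitrarily small, which is why \<open>\<beta>\<close> decays faster than any
  geometric sequence. Both sides are compared on each sphere, where coefficients determine a continuous function.\<close>

theorem laurent_decomposition:
  fixes u :: "'a \<Rightarrow> real"
  assumes dim: "DIM('a) \<ge> 2" and R: "R > 0" and u: "harmonic_on u S" "cball 0 R - {0} \<subseteq> S"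
  obtains \<alpha> \<beta> where "admissible \<alpha> (R / 2)" "entire \<beta>"
    "\<And>x. 0 < norm x \<Longrightarrow> norm x < R / 2 \<Longrightarrow> u x = series \<alpha> x + singular_part \<beta> x"
proof -
  let ?n = "DIM('a)"
  have "\<exists>\<alpha> \<beta>. \<forall>i\<in>I. \<forall>r. 0 < r \<longrightarrow> r \<le> R \<longrightarrow>
     coeff (\<lambda>x. u (r *\<^sub>R x)) i = \<alpha> i * r ^ deg i + \<beta> i * singular_profile ?n (deg i) r"
    using coeff_punctured_ball[OF dim R u] by metis
  then obtain \<alpha> \<beta> where ab: "\<And>i r. i \<in> I \<Longrightarrow> 0 < r \<Longrightarrow> r \<le> R \<Longrightarrow>
     coeff (\<lambda>x. u (r *\<^sub>R x)) i = \<alpha> i * r ^ deg i + \<beta> i * singular_profile ?n (deg i) r" by blast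
  have ucont: "continuous_on usphere (\<lambda>x. u (t *\<^sub>R x))" if "0 < t" "t \<le> R" for t
    by (rule continuous_on_compose2[OF harmonic_on_continuous[OF u(1)]])
      (use that u(2) in \<open>auto intro!: continuous_intros\<close>)
  have sumf: "(\<lambda>i. K * ((coeff (\<lambda>x. u (r *\<^sub>R x)) i)\<^sup>2 + (coeff (\<lambda>x. u ((2 * r) *\<^sub>R x)) i)\<^sup>2)) summable_on I"
    if "0 < r" "r \<le> R / 2" for r K
    by (intro summable_on_cmult_right summable_on_add bessel_summable ucont) (use that in auto)
  have beta: "admissible \<beta> (1 / r)" if r: "0 < r" "r \<le> R / 2" for r
    unfolding admissible_def
  proof (rule summable_on_comparison_test[OF sumf[OF r, of "2 * (2 * r ^ (?n - 2))\<^sup>2"]])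
    fix i assume i: "i \<in> I"
    have "\<bar>\<beta> i\<bar> \<le> 2 * r ^ (?n - 2 + deg i) *
        (\<bar>coeff (\<lambda>x. u (r *\<^sub>R x)) i\<bar> + \<bar>coeff (\<lambda>x. u ((2 * r) *\<^sub>R x)) i\<bar>)"
      using two_radii_bounds(1)[OF dim r(1), of "\<beta> i" "deg i" "\<alpha> i"] ab[OF i, of r] ab[OF i, of "2 * r"] r by simp
    then have "\<bar>\<beta> i\<bar> * (1 / r) ^ deg i \<le> 2 * r ^ (?n - 2 + deg i) *
        (\<bar>coeff (\<lambda>x. u (r *\<^sub>R x)) i\<bar> + \<bar>coeff (\<lambda>x. u ((2 * r) *\<^sub>R x)) i\<bar>) * (1 / r) ^ deg i"
      using r by (intro mult_right_mono) auto
    also have "\<dots> = 2 * r ^ (?n - 2) *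
        (\<bar>coeff (\<lambda>x. u (r *\<^sub>R x)) i\<bar> + \<bar>coeff (\<lambda>x. u ((2 * r) *\<^sub>R x)) i\<bar>)"
      using r by (simp add: power_add power_one_over)
    finally have "\<bar>\<beta> i * (1 / r) ^ deg i\<bar> \<le> \<dots>" using r by (simp add: abs_mult)
    from square_le_two_squares[OF this]
    show "(\<beta> i)\<^sup>2 * (1 / r) ^ (2 * deg i) \<le> 2 * (2 * r ^ (?n - 2))\<^sup>2 *
        ((coeff (\<lambda>x. u (r *\<^sub>R x)) i)\<^sup>2 + (coeff (\<lambda>x. u ((2 * r) *\<^sub>R x)) i)\<^sup>2)"
      by (simp only: power_mult_distrib power_mult power_commutes mult.commute[of 2 "deg i"])
  qed (use r in simp)
  have "entire \<beta>" unfolding entire_def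
  proof (intro allI impI)
    fix t :: real assume t: "t > 0"
    show "admissible \<beta> t"
    proof (rule admissible_mono[OF beta])
      show "0 < min (1 / t) (R / 2)" using t R by simp
      show "t \<le> 1 / min (1 / t) (R / 2)" using t R by (auto simp: min_def field_simps)
    qed (use t in auto)
  qed
  moreover have alpha: "admissible \<alpha> (R / 2)"
    unfolding admissible_def
  proof (rule summable_on_comparison_test[OF sumf[of "R / 2" "2 * (3 + 2 * \<bar>ln (R / 2)\<bar>)\<^sup>2"]])
    fix i assume i: "i \<in> I"
    have "\<bar>\<alpha> i * (R / 2) ^ deg i\<bar> \<le> (3 + 2 * \<bar>ln (R / 2)\<bar>) *
        (\<bar>coeff (\<lambda>x. u ((R / 2) *\<^sub>R x)) i\<bar> + \<bar>coeff (\<lambda>x. u ((2 * (R / 2)) *\<^sub>R x)) i\<bar>)"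
      using two_radii_bounds(2)[OF dim, of "R / 2" "\<alpha> i" "deg i" "\<beta> i"] ab[OF i, of "R / 2"] ab[OF i, of "2 * (R / 2)"] R
      by simp
    from square_le_two_squares[OF this]
    show "(\<alpha> i)\<^sup>2 * (R / 2) ^ (2 * deg i) \<le> 2 * (3 + 2 * \<bar>ln (R / 2)\<bar>)\<^sup>2 *
        ((coeff (\<lambda>x. u ((R / 2) *\<^sub>R x)) i)\<^sup>2 + (coeff (\<lambda>x. u ((2 * (R / 2)) *\<^sub>R x)) i)\<^sup>2)"
      by (simp only: power_mult_distrib power_mult power_commutes mult.commute[of 2 "deg i"])
  qed (use R in auto)
  moreover have "u x = series \<alpha> x + singular_part \<beta> x" if x: "0 < norm x" "norm x < R / 2" for x
  proof -
    define r where "r = norm x"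
    define y where "y = x /\<^sub>R r"
    have y: "y \<in> usphere" "x = r *\<^sub>R y" and r: "0 < r" "r < R / 2" using x by (auto simp: y_def r_def)
    have c1: "continuous_on usphere (\<lambda>x. u (r *\<^sub>R x))" using r by (intro ucont) auto
    have c2: "continuous_on usphere (\<lambda>x. series \<alpha> (r *\<^sub>R x))"
      by (rule continuous_on_compose2[OF harmonic_on_continuous[OF harmonic_series[OF alpha]]])
        (use r in \<open>auto intro!: continuous_intros\<close>)
    have c3: "continuous_on usphere (\<lambda>x. singular_part \<beta> (r *\<^sub>R x))"
      by (rule continuous_on_compose2[OF harmonic_on_continuous[OF harmonic_singular_part[OF \<open>entire \<beta>\<close> dim]]])
        (use r in \<open>auto intro!: continuous_intros\<close>)
    have "u (r *\<^sub>R y) - (series \<alpha> (r *\<^sub>R y) + singular_part \<beta> (r *\<^sub>R y)) = 0"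
    proof (rule coeff_zero_imp_zero[OF _ _ y(1)])
      show "continuous_on usphere (\<lambda>x. u (r *\<^sub>R x) - (series \<alpha> (r *\<^sub>R x) + singular_part \<beta> (r *\<^sub>R x)))"
        by (intro continuous_intros c1 c2 c3)
      fix i assume i: "i \<in> I"
      have "coeff (\<lambda>x. u (r *\<^sub>R x)) i = \<alpha> i * r ^ deg i + \<beta> i * singular_profile ?n (deg i) r"
        using r by (intro ab i) auto
      moreover have "coeff (\<lambda>x. series \<alpha> (r *\<^sub>R x)) i = \<alpha> i * r ^ deg i"
        using r by (intro coeff_series[OF alpha] i) auto
      moreover have "coeff (\<lambda>x. singular_part \<beta> (r *\<^sub>R x)) i = \<beta> i * singular_profile ?n (deg i) r"
        by (rule coeff_singular_part[OF \<open>entire \<beta>\<close> r(1) i])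
      ultimately show "coeff (\<lambda>x. u (r *\<^sub>R x) - (series \<alpha> (r *\<^sub>R x) + singular_part \<beta> (r *\<^sub>R x))) i = 0"
        by (simp add: coeff_diff[OF c1 continuous_on_add[OF c2 c3] i] coeff_add[OF c2 c3 i])
    qed
    then show ?thesis by (simp add: y(2))
  qed
  ultimately show ?thesis using that by blast
qed

end

section \<open>The trace at the origin as a limit of Poisson integrals\<close>

lemma integral_periodic_shift:
  fixes g :: "real \<Rightarrow> real"
  assumes g: "continuous_on UNIV g" and per: "\<And>s. g (s + 2 * pi) = g s" and t: "0 \<le> t" "t \<le> 2 * pi"
  shows "integral {-pi..pi} (\<lambda>s. g (t + s)) = integral {-pi..pi} g"
proof -
  have int: "g integrable_on {a..b}" for a b
    by (intro integrable_continuous_real continuous_on_subset[OF g]) auto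
  have "integral {-pi..pi} (\<lambda>s. g (t + s)) = integral {-pi+t..pi+t} g"
    using integral_shift_Icc_real[of "-pi" pi g t] by (simp add: o_def)
  also have "\<dots> = integral {-pi+t..pi} g + integral {pi..pi+t} g"
    using t by (intro Henstock_Kurzweil_Integration.integral_combine[symmetric] int) auto
  also have "integral {pi..pi+t} g = integral {-pi..-pi+t} (g \<circ> (+) (2 * pi))"
    using integral_shift_Icc_real[of "-pi" "-pi+t" g "2 * pi"] by (simp add: algebra_simps)
  also have "g \<circ> (+) (2 * pi) = g" using per by (auto simp: o_def add.commute)
  also have "integral {-pi+t..pi} g + integral {-pi..-pi+t} g = integral {-pi..pi} g"
    using t by (subst add.commute, intro Henstock_Kurzweil_Integration.integral_combine int) auto
  finally show ?thesis .
qed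

text \<open>Polar coordinates in the plane with respect to either ordering of the standard basis.\<close>

locale plane_basis =
  fixes e1 e2 :: "'a::euclidean_space"
  assumes Basis: "Basis = {e1, e2}" and neq: "e1 \<noteq> e2"
begin

lemma inner_basis [simp]: "e1 \<bullet> e1 = 1" "e2 \<bullet> e2 = 1" "e1 \<bullet> e2 = 0" "e2 \<bullet> e1 = 0"
  using Basis neq inner_Basis by (metis insertCI)+

lemma DIM_plane: "DIM('a) = 2" by (subst Basis) (simp add: neq)

lemma sphere_area_plane: "sphere_area TYPE('a) = 2 * pi"
  by (simp add: sphere_area_def DIM_plane)

lemma inner_eq: "u \<bullet> v = (u \<bullet> e1) * (v \<bullet> e1) + (u \<bullet> e2) * (v \<bullet> e2)" for u v :: 'a
  using euclidean_inner[of u v] neq by (simp add: Basis)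

abbreviation circle :: "real \<Rightarrow> 'a" where "circle t \<equiv> polar e1 e2 1 t"

lemma polar_scale: "polar e1 e2 r t = r *\<^sub>R circle t"
  by (simp add: polar_def scaleR_add_right)

lemma circle_inner: "circle s \<bullet> circle t = cos (s - t)"
  by (simp add: polar_def inner_add_left inner_add_right cos_diff)

lemma circle_in_usphere [simp]: "circle t \<in> usphere"
  using circle_inner[of t t] by (simp add: norm_eq_1)

lemma norm_circle [simp]: "norm (circle t) = 1"
  using circle_in_usphere[of t] by simp

lemma usphere_circle:
  assumes "x \<in> usphere"
  obtains t where "0 \<le> t" "t < 2 * pi" "x = circle t"
proof -
  have "x \<bullet> x = 1" using assms by (simp add: dot_square_norm)
  then have "(x \<bullet> e1)\<^sup>2 + (x \<bullet> e2)\<^sup>2 = 1" using inner_eq[of x x] by (simp add: power2_eq_square)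
  then obtain t where t: "0 \<le> t" "t < 2 * pi" "x \<bullet> e1 = cos t" "x \<bullet> e2 = sin t"
    by (rule sincos_total_2pi)
  have "x = (\<Sum>i\<in>Basis. (x \<bullet> i) *\<^sub>R i)" by (simp add: euclidean_representation)
  also have "\<dots> = circle t" using neq t by (simp add: Basis polar_def)
  finally show ?thesis using that t by blast
qed

definition rotation :: "real \<Rightarrow> 'a \<Rightarrow> 'a" where
  "rotation s x = (x \<bullet> e1) *\<^sub>R circle s + (x \<bullet> e2) *\<^sub>R (cos s *\<^sub>R e2 - sin s *\<^sub>R e1)"

lemma rotation_circle: "rotation s (circle t) = circle (t + s)"
  by (simp add: rotation_def polar_def inner_add_left cos_add sin_add algebra_simps)

lemma rotation_orthogonal: "orthogonal_transformation (rotation s)"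
  unfolding orthogonal_transformation_def
proof (intro conjI allI)
  show "linear (rotation s)"
    by (rule linearI) (simp_all add: rotation_def inner_add_left algebra_simps)
  fix u v :: 'a
  have sc: "cos s * cos s + sin s * sin s = 1" using sin_cos_squared_add3 by blast
  have rot: "rotation s u \<bullet> e1 = (u \<bullet> e1) * cos s - (u \<bullet> e2) * sin s"
    "rotation s u \<bullet> e2 = (u \<bullet> e1) * sin s + (u \<bullet> e2) * cos s" for u
    by (simp_all add: rotation_def polar_def inner_add_left inner_diff_left)
  have "rotation s u \<bullet> rotation s v =
      ((u \<bullet> e1) * (v \<bullet> e1) + (u \<bullet> e2) * (v \<bullet> e2)) * (cos s * cos s + sin s * sin s)"
    unfolding inner_eq[of "rotation s u" "rotation s v"] rot by (simp only: algebra_simps)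
  then show "rotation s u \<bullet> rotation s v = u \<bullet> v" unfolding sc inner_eq[of u v] by simp
qed

lemma continuous_circle: "continuous_on S circle"
  unfolding polar_def by (intro continuous_intros)

text \<open>Both sides are invariant under rotations. Averaging \<open>f \<circ> rotation s\<close> over \<open>s\<close> and over the sphere in
  both orders gives \<open>2 pi\<close> times each side.\<close>

theorem sphere_integral_circle:
  fixes f :: "'a \<Rightarrow> real"
  assumes f: "continuous_on usphere f"
  shows "(LBINT t=-pi..pi. f (circle t)) = (LINT x|sphere_measure. f x)"
proof -
  let ?S = "sphere_measure :: 'a measure"
  \<comment> \<open>A finite measure, so that boundedness suffices for Fubini.\<close>
  define M where "M = restrict_space (lborel :: real measure) {-pi..pi}"
  have spM: "space M = {-pi..pi}" by (simp add: M_def space_restrict_space)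
  have emM: "emeasure M {-pi..pi} = ennreal (2 * pi)"
    unfolding M_def by (subst emeasure_restrict_space) auto
  have finM: "finite_measure M" by (rule finite_measureI) (simp add: spM emM)
  interpret M: finite_measure M by (rule finM)
  interpret S: finite_measure ?S by (rule finite_measure_sphere)
  interpret P: pair_sigma_finite ?S M ..
  interpret PP: finite_measure "?S \<Otimes>\<^sub>M M"
    by (rule finite_measure_pair_measure[OF finM finite_measure_sphere])
  have nrm: "norm (rotation s x) = norm x" for s x
    by (rule orthogonal_transformation_norm[OF rotation_orthogonal])
  have [measurable]: "(\<lambda>s. s) \<in> borel_measurable M"
    unfolding M_def by (intro measurable_restrict_space1) simp
  have [measurable]: "(\<lambda>x. x) \<in> borel_measurable ?S"
    by (intro continuous_on_borel_measurable_sphere continuous_intros)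
  have "(\<lambda>p. rotation (snd p) (fst p)) \<in> borel_measurable (?S \<Otimes>\<^sub>M M)"
    unfolding rotation_def polar_def by measurable
  then have rm: "(\<lambda>p. rotation (snd p) (fst p)) \<in> ?S \<Otimes>\<^sub>M M \<rightarrow>\<^sub>M restrict_space borel usphere"
    by (rule measurable_restrict_space2[rotated]) (auto simp: space_pair_measure nrm)
  have Fm: "(\<lambda>(x,s). f (rotation s x)) \<in> borel_measurable (?S \<Otimes>\<^sub>M M)"
    using measurable_compose[OF rm borel_measurable_continuous_on_restrict[OF f]]
    by (simp add: case_prod_beta)
  have "compact (f ` usphere)" by (intro compact_continuous_image f compact_sphere)
  then obtain B where "\<forall>v\<in>f ` usphere. norm v \<le> B" using compact_imp_bounded bounded_iff by metis
  then have B: "\<bar>f x\<bar> \<le> B" if "x \<in> usphere" for x using that by force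
  have int: "integrable (?S \<Otimes>\<^sub>M M) (\<lambda>(x,s). f (rotation s x))"
    by (rule PP.integrable_const_bound[where B = B])
      (auto intro!: AE_I2 B Fm simp: space_pair_measure nrm)
  define C where "C = (LBINT t=-pi..pi. f (circle t))"
  have fc: "continuous_on S (\<lambda>s. f (circle s))" for S
    by (rule continuous_on_compose2[OF f continuous_circle]) auto
  have setint: "(LINT s|M. g s) = integral {-pi..pi} g" if g: "continuous_on UNIV g" for g :: "real \<Rightarrow> real"
  proof -
    have "set_integrable lborel {-pi..pi} g"
      by (intro borel_integrable_atLeastAtMost' continuous_on_subset[OF g]) auto
    then show ?thesis
      unfolding M_def by (subst integral_restrict_space)
        (auto simp: set_borel_integral_eq_integral(2)[symmetric] set_lebesgue_integral_def)
  qed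
  have C: "C = integral {-pi..pi} (\<lambda>s. f (circle s))"
    unfolding C_def by (intro interval_integral_eq_integral borel_integrable_atLeastAtMost' fc) simp
  have "2 * pi * (LINT x|?S. f x) = (LINT s|M. (LINT x|?S. f x))"
    using emM by (simp add: spM measure_def)
  also have "\<dots> = (LINT s|M. (LINT x|?S. f (rotation s x)))"
    by (simp add: sphere_integral_orthogonal[OF rotation_orthogonal f])
  also have "\<dots> = (LINT x|?S. (LINT s|M. f (rotation s x)))"
    by (rule P.Fubini_integral[OF int])
  also have "\<dots> = (LINT x|?S. C)"
  proof (rule sphere_integral_cong)
    fix x :: 'a assume "x \<in> usphere"
    then obtain t where t: "0 \<le> t" "t < 2 * pi" "x = circle t" by (rule usphere_circle)
    have "(LINT s|M. f (rotation s x)) = (LINT s|M. f (circle (t + s)))"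
      by (simp add: t(3) rotation_circle)
    also have "\<dots> = integral {-pi..pi} (\<lambda>s. f (circle (t + s)))"
      by (intro setint continuous_on_compose2[OF fc[of UNIV]] continuous_intros) auto
    also have "\<dots> = C" unfolding C
      by (rule integral_periodic_shift[OF fc]) (use t in \<open>auto simp: polar_def\<close>)
    finally show "(LINT s|M. f (rotation s x)) = C" .
  qed
  also have "\<dots> = C * (2 * pi)" unfolding sphere_integral_const sphere_area_plane ..
  finally show ?thesis by (simp add: C_def)
qed

end

text \<open>The quantity whose limit for \<open>r \<rightarrow> 0\<close> is the trace, written with the Poisson kernel in every dimension.
  In the plane the kernel of the definition is \<open>2 pi\<close> times the Poisson kernel, minus \<open>1\<close>, plus \<open>1 / ln r\<close>.\<close>

definition sigma_mean :: "('a::euclidean_space \<Rightarrow> real) \<Rightarrow> 'a \<Rightarrow> real \<Rightarrow> real" where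
  "sigma_mean u t r =
     (let m = poisson_integral (\<lambda>y. u (r *\<^sub>R y)) (r *\<^sub>R t);
          a = (LINT y|sphere_measure. u (r *\<^sub>R y)) / sphere_area TYPE('a)
      in if DIM('a) = 2 then m - a + a / ln r else r ^ (DIM('a) - 2) * m)"

lemma eventually_at_right_0: "(\<And>r::real. 0 < r \<Longrightarrow> r < b \<Longrightarrow> Q r) \<Longrightarrow> b > 0 \<Longrightarrow> eventually Q (at_right 0)"
  by (auto simp: eventually_at_right_field)

lemma continuous_on_dilation_sphere:
  fixes u :: "'a::euclidean_space \<Rightarrow> real"
  assumes "continuous_on (ball 0 R - {0}) u" "0 < r" "r < R"
  shows "continuous_on usphere (\<lambda>y. u (r *\<^sub>R y))"
  by (rule continuous_on_compose2[OF assms(1)]) (use assms in \<open>auto intro!: continuous_intros\<close>)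

lemma (in plane_basis) sigma_mean_plane:
  fixes u :: "'a \<Rightarrow> real"
  assumes u: "continuous_on usphere (\<lambda>y. u (r *\<^sub>R y))" and r: "0 < r" "r < 1"
  shows "1 / (2 * pi) * (LBINT \<phi>'=-pi..pi. u (polar e1 e2 r \<phi>') *
           ((2 * r * cos (\<phi> - \<phi>') - 2 * r\<^sup>2) / (1 - 2 * r * cos (\<phi> - \<phi>') + r\<^sup>2) + 1 / ln r)) =
         sigma_mean u (circle \<phi>) r"
proof -
  let ?x = "r *\<^sub>R circle \<phi>"
  have xb: "?x \<in> ball 0 1" using r circle_in_usphere[of \<phi>] by simp
  define f where "f y = u (r *\<^sub>R y) * (2 * pi * poisson_kernel ?x y - 1 + 1 / ln r)" for y
  have f: "continuous_on usphere f"
    unfolding f_def by (intro continuous_intros u continuous_poisson_kernel_snd[OF xb])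
  have "u (polar e1 e2 r \<phi>') *
     ((2 * r * cos (\<phi> - \<phi>') - 2 * r\<^sup>2) / (1 - 2 * r * cos (\<phi> - \<phi>') + r\<^sup>2) + 1 / ln r) = f (circle \<phi>')" for \<phi>'
  proof -
    let ?D = "1 - 2 * r * cos (\<phi> - \<phi>') + r\<^sup>2"
    have D: "(norm (?x - circle \<phi>'))\<^sup>2 = ?D"
    proof -
      have "circle \<phi>' \<bullet> circle \<phi> = cos (\<phi> - \<phi>')" by (subst inner_commute) (rule circle_inner)
      then show ?thesis unfolding power2_norm_eq_inner
        by (simp add: inner_diff_left inner_diff_right circle_inner[of _ \<phi>'] circle_inner[of \<phi> \<phi>] power2_eq_square algebra_simps)
    qed
    have "?x \<noteq> circle \<phi>'" by (rule ball_neq_usphere[OF xb circle_in_usphere])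
    then have "?D \<noteq> 0" unfolding D[symmetric] by simp
    moreover have "2 * pi * poisson_kernel ?x (circle \<phi>') = (1 - r\<^sup>2) / ?D"
      using circle_in_usphere[of \<phi>] r D by (simp add: poisson_kernel_def DIM_plane)
    ultimately have "2 * pi * poisson_kernel ?x (circle \<phi>') - 1 = (2 * r * cos (\<phi> - \<phi>') - 2 * r\<^sup>2) / ?D"
      by (simp add: field_simps)
    then show ?thesis by (simp add: f_def polar_scale[of r])
  qed
  then have "(LBINT \<phi>'=-pi..pi. u (polar e1 e2 r \<phi>') *
     ((2 * r * cos (\<phi> - \<phi>') - 2 * r\<^sup>2) / (1 - 2 * r * cos (\<phi> - \<phi>') + r\<^sup>2) + 1 / ln r)) =
     (LBINT t=-pi..pi. f (circle t))" by simp
  also have "\<dots> = (LINT y|sphere_measure. f y)" by (rule sphere_integral_circle[OF f])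
  also have "\<dots> = (LINT y|sphere_measure. 2 * pi * (u (r *\<^sub>R y) * poisson_kernel ?x y) + (1 / ln r - 1) * u (r *\<^sub>R y))"
    by (rule sphere_integral_cong) (simp add: f_def algebra_simps)
  also have "\<dots> = (LINT y|sphere_measure. 2 * pi * (u (r *\<^sub>R y) * poisson_kernel ?x y)) +
      (LINT y|sphere_measure. (1 / ln r - 1) * u (r *\<^sub>R y))"
    by (intro Bochner_Integration.integral_add continuous_on_integrable_sphere continuous_intros u
        continuous_poisson_kernel_snd[OF xb])
  also have "\<dots> = 2 * pi * poisson_integral (\<lambda>y. u (r *\<^sub>R y)) ?x +
     (1 / ln r - 1) * (LINT y|sphere_measure. u (r *\<^sub>R y))"
    by (simp add: poisson_integral_def)
  finally show ?thesis
    by (simp add: sigma_mean_def DIM_plane sphere_area_plane Let_def field_simps)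
qed

lemma has_sigma_trace_iff:
  fixes u \<psi> :: "'a::euclidean_space \<Rightarrow> real"
  assumes u: "continuous_on (ball 0 R - {0}) u" and R: "R > 0"
  shows "has_sigma_trace u \<psi> \<longleftrightarrow> (\<forall>t\<in>usphere. (sigma_mean u t \<longlongrightarrow> \<psi> t) (at_right 0))"
proof (cases "DIM('a) = 2")
  case False
  then show ?thesis
    by (simp add: has_sigma_trace_def sigma_mean_def[abs_def] poisson_integral_def Let_def)
next
  case True
  have eq: "((\<lambda>r. 1 / (2 * pi) * (LBINT \<phi>'=-pi..pi. u (polar e1 e2 r \<phi>') *
         ((2 * r * cos (\<phi> - \<phi>') - 2 * r\<^sup>2) / (1 - 2 * r * cos (\<phi> - \<phi>') + r\<^sup>2) + 1 / ln r)))
         \<longlongrightarrow> \<psi> (polar e1 e2 1 \<phi>)) (at_right 0) \<longleftrightarrow>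
       (sigma_mean u (polar e1 e2 1 \<phi>) \<longlongrightarrow> \<psi> (polar e1 e2 1 \<phi>)) (at_right 0)"
    if B: "Basis = {e1, e2}" "e1 \<noteq> e2" for e1 e2 :: 'a and \<phi>
  proof (rule tendsto_cong, rule eventually_at_right_0[of "min R 1"])
    interpret plane_basis e1 e2 by unfold_locales (rule B)+
    fix r :: real assume r: "0 < r" "r < min R 1"
    show "1 / (2 * pi) * (LBINT \<phi>'=-pi..pi. u (polar e1 e2 r \<phi>') *
         ((2 * r * cos (\<phi> - \<phi>') - 2 * r\<^sup>2) / (1 - 2 * r * cos (\<phi> - \<phi>') + r\<^sup>2) + 1 / ln r)) =
       sigma_mean u (polar e1 e2 1 \<phi>) r"
      by (rule sigma_mean_plane) (use r continuous_on_dilation_sphere[OF u] in auto)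
  qed (use R in simp)
  obtain b1 b2 :: 'a where b: "Basis = {b1, b2}" "b1 \<noteq> b2" using True by (metis card_2_iff)
  show ?thesis
  proof
    assume tr: "has_sigma_trace u \<psi>"
    show "\<forall>t\<in>usphere. (sigma_mean u t \<longlongrightarrow> \<psi> t) (at_right 0)"
    proof
      fix t :: 'a assume "t \<in> usphere"
      interpret plane_basis b1 b2 by unfold_locales (rule b)+
      obtain \<phi> where "t = circle \<phi>" using usphere_circle[OF \<open>t \<in> usphere\<close>] by metis
      moreover have "(sigma_mean u (circle \<phi>) \<longlongrightarrow> \<psi> (circle \<phi>)) (at_right 0)"
        using tr True b unfolding has_sigma_trace_def eq[OF b, symmetric] by simp
      ultimately show "(sigma_mean u t \<longlongrightarrow> \<psi> t) (at_right 0)" by simp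
    qed
  next
    assume tr: "\<forall>t\<in>usphere. (sigma_mean u t \<longlongrightarrow> \<psi> t) (at_right 0)"
    have "(sigma_mean u (polar e1 e2 1 \<phi>) \<longlongrightarrow> \<psi> (polar e1 e2 1 \<phi>)) (at_right 0)"
      if B: "Basis = {e1, e2}" "e1 \<noteq> e2" for e1 e2 :: 'a and \<phi>
    proof -
      interpret plane_basis e1 e2 by unfold_locales (rule B)+
      show ?thesis using tr circle_in_usphere by blast
    qed
    then show "has_sigma_trace u \<psi>" unfolding has_sigma_trace_def using True eq by simp
  qed
qed

lemma sigma_mean_add:
  fixes u v :: "'a::euclidean_space \<Rightarrow> real"
  assumes u: "continuous_on usphere (\<lambda>y. u (r *\<^sub>R y))" and v: "continuous_on usphere (\<lambda>y. v (r *\<^sub>R y))"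
    and r: "0 < r" "r < 1" and t: "t \<in> usphere"
  shows "sigma_mean (\<lambda>x. u x + v x) t r = sigma_mean u t r + sigma_mean v t r"
proof -
  have xb: "r *\<^sub>R t \<in> ball 0 1" using r t by simp
  show ?thesis
    by (simp add: sigma_mean_def Let_def poisson_integral_add[OF u v xb] sphere_integral_add[OF u v]
        add_divide_distrib algebra_simps)
qed

lemma sigma_mean_cong:
  assumes "\<And>y. y \<in> usphere \<Longrightarrow> u (r *\<^sub>R y) = v (r *\<^sub>R y)"
  shows "sigma_mean u t r = sigma_mean v t r"
proof -
  have "poisson_integral (\<lambda>y. u (r *\<^sub>R y)) (r *\<^sub>R t) = poisson_integral (\<lambda>y. v (r *\<^sub>R y)) (r *\<^sub>R t)"
    by (rule poisson_integral_cong) (rule assms)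
  moreover have "(LINT y|sphere_measure. u (r *\<^sub>R y)) = (LINT y|sphere_measure. v (r *\<^sub>R y))"
    by (rule sphere_integral_cong) (rule assms)
  ultimately show ?thesis by (simp add: sigma_mean_def)
qed

text \<open>By the Poisson formula the Poisson integral is \<open>v (r\<^sup>2 t)\<close> and the mean value is \<open>v 0\<close>.\<close>

lemma sigma_mean_regular:
  fixes v :: "'a::euclidean_space \<Rightarrow> real"
  assumes dim: "DIM('a) \<ge> 2" and v: "harmonic_on v (ball 0 R)" and R: "R > 0" and t: "t \<in> usphere"
  shows "(sigma_mean v t \<longlongrightarrow> 0) (at_right 0)"
proof -
  have vc: "continuous_on (ball 0 R) v" by (rule harmonic_on_continuous[OF v])
  have lim: "((\<lambda>r. v ((r * r) *\<^sub>R t)) \<longlongrightarrow> v 0) (at_right 0)"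
  proof -
    have "isCont v 0" using vc R by (simp add: continuous_on_eq_continuous_at)
    moreover have "((\<lambda>r. (r * r) *\<^sub>R t) \<longlongrightarrow> (0 * 0) *\<^sub>R t) (at_right 0)" by (intro tendsto_intros)
    ultimately show ?thesis by (auto intro: isCont_tendsto_compose)
  qed
  define m where "m r = (if DIM('a) = 2 then v ((r * r) *\<^sub>R t) - v 0 + v 0 / ln r
      else r ^ (DIM('a) - 2) * v ((r * r) *\<^sub>R t))" for r
  have "(m \<longlongrightarrow> 0) (at_right 0)"
  proof (cases "DIM('a) = 2")
    case True
    have "((\<lambda>r. v 0 / ln r) \<longlongrightarrow> 0) (at_right 0)"
      by (rule tendsto_divide_0[OF tendsto_const]) (rule filterlim_at_bot_imp_at_infinity[OF ln_at_0])
    then have "((\<lambda>r. v ((r * r) *\<^sub>R t) - v 0 + v 0 / ln r) \<longlongrightarrow> v 0 - v 0 + 0) (at_right 0)"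
      by (intro tendsto_intros lim)
    then show ?thesis using True by (simp add: m_def[abs_def])
  next
    case False
    have "((\<lambda>r. r ^ (DIM('a) - 2) * v ((r * r) *\<^sub>R t)) \<longlongrightarrow> 0 ^ (DIM('a) - 2) * v 0) (at_right 0)"
      by (intro tendsto_intros lim)
    moreover have "0 ^ (DIM('a) - 2) = (0::real)" using dim False by (intro zero_power) linarith
    ultimately show ?thesis using False by (simp add: m_def[abs_def])
  qed
  moreover have "\<forall>\<^sub>F r in at_right 0. sigma_mean v t r = m r"
  proof (rule eventually_at_right_0[of "min R 1"])
    fix r :: real assume r: "0 < r" "r < min R 1"
    have cb: "continuous_on (cball 0 r) v" and hb: "harmonic_on v (ball 0 r)"
      using r by (auto intro!: continuous_on_subset[OF vc] harmonic_on_subset[OF v])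
    have p: "poisson_integral (\<lambda>y. v (0 + r *\<^sub>R y)) x = v (0 + r *\<^sub>R x)" if "x \<in> ball 0 1" for x
      by (rule poisson_formula_affine[OF cb hb r(1) that])
    have "(LINT y|sphere_measure. v (r *\<^sub>R y)) = sphere_area TYPE('a) * v (r *\<^sub>R 0)"
    proof (rule sphere_mean_value)
      show "continuous_on (cball 0 1) (\<lambda>y. v (r *\<^sub>R y))"
        using r by (intro continuous_on_compose2[OF cb] continuous_intros) (auto intro: mult_left_le)
      show "harmonic_on (\<lambda>y. v (r *\<^sub>R y)) (ball 0 1)"
      proof -
        have "{y. 0 + r *\<^sub>R y \<in> ball 0 r} = ball (0::'a) 1" using r by auto
        then show ?thesis using harmonic_on_affine[OF hb, of 0 r] by simp
      qed
    qed
    then show "sigma_mean v t r = m r"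
      using p[of "r *\<^sub>R t"] r t sphere_area_pos[where 'a='a] by (simp add: sigma_mean_def m_def Let_def)
  qed (use R in simp)
  ultimately show ?thesis by (simp add: tendsto_cong)
qed

context harmonic_basis
begin

text \<open>On the sphere of radius \<open>r\<close> the singular part is a multiple of \<open>y \<mapsto> series c (y / r)\<close>, up to the
  logarithm. Its Poisson integral at \<open>r *\<^sub>R t\<close> is the value of the entire function at \<open>t\<close>; in the plane the terms
  with \<open>ln r\<close> cancel.\<close>

lemma sigma_mean_singular_part:
  assumes c: "entire c" and r: "0 < r" "r < 1" and t: "t \<in> usphere"
  shows "sigma_mean (singular_part c) t r = series c t"
proof -
  let ?k = "if DIM('a) = 2 then series c 0 * (ln r - 1) else 0"
  have xb: "r *\<^sub>R t \<in> ball 0 1" using r t by simp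
  have hs: "harmonic_on (\<lambda>y. series c (0 + (1 / r) *\<^sub>R y)) UNIV"
    using harmonic_on_affine[OF harmonic_series_entire[OF c], of 0 "1 / r"] by simp
  have cs: "continuous_on S (\<lambda>y. series c ((1 / r) *\<^sub>R y))" for S
    using harmonic_on_continuous[OF hs] continuous_on_subset by fastforce
  have hs1: "harmonic_on (\<lambda>y. series c ((1 / r) *\<^sub>R y)) (ball 0 1)"
    using harmonic_on_subset[OF hs] by simp
  have p: "poisson_integral (\<lambda>y. series c ((1 / r) *\<^sub>R y)) (r *\<^sub>R t) = series c t"
    using poisson_formula[OF cs hs1 xb] r by simp
  have mv: "(LINT y|sphere_measure. series c ((1 / r) *\<^sub>R y)) = sphere_area TYPE('a) * series c 0"
    using sphere_mean_value[OF cs hs1] by simp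
  let ?q = "1 / r ^ (DIM('a) - 2)"
  have polar: "singular_part c (r *\<^sub>R y) = ?q * series c ((1 / r) *\<^sub>R y) + ?k" if "y \<in> usphere" for y
    by (rule singular_part_polar[OF r(1) that])
  have cq: "continuous_on usphere (\<lambda>y. ?q * series c ((1 / r) *\<^sub>R y))"
    by (intro continuous_on_mult continuous_on_const cs)
  have "poisson_integral (\<lambda>y. singular_part c (r *\<^sub>R y)) (r *\<^sub>R t) =
      poisson_integral (\<lambda>y. ?q * series c ((1 / r) *\<^sub>R y) + ?k) (r *\<^sub>R t)"
    by (rule poisson_integral_cong) (rule polar)
  also have "\<dots> = ?q * series c t + ?k"
    unfolding poisson_integral_add[OF cq continuous_on_const xb] poisson_integral_cmult
      poisson_integral_const[OF xb] p ..
  finally have m: "poisson_integral (\<lambda>y. singular_part c (r *\<^sub>R y)) (r *\<^sub>R t) = ?q * series c t + ?k" .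
  have "(LINT y|sphere_measure. singular_part c (r *\<^sub>R y)) =
      (LINT y|sphere_measure. ?q * series c ((1 / r) *\<^sub>R y) + ?k)"
    by (rule sphere_integral_cong) (rule polar)
  also have "\<dots> = sphere_area TYPE('a) * (?q * series c 0 + ?k)"
    unfolding sphere_integral_add[OF cq continuous_on_const] sphere_integral_const
      integral_mult_right_zero mv by (simp only: distrib_left mult_ac)
  finally have a: "(LINT y|sphere_measure. singular_part c (r *\<^sub>R y)) / sphere_area TYPE('a) = ?q * series c 0 + ?k"
    using sphere_area_pos[where 'a='a] by simp
  note sm = sigma_mean_def[of "singular_part c" t r, unfolded m a]
  show ?thesis
  proof (cases "DIM('a) = 2")
    case True
    have "ln r \<noteq> 0" using r by simp
    then show ?thesis unfolding sm using True by (simp add: Let_def field_simps)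
  next
    case False
    then show ?thesis unfolding sm using r by (simp add: Let_def)
  qed
qed

lemma sigma_mean_decomposed:
  fixes u :: "'a \<Rightarrow> real"
  assumes dim: "DIM('a) \<ge> 2" and R: "R > 0" and a: "admissible a R" and c: "entire c"
    and u: "\<And>x. 0 < norm x \<Longrightarrow> norm x < R \<Longrightarrow> u x = series a x + singular_part c x" and t: "t \<in> usphere"
  shows "(sigma_mean u t \<longlongrightarrow> series c t) (at_right 0)"
proof -
  have "((\<lambda>r. sigma_mean (series a) t r + series c t) \<longlongrightarrow> 0 + series c t) (at_right 0)"
    by (intro tendsto_intros sigma_mean_regular[OF dim harmonic_series[OF a] R t])
  moreover have "\<forall>\<^sub>F r in at_right 0. sigma_mean u t r = sigma_mean (series a) t r + series c t"
  proof (rule eventually_at_right_0[of "min R 1"])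
    fix r :: real assume r: "0 < r" "r < min R 1"
    have "sigma_mean u t r = sigma_mean (\<lambda>x. series a x + singular_part c x) t r"
      by (rule sigma_mean_cong, rule u) (use r in auto)
    also have "\<dots> = sigma_mean (series a) t r + sigma_mean (singular_part c) t r"
    proof (rule sigma_mean_add)
      show "continuous_on usphere (\<lambda>y. series a (r *\<^sub>R y))"
        by (rule continuous_on_dilation_sphere[of R])
          (use r in \<open>auto intro: continuous_on_subset[OF harmonic_on_continuous[OF harmonic_series[OF a]]]\<close>)
      show "continuous_on usphere (\<lambda>y. singular_part c (r *\<^sub>R y))"
        by (rule continuous_on_dilation_sphere[of R])
          (use r in \<open>auto intro: continuous_on_subset[OF harmonic_on_continuous[OF harmonic_singular_part[OF c dim]]]\<close>)
    qed (use r t in auto)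
    finally show "sigma_mean u t r = sigma_mean (series a) t r + series c t"
      using r by (simp add: sigma_mean_singular_part[OF c _ _ t])
  qed (use R in simp)
  ultimately show ?thesis by (simp add: tendsto_cong)
qed

end

section \<open>The space of entire series and the trace theorem\<close>

context harmonic_basis
begin

text \<open>The coefficients of an entire series are its spherical coefficients on the unit sphere.\<close>

lemma singular_part_eq_0I:
  assumes c: "entire c" and z: "\<And>x. x \<in> usphere \<Longrightarrow> series c x = 0"
  shows "singular_part c x = 0"
proof -
  have c0: "c i = 0" if i: "i \<in> I" for i
  proof -
    have "c i = coeff (\<lambda>x. series c (1 *\<^sub>R x)) i" using coeff_series_entire[OF c _ i, of 1] by simp
    also have "\<dots> = coeff (\<lambda>x. 0) i" by (rule coeff_cong) (simp add: z)
    finally show ?thesis by (simp add: coeff_def)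
  qed
  have "series c y = 0" for y unfolding series_def using c0 by (intro infsum_0) simp
  then show ?thesis by (simp add: singular_part_def)
qed

end

lemma powi_eq_inverse_power: "h powi (- 2 * int k) = (1 / h) ^ (2 * k)" for h :: real
proof -
  have "h powi (- 2 * int k) = h powi (- int (2 * k))" by simp
  also have "\<dots> = inverse (h ^ (2 * k))" by (simp only: power_int_minus power_int_of_nat)
  finally show ?thesis by (simp add: power_one_over inverse_eq_divide)
qed

lemma spherical_harmonic_onb_imp_harmonic_basis:
  fixes Y :: "nat \<Rightarrow> nat \<Rightarrow> 'a::euclidean_space \<Rightarrow> real"
  assumes onb: "spherical_harmonic_onb d Y"
  obtains P where "harmonic_basis (harmonic_index d) fst P"
    "\<And>k l x. (k, l) \<in> harmonic_index d \<Longrightarrow> x \<in> usphere \<Longrightarrow> Y k l x = P (k, l) x"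
proof -
  have "\<forall>p\<in>harmonic_index d. \<exists>P. (\<forall>t x. P (t *\<^sub>R x) = t ^ fst p * P x) \<and>
          harmonic_on P UNIV \<and> (\<forall>x\<in>usphere. Y (fst p) (snd p) x = P x)"
  proof
    fix p assume p: "p \<in> harmonic_index d"
    have "\<forall>(k,l)\<in>harmonic_index d. spherical_harmonic k (Y k l)"
      using onb unfolding spherical_harmonic_onb_def by (rule conjunct1)
    then have "spherical_harmonic (fst p) (Y (fst p) (snd p))"
      using p by (simp add: case_prod_beta)
    then show "\<exists>P. (\<forall>t x. P (t *\<^sub>R x) = t ^ fst p * P x) \<and>
          harmonic_on P UNIV \<and> (\<forall>x\<in>usphere. Y (fst p) (snd p) x = P x)"
      unfolding spherical_harmonic_def by blast
  qed
  then obtain P where P: "\<And>p. p \<in> harmonic_index d \<Longrightarrow> (\<forall>t x. P p (t *\<^sub>R x) = t ^ fst p * P p x) \<and>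
          harmonic_on (P p) UNIV \<and> (\<forall>x\<in>usphere. Y (fst p) (snd p) x = P p x)"
    by metis
  have orth: "(LINT x|sphere_measure. P i x * P j x) = (if i = j then 1 else 0)"
    if i: "i \<in> harmonic_index d" and j: "j \<in> harmonic_index d" for i j
  proof -
    have "(LINT x|sphere_measure. P i x * P j x) =
        (LINT x|sphere_measure. Y (fst i) (snd i) x * Y (fst j) (snd j) x)"
      by (rule sphere_integral_cong) (use P i j in simp)
    also have "\<dots> = (if i = j then 1 else 0)"
    proof -
      have "\<forall>(k,l)\<in>harmonic_index d. \<forall>(k',l')\<in>harmonic_index d.
          (LINT x|sphere_measure. Y k l x * Y k' l' x) = (if (k,l) = (k',l') then 1 else 0)"
        using onb unfolding spherical_harmonic_onb_def by (elim conjE)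
      then show ?thesis using i j by (simp add: case_prod_beta prod_eq_iff)
    qed
    finally show ?thesis .
  qed
  have "\<exists>F c. finite F \<and> F \<subseteq> harmonic_index d \<and>
      (LINT x|sphere_measure. (g x - (\<Sum>i\<in>F. c i * P i x))\<^sup>2) < e"
    if g: "continuous_on usphere g" and e: "e > 0" for g :: "'a \<Rightarrow> real" and e
  proof -
    have dense: "\<forall>f. f \<in> borel_measurable sphere_measure \<and> integrable sphere_measure (\<lambda>x. (f x)\<^sup>2) \<longrightarrow>
        (\<forall>\<epsilon>>0. \<exists>F c. finite F \<and> F \<subseteq> harmonic_index d \<and>
           (LINT x|sphere_measure. (f x - (\<Sum>(k,l)\<in>F. c k l * Y k l x))\<^sup>2) < \<epsilon>)"
      using onb unfolding spherical_harmonic_onb_def by (elim conjE)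
    have "g \<in> borel_measurable sphere_measure" by (rule continuous_on_borel_measurable_sphere[OF g])
    moreover have "integrable sphere_measure (\<lambda>x. (g x)\<^sup>2)"
      by (intro continuous_on_integrable_sphere continuous_intros g)
    ultimately have "\<exists>F c. finite F \<and> F \<subseteq> harmonic_index d \<and>
       (LINT x|sphere_measure. (g x - (\<Sum>(k,l)\<in>F. c k l * Y k l x))\<^sup>2) < e"
      using dense e by blast
    then obtain F c where F: "finite F" "F \<subseteq> harmonic_index d"
      "(LINT x|sphere_measure. (g x - (\<Sum>(k,l)\<in>F. c k l * Y k l x))\<^sup>2) < e"
      by blast
    have "(LINT x|sphere_measure. (g x - (\<Sum>i\<in>F. c (fst i) (snd i) * P i x))\<^sup>2) =
       (LINT x|sphere_measure. (g x - (\<Sum>(k,l)\<in>F. c k l * Y k l x))\<^sup>2)"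
    proof (rule sphere_integral_cong)
      fix x :: 'a assume x: "x \<in> usphere"
      have "(\<Sum>i\<in>F. c (fst i) (snd i) * P i x) = (\<Sum>(k,l)\<in>F. c k l * Y k l x)"
        using F(2) P x by (intro sum.cong refl) (auto simp: case_prod_beta)
      then show "(g x - (\<Sum>i\<in>F. c (fst i) (snd i) * P i x))\<^sup>2 = (g x - (\<Sum>(k,l)\<in>F. c k l * Y k l x))\<^sup>2"
        by simp
    qed
    then show ?thesis using F by (intro exI[of _ F] exI[of _ "\<lambda>i. c (fst i) (snd i)"]) simp
  qed
  then have "harmonic_basis (harmonic_index d) fst P"
    using P orth by unfold_locales blast+
  then show ?thesis using that P by (metis fst_conv snd_conv)
qed

text \<open>Replacing \<open>h\<close> by \<open>1 / h\<close> turns the finiteness of all norms of \<open>A(\<Theta>)\<close> into admissibility for all radii,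
  and the pointwise expansion identifies \<open>\<psi>\<close> with the series.\<close>

lemma A_space_eq_entire_series:
  fixes Y :: "nat \<Rightarrow> nat \<Rightarrow> 'a::euclidean_space \<Rightarrow> real"
  assumes basis: "harmonic_basis (harmonic_index d) fst P"
    and Y: "\<And>k l x. (k, l) \<in> harmonic_index d \<Longrightarrow> x \<in> usphere \<Longrightarrow> Y k l x = P (k, l) x"
  shows series_in_A_space:
      "harmonic_basis.entire (harmonic_index d) fst c \<Longrightarrow>
         harmonic_basis.series (harmonic_index d) P c \<in> A_space d Y"
    and A_space_series: "\<psi> \<in> A_space d Y \<Longrightarrow>
         \<exists>c. harmonic_basis.entire (harmonic_index d) fst c \<and>
             (\<forall>x\<in>usphere. \<psi> x = harmonic_basis.series (harmonic_index d) P c x)"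
proof -
  interpret harmonic_basis "harmonic_index d" fst P by (rule basis)
  have hc: "harmonic_coeff Y \<psi> k l = coeff \<psi> (k, l)" if "(k, l) \<in> harmonic_index d" for \<psi> k l
    unfolding harmonic_coeff_def coeff_def by (rule sphere_integral_cong) (simp add: Y[OF that])
  have adm: "admissible (coeff \<psi>) (1 / h) \<longleftrightarrow>
     (\<lambda>(k,l). \<bar>harmonic_coeff Y \<psi> k l\<bar>\<^sup>2 * h powi (- 2 * int k)) summable_on harmonic_index d" for \<psi> h
    unfolding admissible_def
  proof (rule summable_on_cong)
    fix p assume "p \<in> harmonic_index d"
    then show "(coeff \<psi> p)\<^sup>2 * (1 / h) ^ (2 * fst p) =
        (case p of (k, l) \<Rightarrow> \<bar>harmonic_coeff Y \<psi> k l\<bar>\<^sup>2 * h powi (- 2 * int k))"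
      by (cases p) (simp only: hc powi_eq_inverse_power prod.case power2_abs fst_conv)
  qed
  show "series c \<in> A_space d Y" if c: "entire c"
  proof -
    have cf: "coeff (series c) i = c i" if "i \<in> harmonic_index d" for i
      using coeff_series_entire[OF c _ that, of 1] by simp
    have "integrable sphere_measure (series c)"
      using series_continuous_sphere[OF c, of 1] by (intro continuous_on_integrable_sphere) simp
    moreover have "((\<lambda>(k,l). harmonic_coeff Y (series c) k l * Y k l x) has_sum series c x) (harmonic_index d)"
      if x: "x \<in> usphere" for x
    proof -
      have "((\<lambda>i. c i * P i x) has_sum series c x) (harmonic_index d)"
        by (rule admissible_has_sum[of c 2]) (use c x in \<open>auto intro: entire_admissible\<close>)
      then show ?thesis
        by (rule has_sum_cong[THEN iffD1, rotated]) (auto simp: hc cf Y[OF _ x])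
    qed
    moreover have "(\<lambda>(k,l). \<bar>harmonic_coeff Y (series c) k l\<bar>\<^sup>2 * h powi (- 2 * int k)) summable_on harmonic_index d"
      if h: "h \<in> {0<..<1}" for h
    proof -
      have "admissible c (1 / h)" using c h by (intro entire_admissible) auto
      then have "admissible (coeff (series c)) (1 / h)"
        unfolding admissible_def by (rule summable_on_cong[THEN iffD1, rotated]) (simp add: cf)
      then show ?thesis unfolding adm .
    qed
    ultimately show ?thesis unfolding A_space_def by blast
  qed
  show "\<exists>c. entire c \<and> (\<forall>x\<in>usphere. \<psi> x = series c x)" if \<psi>: "\<psi> \<in> A_space d Y"
  proof (intro exI[of _ "coeff \<psi>"] conjI ballI)
    show "entire (coeff \<psi>)" unfolding entire_def
    proof (intro allI impI)
      fix r :: real assume r: "r > 0"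
      \<comment> \<open>The norms are indexed by \<open>h < 1\<close>; smaller radii follow by monotonicity.\<close>
      define h where "h = min (1 / r) (1 / 2)"
      have h: "h \<in> {0<..<1}" "r \<le> 1 / h" using r by (auto simp: h_def min_def field_simps)
      have "admissible (coeff \<psi>) (1 / h)" unfolding adm using \<psi> h(1) by (auto simp: A_space_def)
      then show "admissible (coeff \<psi>) r" by (rule admissible_mono) (use r h in auto)
    qed
    fix x :: 'a assume x: "x \<in> usphere"
    have "((\<lambda>(k,l). harmonic_coeff Y \<psi> k l * Y k l x) has_sum \<psi> x) (harmonic_index d)"
      using \<psi> x by (auto simp: A_space_def)
    then have "((\<lambda>i. coeff \<psi> i * P i x) has_sum \<psi> x) (harmonic_index d)"
      by (rule has_sum_cong[THEN iffD1, rotated]) (auto simp: hc Y[OF _ x])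
    then show "\<psi> x = series (coeff \<psi>) x" unfolding series_def by (simp add: infsumI)
  qed
qed

theorem lemma5p2p1:
  fixes \<Omega> :: "'a::euclidean_space set"
    and d :: "nat \<Rightarrow> nat"
    and Y :: "nat \<Rightarrow> nat \<Rightarrow> 'a \<Rightarrow> real"
  assumes dim: "DIM('a) \<ge> 2"
    and onb: "spherical_harmonic_onb d Y"
    and domain: "open \<Omega>" "connected \<Omega>" "bounded \<Omega>" "0 \<in> \<Omega>"
    and boundary: "smooth_boundary \<Omega>"
  shows "(\<forall>u. harmonic_on u (\<Omega> - {0}) \<longrightarrow> (\<exists>\<psi>\<in>A_space d Y. has_sigma_trace u \<psi>)) \<and>
    (\<forall>\<psi>\<in>A_space d Y.
       (\<exists>u. harmonic_on u (\<Omega> - {0}) \<and> has_sigma_trace u \<psi>) \<and>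
       (\<forall>u u'. harmonic_on u (\<Omega> - {0}) \<and> has_sigma_trace u \<psi> \<and> harmonic_on u' (\<Omega> - {0}) \<longrightarrow>
          (has_sigma_trace u' \<psi> \<longleftrightarrow>
            (\<exists>V w. open V \<and> 0 \<in> V \<and> harmonic_on w V \<and>
                   (\<forall>x\<in>V \<inter> (\<Omega> - {0}). u' x = u x + w x)))))"
proof -
  obtain P where basis: "harmonic_basis (harmonic_index d) fst P"
    and Y: "\<And>k l x. (k, l) \<in> harmonic_index d \<Longrightarrow> x \<in> usphere \<Longrightarrow> Y k l x = P (k, l) x"
    using spherical_harmonic_onb_imp_harmonic_basis[OF onb] by metis
  interpret harmonic_basis "harmonic_index d" fst P by (rule basis)
  obtain R where R: "R > 0" "cball 0 R \<subseteq> \<Omega>" using domain(1,4) open_contains_cball by metis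
  have R': "ball 0 R - {0} \<subseteq> \<Omega> - {0}" using R(2) ball_subset_cball by blast
  have trace_iff: "has_sigma_trace u \<psi> \<longleftrightarrow> (\<forall>t\<in>usphere. (sigma_mean u t \<longlongrightarrow> \<psi> t) (at_right 0))"
    if "harmonic_on u (\<Omega> - {0})" for u \<psi>
    by (rule has_sigma_trace_iff[OF continuous_on_subset[OF harmonic_on_continuous[OF that] R'] R(1)])
  have expand: "\<exists>a c. admissible a (R / 2) \<and> entire c \<and>
      (\<forall>x. 0 < norm x \<longrightarrow> norm x < R / 2 \<longrightarrow> u x = series a x + singular_part c x) \<and>
      has_sigma_trace u (series c)"
    if u: "harmonic_on u (\<Omega> - {0})" for u
  proof -
    obtain a c where ac: "admissible a (R / 2)" "entire c"
      "\<And>x. 0 < norm x \<Longrightarrow> norm x < R / 2 \<Longrightarrow> u x = series a x + singular_part c x"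
      by (rule laurent_decomposition[OF dim R(1) u]) (use R(2) in blast)+
    have "has_sigma_trace u (series c)"
      unfolding trace_iff[OF u] using sigma_mean_decomposed[OF dim _ ac] R(1) by simp
    then show ?thesis using ac by blast
  qed
  have trace_unique: "\<psi> t = \<psi>' t"
    if "harmonic_on u (\<Omega> - {0})" "has_sigma_trace u \<psi>" "has_sigma_trace u \<psi>'" "t \<in> usphere" for u \<psi> \<psi>' t
    using that(2-4) unfolding trace_iff[OF that(1)] by (meson tendsto_unique trivial_limit_at_right_real)
  show ?thesis
  proof (intro conjI allI impI ballI)
    fix u assume "harmonic_on u (\<Omega> - {0})"
    from expand[OF this] show "\<exists>\<psi>\<in>A_space d Y. has_sigma_trace u \<psi>"
      using series_in_A_space[OF basis Y] by blast
  next
    fix \<psi> assume \<psi>: "\<psi> \<in> A_space d Y"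
    obtain c where c: "entire c" "\<forall>x\<in>usphere. \<psi> x = series c x"
      using A_space_series[OF basis Y \<psi>] by blast
    have h: "harmonic_on (singular_part c) (\<Omega> - {0})"
      by (rule harmonic_on_subset[OF harmonic_singular_part[OF c(1) dim]]) (use domain(1) in auto)
    moreover have "has_sigma_trace (singular_part c) \<psi>"
      unfolding trace_iff[OF h]
    proof
      fix t :: 'a assume t: "t \<in> usphere"
      have "\<forall>\<^sub>F r in at_right 0. sigma_mean (singular_part c) t r = series c t"
        by (rule eventually_at_right_0[of 1]) (use sigma_mean_singular_part[OF c(1) _ _ t] in auto)
      then show "(sigma_mean (singular_part c) t \<longlongrightarrow> \<psi> t) (at_right 0)"
        using c(2) t by (simp add: tendsto_cong)
    qed
    ultimately show "\<exists>u. harmonic_on u (\<Omega> - {0}) \<and> has_sigma_trace u \<psi>" by blast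
  next
    fix \<psi> u u'
    assume "harmonic_on u (\<Omega> - {0}) \<and> has_sigma_trace u \<psi> \<and> harmonic_on u' (\<Omega> - {0})"
    then have u: "harmonic_on u (\<Omega> - {0})" "has_sigma_trace u \<psi>" and u': "harmonic_on u' (\<Omega> - {0})"
      by auto
    have dil: "continuous_on usphere (\<lambda>y. f (r *\<^sub>R y))"
      if "harmonic_on f S" "ball 0 \<rho> - {0} \<subseteq> S" "0 < r" "r < \<rho>" for f :: "'a \<Rightarrow> real" and S \<rho> r
      by (rule continuous_on_dilation_sphere[OF continuous_on_subset[OF harmonic_on_continuous[OF that(1)] that(2)] that(3,4)])
    show "has_sigma_trace u' \<psi> \<longleftrightarrow>
       (\<exists>V w. open V \<and> 0 \<in> V \<and> harmonic_on w V \<and> (\<forall>x\<in>V \<inter> (\<Omega> - {0}). u' x = u x + w x))"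
    proof
      assume tr': "has_sigma_trace u' \<psi>"
      define v where "v x = u' x - u x" for x
      have v: "harmonic_on v (\<Omega> - {0})" unfolding v_def by (rule harmonic_on_diff[OF u' u(1)])
      obtain a c where ac: "admissible a (R / 2)" "entire c"
        "\<And>x. 0 < norm x \<Longrightarrow> norm x < R / 2 \<Longrightarrow> v x = series a x + singular_part c x"
        "has_sigma_trace v (series c)"
        using expand[OF v] by blast
      have "has_sigma_trace v (\<lambda>_. 0)" unfolding trace_iff[OF v]
      proof
        fix t :: 'a assume t: "t \<in> usphere"
        have "((\<lambda>r. sigma_mean u' t r - sigma_mean u t r) \<longlongrightarrow> \<psi> t - \<psi> t) (at_right 0)"
          using tr' u(2) t unfolding trace_iff[OF u'] trace_iff[OF u(1)] by (intro tendsto_diff) auto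
        moreover have "\<forall>\<^sub>F r in at_right 0. sigma_mean v t r = sigma_mean u' t r - sigma_mean u t r"
        proof (rule eventually_at_right_0[of "min R 1"])
          fix r :: real assume r: "0 < r" "r < min R 1"
          have "sigma_mean (\<lambda>x. u x + v x) t r = sigma_mean u t r + sigma_mean v t r"
            by (rule sigma_mean_add[OF dil[OF u(1) R'] dil[OF v R'] _ _ t]) (use r in auto)
          then show "sigma_mean v t r = sigma_mean u' t r - sigma_mean u t r" by (simp add: v_def)
        qed (use R(1) in simp)
        ultimately show "(sigma_mean v t \<longlongrightarrow> 0) (at_right 0)" by (simp add: tendsto_cong)
      qed
      then have "series c x = 0" if "x \<in> usphere" for x
        using trace_unique[OF v ac(4)] that by blast
      then have "singular_part c x = 0" for x by (rule singular_part_eq_0I[OF ac(2)])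
      then have "u' x = u x + series a x" if "0 < norm x" "norm x < R / 2" for x
        using ac(3)[OF that] by (simp add: v_def)
      then show "\<exists>V w. open V \<and> 0 \<in> V \<and> harmonic_on w V \<and> (\<forall>x\<in>V \<inter> (\<Omega> - {0}). u' x = u x + w x)"
        using harmonic_series[OF ac(1)] R(1)
        by (intro exI[of _ "ball 0 (R / 2)"] exI[of _ "series a"]) auto
    next
      assume "\<exists>V w. open V \<and> 0 \<in> V \<and> harmonic_on w V \<and> (\<forall>x\<in>V \<inter> (\<Omega> - {0}). u' x = u x + w x)"
      then obtain V w where V: "open V" "0 \<in> V" "harmonic_on w V"
        "\<And>x. x \<in> V \<inter> (\<Omega> - {0}) \<Longrightarrow> u' x = u x + w x" by blast
      obtain r0 where r0: "r0 > 0" "ball 0 r0 \<subseteq> V" using V(1,2) open_contains_ball by metis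
      define \<rho> where "\<rho> = min r0 R"
      have \<rho>: "\<rho> > 0" "ball 0 \<rho> \<subseteq> V" "ball 0 \<rho> - {0} \<subseteq> \<Omega> - {0}" using r0 R(1) R' by (auto simp: \<rho>_def)
      have wh: "harmonic_on w (ball 0 \<rho>)" by (rule harmonic_on_subset[OF V(3) open_ball \<rho>(2)])
      show "has_sigma_trace u' \<psi>" unfolding trace_iff[OF u']
      proof
        fix t :: 'a assume t: "t \<in> usphere"
        have "((\<lambda>r. sigma_mean u t r + sigma_mean w t r) \<longlongrightarrow> \<psi> t + 0) (at_right 0)"
          using u(2) t unfolding trace_iff[OF u(1)]
          by (intro tendsto_add sigma_mean_regular[OF dim wh \<rho>(1) t]) auto
        moreover have "\<forall>\<^sub>F r in at_right 0. sigma_mean u' t r = sigma_mean u t r + sigma_mean w t r"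
        proof (rule eventually_at_right_0[of "min \<rho> 1"])
          fix r :: real assume r: "0 < r" "r < min \<rho> 1"
          have "sigma_mean u' t r = sigma_mean (\<lambda>x. u x + w x) t r"
          proof (rule sigma_mean_cong, rule V(4))
            fix y :: 'a assume "y \<in> usphere"
            then have "r *\<^sub>R y \<in> ball 0 \<rho> - {0}" using r by auto
            then show "r *\<^sub>R y \<in> V \<inter> (\<Omega> - {0})" using \<rho> by blast
          qed
          also have "\<dots> = sigma_mean u t r + sigma_mean w t r"
            by (rule sigma_mean_add[OF dil[OF u(1) \<rho>(3)] dil[OF wh Diff_subset] _ _ t]) (use r in auto)
          finally show "sigma_mean u' t r = sigma_mean u t r + sigma_mean w t r" .
        qed (use \<rho>(1) in simp)
        ultimately show "(sigma_mean u' t \<longlongrightarrow> \<psi> t) (at_right 0)" by (simp add: tendsto_cong)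
      qed
    qed
  qed
qed

end
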